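(* Let $A$ be a finite-dimensional $\Bbbk$-algebra and $\mathcal X\simeq A\text{-mod}$ a finite linear category, identified with $A\text{-mod}$. Then the Nakayama functor $\mathrm N^{\rm r}_{\mathcal X}=\int^{x\in\mathcal X}\mathrm{Hom}_{\mathcal X}(-,x)^*\otimes x$ satisfies $$\mathrm N^{\rm r}_{\mathcal X}\;\cong\;({}_AA_A)^*\otimes_A{-}\,.$$
   Context: $\Bbbk$ is an algebraically closed field; $A\text{-mod}$ is the category of finite-dimensional left $A$-modules. $({}_AA_A)^*$ is the co-regular $A$-bimodule, i.e. the dual vector space of $A$ with actions dual to the regular ones. $\int^x$ is a coend; for a finite-dimensional vector space $v$, $v^*$ is its dual and $v\otimes x\in\mathcal X$ is the object with $\mathrm{Hom}_{\mathcal X}(-,v\otimes x)\cong v\otimes_{\Bbbk}\mathrm{Hom}_{\mathcal X}(-,x)$. *)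

theory Defs
  imports "HOL-Algebra.Algebraic_Closure" "Jordan_Normal_Form.Missing_VectorSpace"
begin

hide_const (open) Multiset.mult

section \<open>Linear algebra over a field\<close>

text \<open>
  Vector spaces are the carrier-based ones of \<^locale>\<open>vectorspace\<close>; the fields \<^const>\<open>mult\<close> and
  \<^const>\<open>one\<close> that their record type inherits from rings carry no meaning and are left undefined.
  Maps between carriers are normalised to be extensional, so that equality of maps is equality on
  the carrier.
\<close>

definition map_space :: "'s set \<Rightarrow> ('k, 'w, 'x) module_scheme \<Rightarrow> ('s \<Rightarrow> 'w) set \<Rightarrow> ('k, 's \<Rightarrow> 'w) module"
  where "map_space S W H =
    \<lparr>carrier = H, mult = undefined, one = undefined,
     zero = (\<lambda>s\<in>S. \<zero>\<^bsub>W\<^esub>),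
     add = (\<lambda>f g. \<lambda>s\<in>S. f s \<oplus>\<^bsub>W\<^esub> g s),
     smult = (\<lambda>c f. \<lambda>s\<in>S. c \<odot>\<^bsub>W\<^esub> f s)\<rparr>"

definition ground_space :: "'k ring \<Rightarrow> ('k, 'k) module"
  where "ground_space K =
    \<lparr>carrier = carrier K, mult = mult K, one = one K, zero = zero K, add = add K, smult = mult K\<rparr>"

definition dual :: "'k ring \<Rightarrow> ('k, 'v, 'x) module_scheme \<Rightarrow> ('k, 'v \<Rightarrow> 'k) module"
  where "dual K V = map_space (carrier V) (ground_space K)
    (module_hom K V (ground_space K) \<inter> extensional (carrier V))"

definition dual_map ::
  "'k ring \<Rightarrow> ('k, 'v, 'x) module_scheme \<Rightarrow> ('k, 'w, 'y) module_scheme \<Rightarrow> ('v \<Rightarrow> 'w) \<Rightarrow> ('w \<Rightarrow> 'k) \<Rightarrow> ('v \<Rightarrow> 'k)"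
  where "dual_map K V W f = (\<lambda>\<phi>\<in>carrier (dual K W). compose (carrier V) \<phi> f)"

definition free_space :: "'k ring \<Rightarrow> 's set \<Rightarrow> ('k, 's \<Rightarrow> 'k) module"
  where "free_space K S =
    \<lparr>carrier = {\<phi>. \<phi> \<in> S \<rightarrow> carrier K \<and> (\<forall>s. s \<notin> S \<longrightarrow> \<phi> s = \<zero>\<^bsub>K\<^esub>) \<and> finite {s. \<phi> s \<noteq> \<zero>\<^bsub>K\<^esub>}},
     mult = undefined, one = undefined,
     zero = (\<lambda>s. \<zero>\<^bsub>K\<^esub>),
     add = (\<lambda>\<phi> \<psi> s. \<phi> s \<oplus>\<^bsub>K\<^esub> \<psi> s),
     smult = (\<lambda>c \<phi> s. c \<otimes>\<^bsub>K\<^esub> \<phi> s)\<rparr>"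

definition delta :: "'k ring \<Rightarrow> 's \<Rightarrow> 's \<Rightarrow> 'k"
  where "delta K s = (\<lambda>t. if t = s then \<one>\<^bsub>K\<^esub> else \<zero>\<^bsub>K\<^esub>)"

definition quotient_space :: "('k, 'v) module \<Rightarrow> 'v set \<Rightarrow> ('k, 'v set) module"
  where "quotient_space V W =
    \<lparr>carrier = a_rcosets\<^bsub>V\<^esub> W, mult = undefined, one = undefined,
     zero = W,
     add = (\<lambda>C D. C <+>\<^bsub>V\<^esub> D),
     smult = (\<lambda>c C. \<Union>v\<in>C. W +>\<^bsub>V\<^esub> (c \<odot>\<^bsub>V\<^esub> v))\<rparr>"


section \<open>Algebras, modules and tensor products\<close>

locale fd_algebra =
  fixes K :: "'k ring" and A :: "('k, 'a) module"
  assumes vectorspace: "vectorspace K A"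
    and fin_dim: "vectorspace.fin_dim K A"
    and ring: "ring A"
    and smult_mult_left: "\<And>c a b. c \<in> carrier K \<Longrightarrow> a \<in> carrier A \<Longrightarrow> b \<in> carrier A
      \<Longrightarrow> (c \<odot>\<^bsub>A\<^esub> a) \<otimes>\<^bsub>A\<^esub> b = c \<odot>\<^bsub>A\<^esub> (a \<otimes>\<^bsub>A\<^esub> b)"
    and smult_mult_right: "\<And>c a b. c \<in> carrier K \<Longrightarrow> a \<in> carrier A \<Longrightarrow> b \<in> carrier A
      \<Longrightarrow> a \<otimes>\<^bsub>A\<^esub> (c \<odot>\<^bsub>A\<^esub> b) = c \<odot>\<^bsub>A\<^esub> (a \<otimes>\<^bsub>A\<^esub> b)"

record ('k, 'a, 'm) lmod = "('k, 'm) module" +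
  lact :: "'a \<Rightarrow> 'm \<Rightarrow> 'm"

record ('k, 'a, 'm) rmod = "('k, 'm) module" +
  ract :: "'m \<Rightarrow> 'a \<Rightarrow> 'm"

record ('k, 'a, 'm) bimod = "('k, 'a, 'm) rmod" +
  blact :: "'a \<Rightarrow> 'm \<Rightarrow> 'm"

locale fd_lmodule =
  fixes K :: "'k ring" and A :: "('k, 'a) module" and M :: "('k, 'a, 'm) lmod"
  assumes vectorspace: "vectorspace K M"
    and fin_dim: "vectorspace.fin_dim K M"
    and lact_closed: "\<And>a m. a \<in> carrier A \<Longrightarrow> m \<in> carrier M \<Longrightarrow> lact M a m \<in> carrier M"
    and lact_add_left: "\<And>a b m. a \<in> carrier A \<Longrightarrow> b \<in> carrier A \<Longrightarrow> m \<in> carrier M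
      \<Longrightarrow> lact M (a \<oplus>\<^bsub>A\<^esub> b) m = lact M a m \<oplus>\<^bsub>M\<^esub> lact M b m"
    and lact_add_right: "\<And>a m n. a \<in> carrier A \<Longrightarrow> m \<in> carrier M \<Longrightarrow> n \<in> carrier M
      \<Longrightarrow> lact M a (m \<oplus>\<^bsub>M\<^esub> n) = lact M a m \<oplus>\<^bsub>M\<^esub> lact M a n"
    and lact_smult_left: "\<And>c a m. c \<in> carrier K \<Longrightarrow> a \<in> carrier A \<Longrightarrow> m \<in> carrier M
      \<Longrightarrow> lact M (c \<odot>\<^bsub>A\<^esub> a) m = c \<odot>\<^bsub>M\<^esub> lact M a m"
    and lact_smult_right: "\<And>c a m. c \<in> carrier K \<Longrightarrow> a \<in> carrier A \<Longrightarrow> m \<in> carrier M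
      \<Longrightarrow> lact M a (c \<odot>\<^bsub>M\<^esub> m) = c \<odot>\<^bsub>M\<^esub> lact M a m"
    and lact_one: "\<And>m. m \<in> carrier M \<Longrightarrow> lact M \<one>\<^bsub>A\<^esub> m = m"
    and lact_mult: "\<And>a b m. a \<in> carrier A \<Longrightarrow> b \<in> carrier A \<Longrightarrow> m \<in> carrier M
      \<Longrightarrow> lact M (a \<otimes>\<^bsub>A\<^esub> b) m = lact M a (lact M b m)"

definition lmod_hom ::
  "'k ring \<Rightarrow> ('k, 'a) module \<Rightarrow> ('k, 'a, 'm) lmod \<Rightarrow> ('k, 'a, 'n) lmod \<Rightarrow> ('m \<Rightarrow> 'n) set"
  where "lmod_hom K A M N =
    {f \<in> module_hom K M N \<inter> extensional (carrier M).
      \<forall>a\<in>carrier A. \<forall>m\<in>carrier M. f (lact M a m) = lact N a (f m)}"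

definition lmod_iso ::
  "'k ring \<Rightarrow> ('k, 'a) module \<Rightarrow> ('k, 'a, 'm) lmod \<Rightarrow> ('k, 'a, 'n) lmod \<Rightarrow> ('m \<Rightarrow> 'n) set"
  where "lmod_iso K A M N = {f \<in> lmod_hom K A M N. bij_betw f (carrier M) (carrier N)}"

text \<open>
  The tensor product of a right module \<open>M\<close> and a left module \<open>N\<close> over \<open>R\<close>, as a \<open>K\<close>-vector space:
  the free vector space on pairs modulo \<open>K\<close>-bilinearity and \<open>R\<close>-balancedness.
\<close>

definition tensor_rels ::
  "'k ring \<Rightarrow> ('r, 'z) ring_scheme \<Rightarrow> ('k, 'r, 'm, 'x) rmod_scheme \<Rightarrow> ('k, 'r, 'n, 'y) lmod_scheme
    \<Rightarrow> ('m \<times> 'n \<Rightarrow> 'k) set"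
  where "tensor_rels K R M N =
    (let F = free_space K (carrier M \<times> carrier N); d = (\<lambda>m n. delta K (m, n)) in
      {d (m \<oplus>\<^bsub>M\<^esub> m') n \<ominus>\<^bsub>F\<^esub> (d m n \<oplus>\<^bsub>F\<^esub> d m' n) |m m' n.
        m \<in> carrier M \<and> m' \<in> carrier M \<and> n \<in> carrier N}
      \<union> {d m (n \<oplus>\<^bsub>N\<^esub> n') \<ominus>\<^bsub>F\<^esub> (d m n \<oplus>\<^bsub>F\<^esub> d m n') |m n n'.
        m \<in> carrier M \<and> n \<in> carrier N \<and> n' \<in> carrier N}
      \<union> {d (c \<odot>\<^bsub>M\<^esub> m) n \<ominus>\<^bsub>F\<^esub> (c \<odot>\<^bsub>F\<^esub> d m n) |c m n.
        c \<in> carrier K \<and> m \<in> carrier M \<and> n \<in> carrier N}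
      \<union> {d m (c \<odot>\<^bsub>N\<^esub> n) \<ominus>\<^bsub>F\<^esub> (c \<odot>\<^bsub>F\<^esub> d m n) |c m n.
        c \<in> carrier K \<and> m \<in> carrier M \<and> n \<in> carrier N}
      \<union> {d (ract M m r) n \<ominus>\<^bsub>F\<^esub> d m (lact N r n) |m r n.
        m \<in> carrier M \<and> r \<in> carrier R \<and> n \<in> carrier N})"

definition tensor_null ::
  "'k ring \<Rightarrow> ('r, 'z) ring_scheme \<Rightarrow> ('k, 'r, 'm, 'x) rmod_scheme \<Rightarrow> ('k, 'r, 'n, 'y) lmod_scheme
    \<Rightarrow> ('m \<times> 'n \<Rightarrow> 'k) set"
  where "tensor_null K R M N =
    module.span K (free_space K (carrier M \<times> carrier N)) (tensor_rels K R M N)"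

definition tensor ::
  "'k ring \<Rightarrow> ('r, 'z) ring_scheme \<Rightarrow> ('k, 'r, 'm, 'x) rmod_scheme \<Rightarrow> ('k, 'r, 'n, 'y) lmod_scheme
    \<Rightarrow> ('k, ('m \<times> 'n \<Rightarrow> 'k) set) module"
  where "tensor K R M N =
    quotient_space (free_space K (carrier M \<times> carrier N)) (tensor_null K R M N)"

definition pure_tensor ::
  "'k ring \<Rightarrow> ('r, 'z) ring_scheme \<Rightarrow> ('k, 'r, 'm, 'x) rmod_scheme \<Rightarrow> ('k, 'r, 'n, 'y) lmod_scheme
    \<Rightarrow> 'm \<Rightarrow> 'n \<Rightarrow> ('m \<times> 'n \<Rightarrow> 'k) set"
  where "pure_tensor K R M N m n =
    tensor_null K R M N +>\<^bsub>free_space K (carrier M \<times> carrier N)\<^esub> delta K (m, n)"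

definition tensor_map ::
  "'k ring \<Rightarrow> ('r, 'z) ring_scheme
    \<Rightarrow> ('k, 'r, 'm, 'x) rmod_scheme \<Rightarrow> ('k, 'r, 'n, 'y) lmod_scheme
    \<Rightarrow> ('k, 'r, 'm1, 'x1) rmod_scheme \<Rightarrow> ('k, 'r, 'n1, 'y1) lmod_scheme
    \<Rightarrow> ('m \<Rightarrow> 'm1) \<Rightarrow> ('n \<Rightarrow> 'n1) \<Rightarrow> ('m \<times> 'n \<Rightarrow> 'k) set \<Rightarrow> ('m1 \<times> 'n1 \<Rightarrow> 'k) set"
  where "tensor_map K R M N M' N' f g =
    (THE h. h \<in> module_hom K (tensor K R M N) (tensor K R M' N') \<inter> extensional (carrier (tensor K R M N))
      \<and> (\<forall>m\<in>carrier M. \<forall>n\<in>carrier N.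
            h (pure_tensor K R M N m n) = pure_tensor K R M' N' (f m) (g n)))"

definition space_lmod :: "('k, 'v) module \<Rightarrow> ('k, 'k, 'v) lmod"
  where "space_lmod V =
    \<lparr>carrier = carrier V, mult = mult V, one = one V, zero = zero V, add = add V, smult = smult V,
     lact = (\<lambda>c v. c \<odot>\<^bsub>V\<^esub> v)\<rparr>"

definition space_rmod :: "('k, 'v) module \<Rightarrow> ('k, 'k, 'v) rmod"
  where "space_rmod V =
    \<lparr>carrier = carrier V, mult = mult V, one = one V, zero = zero V, add = add V, smult = smult V,
     ract = (\<lambda>v c. c \<odot>\<^bsub>V\<^esub> v)\<rparr>"

definition space_tensor ::
  "'k ring \<Rightarrow> ('k, 'v) module \<Rightarrow> ('k, 'w) module \<Rightarrow> ('k, ('v \<times> 'w \<Rightarrow> 'k) set) module"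
  where "space_tensor K V W = tensor K K (space_rmod V) (space_lmod W)"

definition space_tensor_map ::
  "'k ring \<Rightarrow> ('k, 'v) module \<Rightarrow> ('k, 'w) module \<Rightarrow> ('k, 'v1) module \<Rightarrow> ('k, 'w1) module
    \<Rightarrow> ('v \<Rightarrow> 'v1) \<Rightarrow> ('w \<Rightarrow> 'w1) \<Rightarrow> ('v \<times> 'w \<Rightarrow> 'k) set \<Rightarrow> ('v1 \<times> 'w1 \<Rightarrow> 'k) set"
  where "space_tensor_map K V W V' W' =
    tensor_map K K (space_rmod V) (space_lmod W) (space_rmod V') (space_lmod W')"

text \<open>The co-regular bimodule: \<open>(a.\<phi>)(b) = \<phi>(b a)\<close> and \<open>(\<phi>.a)(b) = \<phi>(a b)\<close>.\<close>

definition coregular :: "'k ring \<Rightarrow> ('k, 'a) module \<Rightarrow> ('k, 'a, 'a \<Rightarrow> 'k) bimod"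
  where "coregular K A =
    (let D = dual K A in
    \<lparr>carrier = carrier D, mult = mult D, one = one D, zero = zero D, add = add D, smult = smult D,
     ract = (\<lambda>\<phi> a. \<lambda>b\<in>carrier A. \<phi> (a \<otimes>\<^bsub>A\<^esub> b)),
     blact = (\<lambda>a \<phi>. \<lambda>b\<in>carrier A. \<phi> (b \<otimes>\<^bsub>A\<^esub> a))\<rparr>)"

definition bimod_tensor ::
  "'k ring \<Rightarrow> ('k, 'a) module \<Rightarrow> ('k, 'a, 'b) bimod \<Rightarrow> ('k, 'a, 'm) lmod
    \<Rightarrow> ('k, 'a, ('b \<times> 'm \<Rightarrow> 'k) set) lmod"
  where "bimod_tensor K A B M =
    (let T = tensor K A B M in
    \<lparr>carrier = carrier T, mult = mult T, one = one T, zero = zero T, add = add T, smult = smult T,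
     lact = (\<lambda>a. tensor_map K A B M B M (blact B a) (\<lambda>m. m))\<rparr>)"


section \<open>Linear categories\<close>

text \<open>
  \<open>cmp \<X> x y z g f\<close> is the composite of \<open>f : x \<rightarrow> y\<close> and \<open>g : y \<rightarrow> z\<close>.  Hom-spaces for different
  pairs of objects need not be disjoint, so composition takes the objects as arguments.
\<close>

record ('o, 'm, 'k) lcat =
  Obj :: "'o set"
  Hom :: "'o \<Rightarrow> 'o \<Rightarrow> ('k, 'm) module"
  idt :: "'o \<Rightarrow> 'm"
  cmp :: "'o \<Rightarrow> 'o \<Rightarrow> 'o \<Rightarrow> 'm \<Rightarrow> 'm \<Rightarrow> 'm"

abbreviation arr :: "('o, 'm, 'k) lcat \<Rightarrow> 'o \<Rightarrow> 'o \<Rightarrow> 'm set"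
  where "arr \<X> x y \<equiv> carrier (Hom \<X> x y)"

locale linear_category =
  fixes K :: "'k ring" and \<X> :: "('o, 'm, 'k) lcat"
  assumes field: "field K"
    and Hom_vectorspace: "\<And>x y. x \<in> Obj \<X> \<Longrightarrow> y \<in> Obj \<X> \<Longrightarrow> vectorspace K (Hom \<X> x y)"
    and idt_arr: "\<And>x. x \<in> Obj \<X> \<Longrightarrow> idt \<X> x \<in> arr \<X> x x"
    and precomp_linear: "\<And>x y z f. x \<in> Obj \<X> \<Longrightarrow> y \<in> Obj \<X> \<Longrightarrow> z \<in> Obj \<X> \<Longrightarrow> f \<in> arr \<X> x y
      \<Longrightarrow> (\<lambda>g. cmp \<X> x y z g f) \<in> module_hom K (Hom \<X> y z) (Hom \<X> x z)"
    and postcomp_linear: "\<And>x y z g. x \<in> Obj \<X> \<Longrightarrow> y \<in> Obj \<X> \<Longrightarrow> z \<in> Obj \<X> \<Longrightarrow> g \<in> arr \<X> y z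
      \<Longrightarrow> (\<lambda>f. cmp \<X> x y z g f) \<in> module_hom K (Hom \<X> x y) (Hom \<X> x z)"
    and cmp_idt_right: "\<And>x y f. x \<in> Obj \<X> \<Longrightarrow> y \<in> Obj \<X> \<Longrightarrow> f \<in> arr \<X> x y
      \<Longrightarrow> cmp \<X> x x y f (idt \<X> x) = f"
    and cmp_idt_left: "\<And>x y f. x \<in> Obj \<X> \<Longrightarrow> y \<in> Obj \<X> \<Longrightarrow> f \<in> arr \<X> x y
      \<Longrightarrow> cmp \<X> x y y (idt \<X> y) f = f"
    and cmp_assoc: "\<And>w x y z f g h. w \<in> Obj \<X> \<Longrightarrow> x \<in> Obj \<X> \<Longrightarrow> y \<in> Obj \<X> \<Longrightarrow> z \<in> Obj \<X>
      \<Longrightarrow> f \<in> arr \<X> w x \<Longrightarrow> g \<in> arr \<X> x y \<Longrightarrow> h \<in> arr \<X> y z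
      \<Longrightarrow> cmp \<X> w y z h (cmp \<X> w x y g f) = cmp \<X> w x z (cmp \<X> x y z h g) f"

record ('o, 'm, 'p, 'n) functr =
  ob :: "'o \<Rightarrow> 'p"
  mor :: "'o \<Rightarrow> 'o \<Rightarrow> 'm \<Rightarrow> 'n"

locale linear_functor =
  fixes K :: "'k ring" and \<X> :: "('o, 'm, 'k) lcat" and Y :: "('p, 'n, 'k) lcat"
    and F :: "('o, 'm, 'p, 'n) functr"
  assumes ob_closed: "\<And>x. x \<in> Obj \<X> \<Longrightarrow> ob F x \<in> Obj Y"
    and mor_linear: "\<And>x y. x \<in> Obj \<X> \<Longrightarrow> y \<in> Obj \<X>
      \<Longrightarrow> mor F x y \<in> module_hom K (Hom \<X> x y) (Hom Y (ob F x) (ob F y))"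
    and mor_idt: "\<And>x. x \<in> Obj \<X> \<Longrightarrow> mor F x x (idt \<X> x) = idt Y (ob F x)"
    and mor_cmp: "\<And>x y z f g. x \<in> Obj \<X> \<Longrightarrow> y \<in> Obj \<X> \<Longrightarrow> z \<in> Obj \<X>
      \<Longrightarrow> f \<in> arr \<X> x y \<Longrightarrow> g \<in> arr \<X> y z
      \<Longrightarrow> mor F x z (cmp \<X> x y z g f)
        = cmp Y (ob F x) (ob F y) (ob F z) (mor F y z g) (mor F x y f)"

definition id_functor :: "('o, 'm, 'o, 'm) functr"
  where "id_functor = \<lparr>ob = (\<lambda>x. x), mor = (\<lambda>x y f. f)\<rparr>"

definition comp_functor ::
  "('p, 'n, 'q, 'l) functr \<Rightarrow> ('o, 'm, 'p, 'n) functr \<Rightarrow> ('o, 'm, 'q, 'l) functr"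
  where "comp_functor G F =
    \<lparr>ob = (\<lambda>x. ob G (ob F x)), mor = (\<lambda>x y f. mor G (ob F x) (ob F y) (mor F x y f))\<rparr>"

definition iso_arr :: "('o, 'm, 'k) lcat \<Rightarrow> 'o \<Rightarrow> 'o \<Rightarrow> 'm set"
  where "iso_arr \<X> x y =
    {f \<in> arr \<X> x y. \<exists>g\<in>arr \<X> y x. cmp \<X> x y x g f = idt \<X> x \<and> cmp \<X> y x y f g = idt \<X> y}"

definition naturally_isomorphic ::
  "('o, 'm, 'k) lcat \<Rightarrow> ('p, 'n, 'k) lcat \<Rightarrow> ('o, 'm, 'p, 'n) functr \<Rightarrow> ('o, 'm, 'p, 'n) functr \<Rightarrow> bool"
  where "naturally_isomorphic \<X> Y F G \<longleftrightarrow>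
    (\<exists>\<eta>. (\<forall>x\<in>Obj \<X>. \<eta> x \<in> iso_arr Y (ob F x) (ob G x))
      \<and> (\<forall>x\<in>Obj \<X>. \<forall>y\<in>Obj \<X>. \<forall>f\<in>arr \<X> x y.
          cmp Y (ob F x) (ob F y) (ob G y) (\<eta> y) (mor F x y f)
          = cmp Y (ob F x) (ob G x) (ob G y) (mor G x y f) (\<eta> x)))"

definition linear_equivalence ::
  "'k ring \<Rightarrow> ('o, 'm, 'k) lcat \<Rightarrow> ('p, 'n, 'k) lcat \<Rightarrow> ('o, 'm, 'p, 'n) functr \<Rightarrow> bool"
  where "linear_equivalence K \<X> Y F \<longleftrightarrow>
    linear_functor K \<X> Y F
    \<and> (\<exists>G. linear_functor K Y \<X> G
        \<and> naturally_isomorphic \<X> \<X> (comp_functor G F) id_functor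
        \<and> naturally_isomorphic Y Y (comp_functor F G) id_functor)"

text \<open>
  The category of finite-dimensional left \<open>A\<close>-modules with carrier in the type \<open>'e\<close>.  For
  \<open>'e = nat \<Rightarrow> 'k\<close> it contains an isomorphic copy of every finite-dimensional \<open>A\<close>-module, because
  that type contains all coordinate spaces; the size of \<open>'e\<close> is then immaterial up to equivalence.
\<close>

definition mod_category :: "'k ring \<Rightarrow> ('k, 'a) module \<Rightarrow> (('k, 'a, 'e) lmod, 'e \<Rightarrow> 'e, 'k) lcat"
  where "mod_category K A =
    \<lparr>Obj = {M. fd_lmodule K A M},
     Hom = (\<lambda>M N. map_space (carrier M) N (lmod_hom K A M N)),
     idt = (\<lambda>M. \<lambda>m\<in>carrier M. m),
     cmp = (\<lambda>L M N g f. compose (carrier L) g f)\<rparr>"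

definition tensor_functor ::
  "'k ring \<Rightarrow> ('k, 'a) module \<Rightarrow> ('k, 'a, 'b) bimod
    \<Rightarrow> (('k, 'a, 'm) lmod, 'm \<Rightarrow> 'm,
        ('k, 'a, ('b \<times> 'm \<Rightarrow> 'k) set) lmod, ('b \<times> 'm \<Rightarrow> 'k) set \<Rightarrow> ('b \<times> 'm \<Rightarrow> 'k) set) functr"
  where "tensor_functor K A B =
    \<lparr>ob = (\<lambda>M. bimod_tensor K A B M),
     mor = (\<lambda>M N f. tensor_map K A B M B N (\<lambda>b. b) f)\<rparr>"

text \<open>
  Natural isomorphism of two functors with values in \<open>A\<close>-modules, where the modules may live on
  different carrier types (a tensor product does not live on the type of its factors).
\<close>

definition mod_naturally_isomorphic ::
  "'k ring \<Rightarrow> ('k, 'a) module \<Rightarrow> ('o, 'm, 'k) lcat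
    \<Rightarrow> ('o, 'm, ('k, 'a, 'e) lmod, 'e \<Rightarrow> 'e) functr
    \<Rightarrow> ('o, 'm, ('k, 'a, 'f) lmod, 'f \<Rightarrow> 'f) functr \<Rightarrow> bool"
  where "mod_naturally_isomorphic K A \<X> F G \<longleftrightarrow>
    (\<exists>\<eta>. (\<forall>x\<in>Obj \<X>. \<eta> x \<in> lmod_iso K A (ob F x) (ob G x))
      \<and> (\<forall>x\<in>Obj \<X>. \<forall>y\<in>Obj \<X>. \<forall>f\<in>arr \<X> x y.
          compose (carrier (ob F x)) (\<eta> y) (mor F x y f)
          = compose (carrier (ob F x)) (mor G x y f) (\<eta> x)))"


section \<open>Coends\<close>

text \<open>
  A functor \<open>\<X>\<^sup>o\<^sup>p \<times> \<X> \<rightarrow> Y\<close> is given by \<open>Fo\<close> on objects and \<open>Fm\<close> on morphisms, where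
  \<open>Fm a b a' b' f g : Fo a b \<rightarrow> Fo a' b'\<close> for \<open>f : a' \<rightarrow> a\<close> and \<open>g : b \<rightarrow> b'\<close>.
\<close>

definition dinatural ::
  "('o, 'm, 'k) lcat \<Rightarrow> ('p, 'n, 'k) lcat
    \<Rightarrow> ('o \<Rightarrow> 'o \<Rightarrow> 'p) \<Rightarrow> ('o \<Rightarrow> 'o \<Rightarrow> 'o \<Rightarrow> 'o \<Rightarrow> 'm \<Rightarrow> 'm \<Rightarrow> 'n) \<Rightarrow> 'p \<Rightarrow> ('o \<Rightarrow> 'n) \<Rightarrow> bool"
  where "dinatural \<X> Y Fo Fm d \<theta> \<longleftrightarrow>
    (\<forall>x\<in>Obj \<X>. \<theta> x \<in> arr Y (Fo x x) d)
    \<and> (\<forall>x\<in>Obj \<X>. \<forall>x'\<in>Obj \<X>. \<forall>f\<in>arr \<X> x x'.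
        cmp Y (Fo x' x) (Fo x x) d (\<theta> x) (Fm x' x x x f (idt \<X> x))
        = cmp Y (Fo x' x) (Fo x' x') d (\<theta> x') (Fm x' x x' x' (idt \<X> x') f))"

definition is_coend ::
  "('o, 'm, 'k) lcat \<Rightarrow> ('p, 'n, 'k) lcat
    \<Rightarrow> ('o \<Rightarrow> 'o \<Rightarrow> 'p) \<Rightarrow> ('o \<Rightarrow> 'o \<Rightarrow> 'o \<Rightarrow> 'o \<Rightarrow> 'm \<Rightarrow> 'm \<Rightarrow> 'n) \<Rightarrow> 'p \<Rightarrow> ('o \<Rightarrow> 'n) \<Rightarrow> bool"
  where "is_coend \<X> Y Fo Fm c \<iota> \<longleftrightarrow>
    c \<in> Obj Y \<and> dinatural \<X> Y Fo Fm c \<iota>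
    \<and> (\<forall>d\<in>Obj Y. \<forall>\<theta>. dinatural \<X> Y Fo Fm d \<theta> \<longrightarrow>
        (\<exists>!u. u \<in> arr Y c d \<and> (\<forall>x\<in>Obj \<X>. cmp Y (Fo x x) c d u (\<iota> x) = \<theta> x)))"


section \<open>Copowers by vector spaces\<close>

text \<open>
  \<open>represents_copower K \<X> V x p \<beta>\<close>: the object \<open>p\<close> is \<open>V \<otimes> x\<close>, with \<open>\<beta>\<close> the natural isomorphism
  \<open>V \<otimes>\<^sub>K Hom(-, x) \<cong> Hom(-, p)\<close>.
\<close>

definition represents_copower ::
  "'k ring \<Rightarrow> ('o, 'm, 'k) lcat \<Rightarrow> ('k, 'v) module \<Rightarrow> 'o \<Rightarrow> 'o
    \<Rightarrow> ('o \<Rightarrow> ('v \<times> 'm \<Rightarrow> 'k) set \<Rightarrow> 'm) \<Rightarrow> bool"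
  where "represents_copower K \<X> V x p \<beta> \<longleftrightarrow>
    p \<in> Obj \<X>
    \<and> (\<forall>z\<in>Obj \<X>. \<beta> z \<in> module_hom K (space_tensor K V (Hom \<X> z x)) (Hom \<X> z p)
        \<and> bij_betw (\<beta> z) (carrier (space_tensor K V (Hom \<X> z x))) (arr \<X> z p))
    \<and> (\<forall>z\<in>Obj \<X>. \<forall>z'\<in>Obj \<X>. \<forall>f\<in>arr \<X> z' z. \<forall>t\<in>carrier (space_tensor K V (Hom \<X> z x)).
        \<beta> z' (space_tensor_map K V (Hom \<X> z x) V (Hom \<X> z' x) (\<lambda>v. v) (\<lambda>h. cmp \<X> z' z x h f) t)
        = cmp \<X> z' z p (\<beta> z t) f)"

definition copower_choice ::
  "'k ring \<Rightarrow> ('o, 'm, 'k) lcat \<Rightarrow> (('k, 'v) module \<Rightarrow> 'o \<Rightarrow> 'o)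
    \<Rightarrow> (('k, 'v) module \<Rightarrow> 'o \<Rightarrow> 'o \<Rightarrow> ('v \<times> 'm \<Rightarrow> 'k) set \<Rightarrow> 'm) \<Rightarrow> bool"
  where "copower_choice K \<X> P \<beta> \<longleftrightarrow>
    (\<forall>V. \<forall>x\<in>Obj \<X>. vectorspace K V \<and> vectorspace.fin_dim K V
      \<longrightarrow> represents_copower K \<X> V x (P V x) (\<beta> V x))"

text \<open>
  \<open>\<alpha> \<otimes> g : V \<otimes> x \<rightarrow> W \<otimes> y\<close> is the morphism that corresponds under the representing isomorphisms
  to \<open>\<alpha> \<otimes>\<^sub>K Hom(-, g)\<close>.
\<close>

definition copower_map ::
  "'k ring \<Rightarrow> ('o, 'm, 'k) lcat \<Rightarrow> (('k, 'v) module \<Rightarrow> 'o \<Rightarrow> 'o)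
    \<Rightarrow> (('k, 'v) module \<Rightarrow> 'o \<Rightarrow> 'o \<Rightarrow> ('v \<times> 'm \<Rightarrow> 'k) set \<Rightarrow> 'm)
    \<Rightarrow> ('k, 'v) module \<Rightarrow> 'o \<Rightarrow> ('k, 'v) module \<Rightarrow> 'o \<Rightarrow> ('v \<Rightarrow> 'v) \<Rightarrow> 'm \<Rightarrow> 'm"
  where "copower_map K \<X> P \<beta> V x W y \<alpha> g =
    (THE q. q \<in> arr \<X> (P V x) (P W y)
      \<and> (\<forall>z\<in>Obj \<X>. \<forall>t\<in>carrier (space_tensor K V (Hom \<X> z x)).
          cmp \<X> z (P V x) (P W y) q (\<beta> V x z t)
          = \<beta> W y z (space_tensor_map K V (Hom \<X> z x) W (Hom \<X> z y) \<alpha> (\<lambda>h. cmp \<X> z x y g h) t)))"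


section \<open>The Nakayama functor\<close>

text \<open>
  The integrand \<open>(y, a, b) \<mapsto> Hom(y, a)\<^sup>* \<otimes> b\<close>, covariant in \<open>y\<close> and \<open>b\<close> and contravariant in \<open>a\<close>:
  for \<open>k : y \<rightarrow> y'\<close>, \<open>f : a' \<rightarrow> a\<close> and \<open>g : b \<rightarrow> b'\<close> the first factor acts by the transpose of
  \<open>Hom(y', a') \<rightarrow> Hom(y, a), h \<mapsto> f h k\<close>.
\<close>

definition nakayama_ob ::
  "'k ring \<Rightarrow> ('o, 'm, 'k) lcat \<Rightarrow> (('k, 'm \<Rightarrow> 'k) module \<Rightarrow> 'o \<Rightarrow> 'o) \<Rightarrow> 'o \<Rightarrow> 'o \<Rightarrow> 'o \<Rightarrow> 'o"
  where "nakayama_ob K \<X> P y a b = P (dual K (Hom \<X> y a)) b"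

definition nakayama_mor ::
  "'k ring \<Rightarrow> ('o, 'm, 'k) lcat \<Rightarrow> (('k, 'm \<Rightarrow> 'k) module \<Rightarrow> 'o \<Rightarrow> 'o)
    \<Rightarrow> (('k, 'm \<Rightarrow> 'k) module \<Rightarrow> 'o \<Rightarrow> 'o \<Rightarrow> (('m \<Rightarrow> 'k) \<times> 'm \<Rightarrow> 'k) set \<Rightarrow> 'm)
    \<Rightarrow> 'o \<Rightarrow> 'o \<Rightarrow> 'm \<Rightarrow> 'o \<Rightarrow> 'o \<Rightarrow> 'o \<Rightarrow> 'o \<Rightarrow> 'm \<Rightarrow> 'm \<Rightarrow> 'm"
  where "nakayama_mor K \<X> P \<beta> y y' k a b a' b' f g =
    copower_map K \<X> P \<beta> (dual K (Hom \<X> y a)) b (dual K (Hom \<X> y' a')) b'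
      (dual_map K (Hom \<X> y' a') (Hom \<X> y a)
        (\<lambda>h. cmp \<X> y a' a f (cmp \<X> y y' a' h k)))
      g"

text \<open>
  \<open>N\<close> is a functor \<open>y \<mapsto> \<integral>\<^sup>x Hom(y, x)\<^sup>* \<otimes> x\<close>, i.e. a coend with parameter \<open>y\<close>: the structure morphisms
  \<open>\<iota> y x : Hom(y, x)\<^sup>* \<otimes> x \<rightarrow> N y\<close> are universal dinatural in \<open>x\<close> and natural in \<open>y\<close>.
\<close>

definition right_nakayama :: "'k ring \<Rightarrow> ('o, 'm, 'k) lcat \<Rightarrow> ('o, 'm, 'o, 'm) functr \<Rightarrow> bool"
  where "right_nakayama K \<X> N \<longleftrightarrow>
    linear_functor K \<X> \<X> N
    \<and> (\<exists>P \<beta> \<iota>. copower_choice K \<X> P \<beta>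
        \<and> (\<forall>y\<in>Obj \<X>. is_coend \<X> \<X> (nakayama_ob K \<X> P y) (nakayama_mor K \<X> P \<beta> y y (idt \<X> y))
              (ob N y) (\<iota> y))
        \<and> (\<forall>y\<in>Obj \<X>. \<forall>y'\<in>Obj \<X>. \<forall>k\<in>arr \<X> y y'. \<forall>x\<in>Obj \<X>.
              cmp \<X> (nakayama_ob K \<X> P y x x) (ob N y) (ob N y') (mor N y y' k) (\<iota> y x)
              = cmp \<X> (nakayama_ob K \<X> P y x x) (nakayama_ob K \<X> P y' x x) (ob N y') (\<iota> y' x)
                  (nakayama_mor K \<X> P \<beta> y y' k x x x x (idt \<X> x) (idt \<X> x))))"

end

theory Submission
  imports Defs
begin

text \<open>
  The copower \<open>V \<otimes> x\<close> of a finite-dimensional space \<open>V\<close> represents the linear maps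
  \<open>V \<rightarrow> Hom(x, -)\<close>, so a dinatural family \<open>Hom(y, x)\<^sup>* \<otimes> x \<rightarrow> d\<close> is a natural transformation
  \<open>Hom(y, -)\<^sup>* \<rightarrow> Hom(-, d)\<close>, and the coend is an object representing the functor of \<open>d\<close> that these
  transformations form.

  For modules, \<open>Hom(y, x)\<^sup>*\<close> is spanned by the matrix coefficients \<open>h \<mapsto> \<xi>(h m)\<close> with \<open>\<xi> \<in> x\<^sup>*\<close> and
  \<open>m \<in> y\<close>.  The universal transformation sends such a coefficient to \<open>w \<mapsto> \<xi>(- w) \<otimes> m\<close> in
  \<open>A\<^sup>* \<otimes>\<^sub>A y\<close>; it is well defined because \<open>x\<close> and the Hom-spaces are reflexive.  A transformation is
  recovered from its component at the injective cogenerator \<open>A\<^sup>*\<close>: there it is a balanced \<open>A\<close>-linear map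
  out of \<open>A\<^sup>* \<times> y\<close>, because \<open>m \<in> y\<close> defines the functional \<open>h \<mapsto> h(m)(1)\<close> on \<open>Hom(y, A\<^sup>* )\<close>, and
  the matrix coefficient of \<open>\<xi>\<close> and \<open>m\<close> is the pullback of this functional along \<open>w \<mapsto> \<xi>(- w) : x \<rightarrow> A\<^sup>*\<close>.
\<close>

section \<open>Linear maps\<close>

text \<open>\<open>right_nakayama\<close> hides the copower choice and the structure morphisms
  behind existential quantifiers, so two candidates come with unrelated choices. This is why coends
  are rewritten as universal families, whose definition mentions neither; uniqueness of universal
  objects then compares any candidate with one explicit functor, \<open>N0_functor\<close>. That
  functor also gives existence, for which copowers have to be built: with n the dimension of V, the
  n-fold direct sum of x serves as V \<otimes> x.

  A second obstacle is typing. The modules reached by the equivalence live on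
  \<open>nat \<Rightarrow> 'k\<close>, whereas A^* and A^* \<otimes> y live on function and set
  types. They are replaced by objects of the category through coordinates, and the chosen
  isomorphisms \<open>\<tau>\<close> and \<open>j\<close> are carried along.

  The functional h -> h(m)(1) arises because evaluation at 1 identifies Hom(y, A^* ) with y^*, so
  that its dual is y again. Matrix coefficients satisfy linear relations, so a map cannot simply be
  prescribed on them; its transpose is constructed instead.\<close>

lemma module_homI:
  assumes "\<And>x. x \<in> carrier V \<Longrightarrow> f x \<in> carrier W"
    and "\<And>x y. x \<in> carrier V \<Longrightarrow> y \<in> carrier V \<Longrightarrow> f (x \<oplus>\<^bsub>V\<^esub> y) = f x \<oplus>\<^bsub>W\<^esub> f y"
    and "\<And>c x. c \<in> carrier K \<Longrightarrow> x \<in> carrier V \<Longrightarrow> f (c \<odot>\<^bsub>V\<^esub> x) = c \<odot>\<^bsub>W\<^esub> f x"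
  shows "f \<in> module_hom K V W"
  using assms unfolding module_hom_def by auto

lemma module_hom_in: "f \<in> module_hom K V W \<Longrightarrow> x \<in> carrier V \<Longrightarrow> f x \<in> carrier W"
  unfolding module_hom_def by auto

lemma vectorspace_module: "vectorspace K V \<Longrightarrow> module K V"
  unfolding vectorspace_def by simp

lemma vectorspace_field: "vectorspace K V \<Longrightarrow> field K"
  unfolding vectorspace_def by simp

lemma vectorspace_zero: "vectorspace K V \<Longrightarrow> \<zero>\<^bsub>V\<^esub> \<in> carrier V"
  by (meson vectorspace_module module.axioms(2) abelian_group.axioms(1) abelian_monoid.zero_closed)

lemma vectorspace_add: "vectorspace K V \<Longrightarrow> x \<in> carrier V \<Longrightarrow> y \<in> carrier V \<Longrightarrow> x \<oplus>\<^bsub>V\<^esub> y \<in> carrier V"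
  by (meson vectorspace_module module.axioms(2) abelian_group.axioms(1) abelian_monoid.a_closed)

lemma vectorspace_smult: "vectorspace K V \<Longrightarrow> c \<in> carrier K \<Longrightarrow> x \<in> carrier V \<Longrightarrow> c \<odot>\<^bsub>V\<^esub> x \<in> carrier V"
  by (meson vectorspace_module module.smult_closed)

lemma vectorspace_add_minus:
  assumes "vectorspace K V" "x \<in> carrier V" "y \<in> carrier V"
  shows "x \<ominus>\<^bsub>V\<^esub> y = x \<oplus>\<^bsub>V\<^esub> (\<ominus>\<^bsub>K\<^esub> \<one>\<^bsub>K\<^esub>) \<odot>\<^bsub>V\<^esub> y"
proof -
  interpret V: vectorspace K V by fact
  show ?thesis using assms(2,3) by (simp add: a_minus_def V.smult_minus_1)
qed

text \<open>The axioms see only the carrier and the operations on it. This carries them between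
  records that share these but differ in other fields, such as \<open>space_lmod\<close>,
  \<open>coregular\<close> and \<open>bimod_tensor\<close>.\<close>

lemma vectorspace_transfer:
  assumes "vectorspace K V" "carrier W = carrier V" "\<zero>\<^bsub>W\<^esub> = \<zero>\<^bsub>V\<^esub>"
    "\<And>x y. x \<in> carrier V \<Longrightarrow> y \<in> carrier V \<Longrightarrow> x \<oplus>\<^bsub>W\<^esub> y = x \<oplus>\<^bsub>V\<^esub> y"
    "\<And>c x. c \<in> carrier K \<Longrightarrow> x \<in> carrier V \<Longrightarrow> c \<odot>\<^bsub>W\<^esub> x = c \<odot>\<^bsub>V\<^esub> x"
  shows "vectorspace K W"
proof -
  interpret V: vectorspace K V by fact
  show ?thesis
    by (rule vs_criteria)
      (auto simp: assms V.field_axioms V.M.a_ac V.smult_assoc1 V.smult_l_distr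
        V.smult_r_distr intro: bexI[of _ "\<ominus>\<^bsub>V\<^esub> _"] V.M.r_neg)
qed

lemma module_hom_zero:
  assumes "vectorspace K V" "vectorspace K W" "f \<in> module_hom K V W"
  shows "f \<zero>\<^bsub>V\<^esub> = \<zero>\<^bsub>W\<^esub>"
proof -
  interpret mod_hom K V W f using assms
    by (simp add: mod_hom_def mod_hom_axioms_def vectorspace_module)
  show ?thesis by simp
qed

lemma module_hom_finsum:
  assumes "vectorspace K V" "vectorspace K W" "f \<in> module_hom K V W"
    and "finite I" "g \<in> I \<rightarrow> carrier V"
  shows "f (finsum V g I) = finsum W (\<lambda>i. f (g i)) I"
proof -
  interpret mod_hom K V W f using assms
    by (simp add: mod_hom_def mod_hom_axioms_def vectorspace_module)
  show ?thesis using assms(4,5)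
    by (induction I rule: finite_induct) (auto simp: Pi_iff)
qed

text \<open>\<open>module_hom\<close> constrains a map on the carrier only, so passing to an
  extensional restriction keeps it linear.\<close>

lemma module_hom_cong:
  assumes "f \<in> module_hom K V W" "vectorspace K V" "\<And>x. x \<in> carrier V \<Longrightarrow> g x = f x"
  shows "g \<in> module_hom K V W"
  using assms by (auto intro!: module_homI
      simp: module_hom_in module_hom_add module_hom_smult vectorspace_add vectorspace_smult)

lemma module_hom_compose:
  assumes "f \<in> module_hom K U V" "g \<in> module_hom K V W"
  shows "(\<lambda>x. g (f x)) \<in> module_hom K U W"
  using assms by (auto intro!: module_homI simp: module_hom_in module_hom_add module_hom_smult)

lemma module_hom_inv_into:
  assumes "vectorspace K V" "f \<in> module_hom K V W" "bij_betw f (carrier V) (carrier W)"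
  shows "inv_into (carrier V) f \<in> module_hom K W V"
proof (rule module_homI)
  let ?g = "inv_into (carrier V) f"
  have inj: "inj_on f (carrier V)" and im: "f ` carrier V = carrier W"
    using assms(3) by (auto simp: bij_betw_def)
  have fg: "f (?g y) = y" and g: "?g y \<in> carrier V" if "y \<in> carrier W" for y
    using that im by (auto simp: f_inv_into_f inv_into_into)
  show "?g y \<in> carrier V" if "y \<in> carrier W" for y using g that .
  show "?g (x \<oplus>\<^bsub>W\<^esub> y) = ?g x \<oplus>\<^bsub>V\<^esub> ?g y" if "x \<in> carrier W" "y \<in> carrier W" for x y
    by (rule inv_into_f_eq[OF inj])
      (use that assms in \<open>auto simp: g fg module_hom_add vectorspace_add\<close>)
  show "?g (c \<odot>\<^bsub>W\<^esub> x) = c \<odot>\<^bsub>V\<^esub> ?g x" if "c \<in> carrier K" "x \<in> carrier W" for c x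
    by (rule inv_into_f_eq[OF inj])
      (use that assms in \<open>auto simp: g fg module_hom_smult vectorspace_smult\<close>)
qed

section \<open>Linear subsets and finite generation\<close>

text \<open>A bare closure condition without the module axioms that \<open>submodule\<close>
  carries, so that preimages, kernels and equalizers given by comprehension are recognised at once.
  Generation by S is expressed below as: every linear subset containing S contains the
  carrier.\<close>

definition linear_subset :: "('k, 'r) ring_scheme \<Rightarrow> ('k, 'v, 'x) module_scheme \<Rightarrow> 'v set \<Rightarrow> bool"
  where "linear_subset K V W \<longleftrightarrow> W \<subseteq> carrier V \<and> \<zero>\<^bsub>V\<^esub> \<in> W
    \<and> (\<forall>x\<in>W. \<forall>y\<in>W. x \<oplus>\<^bsub>V\<^esub> y \<in> W) \<and> (\<forall>c\<in>carrier K. \<forall>x\<in>W. c \<odot>\<^bsub>V\<^esub> x \<in> W)"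

lemma linear_subset_iff_submodule:
  "vectorspace K V \<Longrightarrow> linear_subset K V W \<longleftrightarrow> LinearCombinations.submodule K W V"
  by (auto simp: linear_subset_def LinearCombinations.submodule_def vectorspace_module)

lemma linear_subset_span:
  assumes "vectorspace K V" "S \<subseteq> carrier V"
  shows "linear_subset K V (module.span K V S)" "S \<subseteq> module.span K V S"
  using assms
  by (simp_all add: linear_subset_iff_submodule module.span_is_submodule module.in_own_span
      vectorspace_module)

lemma span_subset_linear:
  assumes "vectorspace K V" "linear_subset K V W" "S \<subseteq> W"
  shows "module.span K V S \<subseteq> W"
  using assms by (simp add: linear_subset_iff_submodule module.span_is_subset vectorspace_module)

lemma linear_subset_equalizer:
  assumes "vectorspace K V" "vectorspace K W" "f \<in> module_hom K V W" "g \<in> module_hom K V W"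
  shows "linear_subset K V {x \<in> carrier V. f x = g x}"
  using assms unfolding linear_subset_def
  by (auto simp: module_hom_zero module_hom_add module_hom_smult vectorspace_zero vectorspace_add
      vectorspace_smult)

lemma linear_subset_minus:
  assumes "vectorspace K V" "linear_subset K V W" "x \<in> W" "y \<in> W"
  shows "x \<ominus>\<^bsub>V\<^esub> y \<in> W"
proof -
  interpret V: vectorspace K V by fact
  have "x \<ominus>\<^bsub>V\<^esub> y = x \<oplus>\<^bsub>V\<^esub> (\<ominus>\<^bsub>K\<^esub> \<one>\<^bsub>K\<^esub>) \<odot>\<^bsub>V\<^esub> y"
    using assms by (auto simp: linear_subset_def intro!: vectorspace_add_minus)
  also have "\<dots> \<in> W" using assms by (auto simp: linear_subset_def)
  finally show ?thesis .
qed

text \<open>Generation as an induction principle; it suffices because the span of S is itself a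
  linear subset containing S. Spans are not computed from here on.\<close>

lemma fin_dimI:
  assumes "vectorspace K V" "finite S" "S \<subseteq> carrier V"
    "\<And>U. linear_subset K V U \<Longrightarrow> S \<subseteq> U \<Longrightarrow> carrier V \<subseteq> U"
  shows "vectorspace.fin_dim K V"
proof -
  interpret V: vectorspace K V by fact
  have "module.span K V S = carrier V"
    using linear_subset_span[OF assms(1,3)] assms(4) by (auto simp: linear_subset_def)
  then show ?thesis using assms(2,3) by (auto simp: V.fin_dim_def)
qed

lemma fin_dim_cases:
  assumes "vectorspace K V" "vectorspace.fin_dim K V"
  obtains S where "finite S" "S \<subseteq> carrier V"
    "\<And>U. linear_subset K V U \<Longrightarrow> S \<subseteq> U \<Longrightarrow> carrier V \<subseteq> U"
proof -
  interpret V: vectorspace K V by fact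
  obtain S where "finite S" "S \<subseteq> carrier V" "V.span S = carrier V"
    using assms(2) by (auto simp: V.fin_dim_def)
  then show ?thesis using that span_subset_linear[OF assms(1)] by metis
qed

lemma linear_subset_vimage:
  assumes "vectorspace K V" "vectorspace K W" "f \<in> module_hom K V W" "linear_subset K W U"
  shows "linear_subset K V {x \<in> carrier V. f x \<in> U}"
  using assms unfolding linear_subset_def
  by (auto simp: module_hom_zero module_hom_add module_hom_smult vectorspace_zero vectorspace_add
      vectorspace_smult)

text \<open>The image of a generating set generates, because the preimage of a linear subset under f
  is linear.\<close>

lemma fin_dim_image:
  assumes "vectorspace K V" "vectorspace.fin_dim K V" "vectorspace K W"
    and f: "f \<in> module_hom K V W" and surj: "f ` carrier V = carrier W"
  shows "vectorspace.fin_dim K W"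
proof -
  obtain S where S: "finite S" "S \<subseteq> carrier V"
    "\<And>U. linear_subset K V U \<Longrightarrow> S \<subseteq> U \<Longrightarrow> carrier V \<subseteq> U"
    using fin_dim_cases[OF assms(1,2)] by blast
  show ?thesis
  proof (rule fin_dimI[OF assms(3), of "f ` S"])
    show "finite (f ` S)" "f ` S \<subseteq> carrier W" using S f by (auto simp: module_hom_in)
    fix U assume U: "linear_subset K W U" "f ` S \<subseteq> U"
    have "linear_subset K V {x \<in> carrier V. f x \<in> U}"
      by (rule linear_subset_vimage[OF assms(1,3) f U(1)])
    then have "carrier V \<subseteq> {x \<in> carrier V. f x \<in> U}" using S U(2) by blast
    then show "carrier W \<subseteq> U" unfolding surj[symmetric] by auto
  qed
qed

section \<open>Functionals and dual spaces\<close>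

lemma ground_space_simps [simp]:
  "carrier (ground_space K) = carrier K" "\<zero>\<^bsub>ground_space K\<^esub> = \<zero>\<^bsub>K\<^esub>"
  "x \<oplus>\<^bsub>ground_space K\<^esub> y = x \<oplus>\<^bsub>K\<^esub> y" "c \<odot>\<^bsub>ground_space K\<^esub> x = c \<otimes>\<^bsub>K\<^esub> x"
  by (simp_all add: ground_space_def)

lemma vectorspace_ground: "field K \<Longrightarrow> vectorspace K (ground_space K)"
proof -
  assume "field K"
  then interpret field K .
  show ?thesis
    by (rule vs_criteria)
      (auto simp: a_ac m_assoc l_distr r_distr intro: bexI[of _ "\<ominus>\<^bsub>K\<^esub> _"] r_neg field_axioms)
qed

abbreviation linear_form :: "'k ring \<Rightarrow> ('k, 'v, 'x) module_scheme \<Rightarrow> ('v \<Rightarrow> 'k) set"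
  where "linear_form K V \<equiv> module_hom K V (ground_space K)"

lemma linear_formD:
  assumes "\<phi> \<in> linear_form K V"
  shows "x \<in> carrier V \<Longrightarrow> \<phi> x \<in> carrier K"
    and "x \<in> carrier V \<Longrightarrow> y \<in> carrier V \<Longrightarrow> \<phi> (x \<oplus>\<^bsub>V\<^esub> y) = \<phi> x \<oplus>\<^bsub>K\<^esub> \<phi> y"
    and "c \<in> carrier K \<Longrightarrow> x \<in> carrier V \<Longrightarrow> \<phi> (c \<odot>\<^bsub>V\<^esub> x) = c \<otimes>\<^bsub>K\<^esub> \<phi> x"
  using assms by (auto simp: module_hom_def)

lemma map_space_simps [simp]:
  "carrier (map_space S W H) = H" "\<zero>\<^bsub>map_space S W H\<^esub> = (\<lambda>s\<in>S. \<zero>\<^bsub>W\<^esub>)"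
  "f \<oplus>\<^bsub>map_space S W H\<^esub> g = (\<lambda>s\<in>S. f s \<oplus>\<^bsub>W\<^esub> g s)"
  "c \<odot>\<^bsub>map_space S W H\<^esub> f = (\<lambda>s\<in>S. c \<odot>\<^bsub>W\<^esub> f s)"
  by (simp_all add: map_space_def)

text \<open>Closure under negatives follows from closure under scalars, by scaling with minus
  one.\<close>

lemma vectorspace_map_space:
  assumes "vectorspace K W" and H: "H \<subseteq> extensional S" "\<And>f s. f \<in> H \<Longrightarrow> s \<in> S \<Longrightarrow> f s \<in> carrier W"
    and zero: "(\<lambda>s\<in>S. \<zero>\<^bsub>W\<^esub>) \<in> H"
    and add: "\<And>f g. f \<in> H \<Longrightarrow> g \<in> H \<Longrightarrow> (\<lambda>s\<in>S. f s \<oplus>\<^bsub>W\<^esub> g s) \<in> H"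
    and smult: "\<And>c f. c \<in> carrier K \<Longrightarrow> f \<in> H \<Longrightarrow> (\<lambda>s\<in>S. c \<odot>\<^bsub>W\<^esub> f s) \<in> H"
  shows "vectorspace K (map_space S W H)"
proof -
  interpret W: vectorspace K W by fact
  have ext: "f \<in> extensional S" if "f \<in> H" for f using H that by auto
  show ?thesis
  proof (rule vs_criteria, goal_cases)
    case 4
    show ?case
    proof
      fix f assume f: "f \<in> carrier (map_space S W H)"
      have "\<ominus>\<^bsub>K\<^esub> \<one>\<^bsub>K\<^esub> \<in> carrier K" by simp
      from smult[OF this] f have "(\<lambda>s\<in>S. (\<ominus>\<^bsub>K\<^esub> \<one>\<^bsub>K\<^esub>) \<odot>\<^bsub>W\<^esub> f s) \<in> H" by simp
      then show "\<exists>g\<in>carrier (map_space S W H). f \<oplus>\<^bsub>map_space S W H\<^esub> g = \<zero>\<^bsub>map_space S W H\<^esub>"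
        using f by (intro bexI[of _ "\<lambda>s\<in>S. (\<ominus>\<^bsub>K\<^esub> \<one>\<^bsub>K\<^esub>) \<odot>\<^bsub>W\<^esub> f s"])
          (auto simp: H(2) W.smult_minus_1 W.M.r_neg restrict_def)
    qed
  qed (auto simp: W.field_axioms zero[unfolded restrict_def] add[unfolded restrict_def]
      smult[unfolded restrict_def] H(2) W.M.a_ac W.smult_assoc1
      W.smult_l_distr W.smult_r_distr fun_eq_iff restrict_def extensional_arb[OF ext])
qed

lemma dual_simps:
  "\<phi> \<in> carrier (dual K V) \<longleftrightarrow> \<phi> \<in> linear_form K V \<and> \<phi> \<in> extensional (carrier V)"
  "\<zero>\<^bsub>dual K V\<^esub> = (\<lambda>x\<in>carrier V. \<zero>\<^bsub>K\<^esub>)"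
  "\<phi> \<oplus>\<^bsub>dual K V\<^esub> \<psi> = (\<lambda>x\<in>carrier V. \<phi> x \<oplus>\<^bsub>K\<^esub> \<psi> x)"
  "c \<odot>\<^bsub>dual K V\<^esub> \<phi> = (\<lambda>x\<in>carrier V. c \<otimes>\<^bsub>K\<^esub> \<phi> x)"
  by (auto simp: dual_def)

lemma dual_form: "\<phi> \<in> carrier (dual K V) \<Longrightarrow> \<phi> \<in> linear_form K V"
  by (simp add: dual_simps)

lemma dual_app:
  "x \<in> carrier V \<Longrightarrow> \<zero>\<^bsub>dual K V\<^esub> x = \<zero>\<^bsub>K\<^esub>"
  "x \<in> carrier V \<Longrightarrow> (\<phi> \<oplus>\<^bsub>dual K V\<^esub> \<psi>) x = \<phi> x \<oplus>\<^bsub>K\<^esub> \<psi> x"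
  "x \<in> carrier V \<Longrightarrow> (c \<odot>\<^bsub>dual K V\<^esub> \<phi>) x = c \<otimes>\<^bsub>K\<^esub> \<phi> x"
  by (simp_all add: dual_simps)

lemma dual_eqI:
  assumes "\<phi> \<in> carrier (dual K V)" "\<psi> \<in> carrier (dual K V)" "\<And>x. x \<in> carrier V \<Longrightarrow> \<phi> x = \<psi> x"
  shows "\<phi> = \<psi>"
  using assms by (auto simp: dual_simps intro: extensionalityI)

lemma dual_restrictI:
  assumes "vectorspace K V" "\<phi> \<in> linear_form K V"
  shows "(\<lambda>x\<in>carrier V. \<phi> x) \<in> carrier (dual K V)"
  using module_hom_cong[OF assms(2,1), of "\<lambda>x\<in>carrier V. \<phi> x"] by (simp add: dual_simps)

lemma vectorspace_dual:
  assumes "vectorspace K V"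
  shows "vectorspace K (dual K V)"
proof -
  interpret V: vectorspace K V by fact
  show ?thesis unfolding dual_def
  proof (rule vectorspace_map_space)
    show "vectorspace K (ground_space K)" using V.field_axioms by (rule vectorspace_ground)
  qed (auto intro!: module_homI simp: linear_formD V.R.a_ac V.R.m_ac V.R.r_distr)
qed

lemma linear_form_eval:
  "x \<in> carrier V \<Longrightarrow> (\<lambda>\<phi>. \<phi> x) \<in> linear_form K (dual K V)"
  by (rule module_homI) (auto simp: dual_app linear_formD(1)[OF dual_form])

text \<open>The finite family embeds V into a power of K. Dimension counts are avoided: each form
  either vanishes on the current subspace or cuts it down to a kernel of codimension one, and one
  extra generator makes up for the loss. Used for duals, Hom-spaces and powers.\<close>

lemma fin_dim_separating:
  assumes V: "vectorspace K V" and "finite \<Phi>" "\<Phi> \<subseteq> linear_form K V"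
    and sep: "\<And>x. x \<in> carrier V \<Longrightarrow> (\<forall>\<phi>\<in>\<Phi>. \<phi> x = \<zero>\<^bsub>K\<^esub>) \<Longrightarrow> x = \<zero>\<^bsub>V\<^esub>"
  shows "vectorspace.fin_dim K V"
proof -
  interpret V: vectorspace K V by fact
  note G = vectorspace_ground[OF V.field_axioms]
  \<comment> \<open>Generalised to all linear subsets W, because adding a form passes from W to the
    kernel of that form in W.\<close>
  have "\<forall>W. linear_subset K V W \<and> (\<forall>x\<in>W. (\<forall>\<phi>\<in>\<Phi>. \<phi> x = \<zero>\<^bsub>K\<^esub>) \<longrightarrow> x = \<zero>\<^bsub>V\<^esub>) \<longrightarrow>
      (\<exists>S. finite S \<and> S \<subseteq> W \<and> (\<forall>U. linear_subset K V U \<and> S \<subseteq> U \<longrightarrow> W \<subseteq> U))"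
    using assms(2,3)
  proof (induction \<Phi> rule: finite_induct)
    case empty
    show ?case
    proof (intro allI impI)
      fix W
      assume "linear_subset K V W \<and> (\<forall>x\<in>W. (\<forall>\<phi>\<in>{}. \<phi> x = \<zero>\<^bsub>K\<^esub>) \<longrightarrow> x = \<zero>\<^bsub>V\<^esub>)"
      then have "W \<subseteq> {\<zero>\<^bsub>V\<^esub>}" by simp blast
      then have "W \<subseteq> U" if "linear_subset K V U" for U using that by (auto simp: linear_subset_def)
      then show "\<exists>S. finite S \<and> S \<subseteq> W \<and> (\<forall>U. linear_subset K V U \<and> S \<subseteq> U \<longrightarrow> W \<subseteq> U)"
        by (intro exI[of _ "{}"]) simp
    qed
  next
    case (insert \<phi> \<Phi>)
    note \<phi> = linear_formD[of \<phi> K V]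
    show ?case
    proof (intro allI impI, elim conjE)
      fix W assume W: "linear_subset K V W"
        and sep: "\<forall>x\<in>W. (\<forall>\<psi>\<in>insert \<phi> \<Phi>. \<psi> x = \<zero>\<^bsub>K\<^esub>) \<longrightarrow> x = \<zero>\<^bsub>V\<^esub>"
      define W' where "W' = {x \<in> W. \<phi> x = \<zero>\<^bsub>K\<^esub>}"
      have WV: "W \<subseteq> carrier V" using W by (simp add: linear_subset_def)
      have \<phi>0: "\<phi> \<zero>\<^bsub>V\<^esub> = \<zero>\<^bsub>K\<^esub>" using module_hom_zero[OF V G] insert by simp
      have "linear_subset K V W'" using W insert WV
        unfolding linear_subset_def W'_def by (auto simp: \<phi>0 \<phi> subset_iff)
      moreover have "\<forall>x\<in>W'. (\<forall>\<psi>\<in>\<Phi>. \<psi> x = \<zero>\<^bsub>K\<^esub>) \<longrightarrow> x = \<zero>\<^bsub>V\<^esub>" using sep by (auto simp: W'_def)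
      moreover have "\<Phi> \<subseteq> linear_form K V" using insert.prems by auto
      ultimately have "\<exists>S. finite S \<and> S \<subseteq> W' \<and> (\<forall>U. linear_subset K V U \<and> S \<subseteq> U \<longrightarrow> W' \<subseteq> U)"
        using insert.IH[rule_format, of W'] by blast
      then obtain S where S': "finite S \<and> S \<subseteq> W' \<and> (\<forall>U. linear_subset K V U \<and> S \<subseteq> U \<longrightarrow> W' \<subseteq> U)" ..
      then have S: "finite S" "S \<subseteq> W'"
        "\<And>U. linear_subset K V U \<Longrightarrow> S \<subseteq> U \<Longrightarrow> W' \<subseteq> U" by simp_all
      show "\<exists>S. finite S \<and> S \<subseteq> W \<and> (\<forall>U. linear_subset K V U \<and> S \<subseteq> U \<longrightarrow> W \<subseteq> U)"
      proof (cases "W' = W")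
        case True show ?thesis by (rule exI[of _ S]) (use S' True in simp)
      next
        case False
        then obtain v where v: "v \<in> W" "\<phi> v \<noteq> \<zero>\<^bsub>K\<^esub>" by (auto simp: W'_def)
        have vV: "v \<in> carrier V" using v WV by auto
        have u: "\<phi> v \<in> carrier K" using \<phi> insert vV by auto
        have inv: "inv\<^bsub>K\<^esub> (\<phi> v) \<in> carrier K" "inv\<^bsub>K\<^esub> (\<phi> v) \<otimes>\<^bsub>K\<^esub> \<phi> v = \<one>\<^bsub>K\<^esub>"
          using V.field_Units u v by auto
        show ?thesis
        proof (intro exI[of _ "insert v S"] conjI allI impI subsetI)
          fix U x assume U: "linear_subset K V U \<and> insert v S \<subseteq> U" and x: "x \<in> W"
          \<comment> \<open>Subtracting this multiple of v moves x into the kernel of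
            \<phi>.\<close>
          let ?c = "\<phi> x \<otimes>\<^bsub>K\<^esub> inv\<^bsub>K\<^esub> (\<phi> v)"
          have xV: "x \<in> carrier V" using x WV by auto
          have px: "\<phi> x \<in> carrier K" using \<phi> insert xV by auto
          have c: "?c \<in> carrier K" using inv px by auto
          have e: "x \<ominus>\<^bsub>V\<^esub> ?c \<odot>\<^bsub>V\<^esub> v = x \<oplus>\<^bsub>V\<^esub> (\<ominus>\<^bsub>K\<^esub> \<one>\<^bsub>K\<^esub>) \<odot>\<^bsub>V\<^esub> (?c \<odot>\<^bsub>V\<^esub> v)"
            using c vV xV V by (simp add: vectorspace_add_minus)
          have "x \<ominus>\<^bsub>V\<^esub> ?c \<odot>\<^bsub>V\<^esub> v \<in> W"
            using W c v x V by (intro linear_subset_minus) (auto simp: linear_subset_def)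
          moreover have "\<phi> (x \<ominus>\<^bsub>V\<^esub> ?c \<odot>\<^bsub>V\<^esub> v) = \<zero>\<^bsub>K\<^esub>"
            unfolding e using \<phi> insert.prems c vV xV px inv u
            by (simp add: V.R.m_assoc V.R.l_minus V.R.r_neg)
          ultimately have "x \<ominus>\<^bsub>V\<^esub> ?c \<odot>\<^bsub>V\<^esub> v \<in> U" using S(3)[of U] U by (auto simp: W'_def)
          moreover have "?c \<odot>\<^bsub>V\<^esub> v \<in> U" using U c by (auto simp: linear_subset_def)
          ultimately have "(x \<ominus>\<^bsub>V\<^esub> ?c \<odot>\<^bsub>V\<^esub> v) \<oplus>\<^bsub>V\<^esub> ?c \<odot>\<^bsub>V\<^esub> v \<in> U"
            using U by (auto simp: linear_subset_def)
          also have "(x \<ominus>\<^bsub>V\<^esub> ?c \<odot>\<^bsub>V\<^esub> v) \<oplus>\<^bsub>V\<^esub> ?c \<odot>\<^bsub>V\<^esub> v = x"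
            using c vV xV by (simp add: a_minus_def V.M.a_assoc V.M.l_neg)
          finally show "x \<in> U" .
        qed (use S v in \<open>auto simp: W'_def\<close>)
      qed
    qed
  qed
  from this[rule_format, of "carrier V"] sep obtain S where
    "finite S" "S \<subseteq> carrier V" "\<And>U. linear_subset K V U \<and> S \<subseteq> U \<longrightarrow> carrier V \<subseteq> U"
    by (auto simp: linear_subset_def)
  then show ?thesis by (intro fin_dimI[OF V, of S]) auto
qed

section \<open>Dual bases, reflexivity and maps out of a dual space\<close>

text \<open>Indexing by an initial segment of the naturals is deliberate: coordinates become
  functions on \<open>nat\<close>, as the carrier type of the realizing modules requires, and V
  \<otimes> x becomes an n-fold power.\<close>

definition dual_basis ::
  "'k ring \<Rightarrow> ('k, 'v, 'x) module_scheme \<Rightarrow> nat \<Rightarrow> (nat \<Rightarrow> 'v) \<Rightarrow> (nat \<Rightarrow> 'v \<Rightarrow> 'k) \<Rightarrow> bool"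
  where "dual_basis K V n v \<phi> \<longleftrightarrow>
    (\<forall>i<n. v i \<in> carrier V) \<and> (\<forall>i<n. \<phi> i \<in> carrier (dual K V))
    \<and> (\<forall>i<n. \<forall>j<n. \<phi> i (v j) = (if i = j then \<one>\<^bsub>K\<^esub> else \<zero>\<^bsub>K\<^esub>))
    \<and> (\<forall>x\<in>carrier V. x = finsum V (\<lambda>i. \<phi> i x \<odot>\<^bsub>V\<^esub> v i) {..<n})"

text \<open>The coordinate forms are the coefficients of the unique expansion in a finite basis.
  Linearity and the delta relations are obtained by exhibiting coefficients and appealing to
  uniqueness.\<close>

lemma dual_basis_exists:
  assumes V: "vectorspace K V" and "vectorspace.fin_dim K V"
  obtains n v \<phi> where "dual_basis K V n v \<phi>"
proof -
  interpret V: vectorspace K V by fact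
  note G = vectorspace_ground[OF V.field_axioms]
  obtain B where B: "finite B" "V.basis B" using V.finite_basis_exists assms(2) by auto
  then have BV: "B \<subseteq> carrier V" by (simp add: V.basis_def)
  have ex1: "\<exists>!a. a \<in> B \<rightarrow>\<^sub>E carrier K \<and> V.lincomb a B = x" if "x \<in> carrier V" for x
    using V.basis_criterion[OF B(1) BV] B(2) that by auto
  define a where "a x = (THE a. a \<in> B \<rightarrow>\<^sub>E carrier K \<and> V.lincomb a B = x)" for x
  have a: "a x \<in> B \<rightarrow>\<^sub>E carrier K" "V.lincomb (a x) B = x" if "x \<in> carrier V" for x
    using theI'[OF ex1[OF that]] by (simp_all add: a_def)
  have aK: "a x b \<in> carrier K" if "x \<in> carrier V" "b \<in> B" for x b using a that by auto
  \<comment> \<open>\<open>basis_criterion\<close> speaks of extensional coefficient functions,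
    hence the restriction of c to B.\<close>
  have unique: "a x b = c b" if "x \<in> carrier V" "c \<in> B \<rightarrow> carrier K" "V.lincomb c B = x" "b \<in> B" for x c b
  proof -
    have "V.lincomb (restrict c B) B = x"
      using that BV by (subst that(3)[symmetric], intro V.lincomb_cong) auto
    moreover have "restrict c B \<in> B \<rightarrow>\<^sub>E carrier K" using that by auto
    ultimately have "a x = restrict c B"
      using ex1[OF that(1)] a[OF that(1)] by blast
    then show ?thesis using that by simp
  qed
  have add: "a (x \<oplus>\<^bsub>V\<^esub> y) b = a x b \<oplus>\<^bsub>K\<^esub> a y b"
    if "x \<in> carrier V" "y \<in> carrier V" "b \<in> B" for x y b
  proof (rule unique)
    have "V.lincomb (\<lambda>b. a x b \<oplus>\<^bsub>K\<^esub> a y b) B = V.lincomb (a x) B \<oplus>\<^bsub>V\<^esub> V.lincomb (a y) B"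
      using that B BV aK by (intro V.lincomb_sum) auto
    then show "V.lincomb (\<lambda>b. a x b \<oplus>\<^bsub>K\<^esub> a y b) B = x \<oplus>\<^bsub>V\<^esub> y" using that a by simp
  qed (use that aK in auto)
  have smult: "a (c \<odot>\<^bsub>V\<^esub> x) b = c \<otimes>\<^bsub>K\<^esub> a x b" if "c \<in> carrier K" "x \<in> carrier V" "b \<in> B" for c x b
  proof (rule unique)
    have "V.lincomb (\<lambda>b. c \<otimes>\<^bsub>K\<^esub> a x b) B = c \<odot>\<^bsub>V\<^esub> V.lincomb (a x) B"
      using that BV aK by (intro V.lincomb_smult) auto
    then show "V.lincomb (\<lambda>b. c \<otimes>\<^bsub>K\<^esub> a x b) B = c \<odot>\<^bsub>V\<^esub> x" using that a by simp
  qed (use that aK in auto)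
  have delta: "a d b = (if b = d then \<one>\<^bsub>K\<^esub> else \<zero>\<^bsub>K\<^esub>)" if "b \<in> B" "d \<in> B" for b d
  proof (rule unique)
    have "V.lincomb (\<lambda>b. if b = d then \<one>\<^bsub>K\<^esub> else \<zero>\<^bsub>K\<^esub>) B
        = (\<Oplus>\<^bsub>V\<^esub>b\<in>B. if d = b then d else \<zero>\<^bsub>V\<^esub>)"
      unfolding V.lincomb_def using BV that by (intro V.M.finsum_cong') auto
    also have "\<dots> = d" using that B BV by (intro V.M.add.finprod_singleton) auto
    finally show "V.lincomb (\<lambda>b. if b = d then \<one>\<^bsub>K\<^esub> else \<zero>\<^bsub>K\<^esub>) B = d" .
  qed (use that BV in auto)
  obtain e where e: "bij_betw e {..<card B} B"
    using ex_bij_betw_nat_finite[OF B(1)] by (auto simp: atLeast0LessThan)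
  have eB: "e i \<in> B" if "i < card B" for i using e that by (auto simp: bij_betw_def)
  have "dual_basis K V (card B) e (\<lambda>i. \<lambda>x\<in>carrier V. a x (e i))"
    unfolding dual_basis_def
  proof (intro conjI allI impI ballI)
    fix i assume i: "i < card B"
    show "e i \<in> carrier V" using eB i BV by auto
    show "(\<lambda>x\<in>carrier V. a x (e i)) \<in> carrier (dual K V)"
      using eB i by (intro dual_restrictI V module_homI) (auto simp: aK add smult)
    fix j assume j: "j < card B"
    show "(\<lambda>x\<in>carrier V. a x (e i)) (e j) = (if i = j then \<one>\<^bsub>K\<^esub> else \<zero>\<^bsub>K\<^esub>)"
      using i j eB BV e by (auto simp: delta bij_betw_def inj_on_def)
  next
    fix x assume x: "x \<in> carrier V"
    have "x = (\<Oplus>\<^bsub>V\<^esub>b\<in>e ` {..<card B}. a x b \<odot>\<^bsub>V\<^esub> b)"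
      using a[OF x] e by (simp add: V.lincomb_def bij_betw_def)
    also have "\<dots> = (\<Oplus>\<^bsub>V\<^esub>i\<in>{..<card B}. a x (e i) \<odot>\<^bsub>V\<^esub> e i)"
      using e eB BV aK[OF x] by (intro V.M.finsum_reindex) (auto simp: bij_betw_def)
    finally show "x = (\<Oplus>\<^bsub>V\<^esub>i\<in>{..<card B}. (\<lambda>x\<in>carrier V. a x (e i)) x \<odot>\<^bsub>V\<^esub> e i)" using x by simp
  qed
  then show ?thesis using that by blast
qed

lemma dual_basisD:
  assumes "dual_basis K V n v \<phi>"
  shows "i < n \<Longrightarrow> v i \<in> carrier V" "i < n \<Longrightarrow> \<phi> i \<in> carrier (dual K V)"
    "i < n \<Longrightarrow> j < n \<Longrightarrow> \<phi> i (v j) = (if i = j then \<one>\<^bsub>K\<^esub> else \<zero>\<^bsub>K\<^esub>)"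
    "x \<in> carrier V \<Longrightarrow> finsum V (\<lambda>i. \<phi> i x \<odot>\<^bsub>V\<^esub> v i) {..<n} = x"
    "i < n \<Longrightarrow> x \<in> carrier V \<Longrightarrow> \<phi> i x \<in> carrier K"
  using assms by (auto simp: dual_basis_def dual_simps linear_formD)

lemma dual_basis_expand:
  assumes "vectorspace K V" "vectorspace K W" "dual_basis K V n v \<phi>" "f \<in> module_hom K V W"
    and "x \<in> carrier V"
  shows "f x = finsum W (\<lambda>i. \<phi> i x \<odot>\<^bsub>W\<^esub> f (v i)) {..<n}"
proof -
  interpret V: vectorspace K V by fact
  interpret W: vectorspace K W by fact
  note d = dual_basisD[OF assms(3)]
  have "f x = f (finsum V (\<lambda>i. \<phi> i x \<odot>\<^bsub>V\<^esub> v i) {..<n})" using d assms by simp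
  also have "\<dots> = finsum W (\<lambda>i. f (\<phi> i x \<odot>\<^bsub>V\<^esub> v i)) {..<n}"
    using d assms by (intro module_hom_finsum) auto
  also have "\<dots> = finsum W (\<lambda>i. \<phi> i x \<odot>\<^bsub>W\<^esub> f (v i)) {..<n}"
    using d assms by (intro W.M.finsum_cong') (auto simp: module_hom_smult module_hom_in)
  finally show ?thesis .
qed

lemma linear_forms_separate:
  assumes "vectorspace K V" "vectorspace.fin_dim K V" "x \<in> carrier V" "y \<in> carrier V"
    and "\<And>\<phi>. \<phi> \<in> carrier (dual K V) \<Longrightarrow> \<phi> x = \<phi> y"
  shows "x = y"
proof -
  interpret V: vectorspace K V by fact
  obtain n v \<phi> where d: "dual_basis K V n v \<phi>" using dual_basis_exists assms by blast
  have "\<phi> i x = \<phi> i y" if "i < n" for i using assms(5) dual_basisD(2)[OF d that] .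
  then have "finsum V (\<lambda>i. \<phi> i x \<odot>\<^bsub>V\<^esub> v i) {..<n} = finsum V (\<lambda>i. \<phi> i y \<odot>\<^bsub>V\<^esub> v i) {..<n}"
    using dual_basisD[OF d] assms(3,4) by (intro V.M.finsum_cong') auto
  then show ?thesis using dual_basisD[OF d] assms by simp
qed

text \<open>A form is determined by its values on the basis v, so the finitely many evaluations at
  the \<open>v i\<close> separate the dual.\<close>

lemma fin_dim_dual:
  assumes V: "vectorspace K V" "vectorspace.fin_dim K V"
  shows "vectorspace.fin_dim K (dual K V)"
proof -
  interpret V: vectorspace K V by fact
  note G = vectorspace_ground[OF V.field_axioms]
  obtain n v \<phi> where d: "dual_basis K V n v \<phi>" using dual_basis_exists assms by blast
  show ?thesis
  proof (rule fin_dim_separating[of K _ "(\<lambda>i \<psi>. \<psi> (v i)) ` {..<n}"])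
    show "vectorspace K (dual K V)" using V by (simp add: vectorspace_dual)
    show "(\<lambda>i \<psi>. \<psi> (v i)) ` {..<n} \<subseteq> linear_form K (dual K V)"
      using linear_form_eval dual_basisD[OF d] by fastforce
    fix \<psi> assume \<psi>: "\<psi> \<in> carrier (dual K V)" "\<forall>\<phi>\<in>(\<lambda>i \<psi>. \<psi> (v i)) ` {..<n}. \<phi> \<psi> = \<zero>\<^bsub>K\<^esub>"
    show "\<psi> = \<zero>\<^bsub>dual K V\<^esub>"
    proof (rule dual_eqI[OF \<psi>(1)])
      show "\<zero>\<^bsub>dual K V\<^esub> \<in> carrier (dual K V)" using vectorspace_zero[OF vectorspace_dual[OF V(1)]] .
      fix x assume x: "x \<in> carrier V"
      have "\<psi> x = finsum (ground_space K) (\<lambda>i. \<phi> i x \<odot>\<^bsub>ground_space K\<^esub> \<psi> (v i)) {..<n}"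
        using dual_basis_expand[OF V(1) G d dual_form[OF \<psi>(1)] x] .
      also have "\<dots> = finsum (ground_space K) (\<lambda>i. \<zero>\<^bsub>ground_space K\<^esub>) {..<n}"
        using \<psi>(2) dual_basisD[OF d] x G
        by (intro abelian_monoid.finsum_cong')
          (auto simp: vectorspace_def module_def abelian_group_def)
      also have "\<dots> = \<zero>\<^bsub>ground_space K\<^esub>"
        using G by (intro abelian_monoid.finsum_zero) (auto simp: vectorspace_def module_def abelian_group_def)
      finally show "\<psi> x = \<zero>\<^bsub>dual K V\<^esub> x" using x by (simp add: dual_app)
    qed
  qed auto
qed

lemma dual_reflexive:
  assumes V: "vectorspace K V" "vectorspace.fin_dim K V" and u: "u \<in> linear_form K (dual K V)"
  obtains x where "x \<in> carrier V" "\<And>\<phi>. \<phi> \<in> carrier (dual K V) \<Longrightarrow> u \<phi> = \<phi> x"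
proof -
  interpret V: vectorspace K V by fact
  interpret D: vectorspace K "dual K V" using V by (simp add: vectorspace_dual)
  note G = vectorspace_ground[OF V.field_axioms]
  interpret G: vectorspace K "ground_space K" by (rule G)
  obtain n v \<phi> where d: "dual_basis K V n v \<phi>" using dual_basis_exists V by blast
  note dD = dual_basisD[OF d]
  have uK: "u (\<phi> i) \<in> carrier K" if "i < n" for i using u that dD by (simp add: linear_formD)
  \<comment> \<open>Forced by the expansion of \<psi> as the sum of the multiples
    \<open>\<psi> (v i)\<close> of \<open>\<phi> i\<close>: applying u and regrouping the scalars
    gives \<psi> of this vector.\<close>
  let ?x = "finsum V (\<lambda>i. u (\<phi> i) \<odot>\<^bsub>V\<^esub> v i) {..<n}"
  have x: "?x \<in> carrier V" using dD uK by (intro V.M.finsum_closed) auto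
  have "u \<psi> = \<psi> ?x" if \<psi>: "\<psi> \<in> carrier (dual K V)" for \<psi>
  proof -
    note f = linear_formD[OF dual_form[OF \<psi>]]
    let ?s = "finsum (dual K V) (\<lambda>i. \<psi> (v i) \<odot>\<^bsub>dual K V\<^esub> \<phi> i) {..<n}"
    have t: "\<psi> (v i) \<odot>\<^bsub>dual K V\<^esub> \<phi> i \<in> carrier (dual K V)" if "i < n" for i
      using that dD f by simp
    have s: "?s \<in> carrier (dual K V)" using t by (intro D.M.finsum_closed) auto
    have "\<psi> = ?s"
    proof (rule dual_eqI[OF \<psi> s])
      fix y assume y: "y \<in> carrier V"
      have "\<psi> y = finsum (ground_space K) (\<lambda>i. \<phi> i y \<odot>\<^bsub>ground_space K\<^esub> \<psi> (v i)) {..<n}"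
        using dual_basis_expand[OF V(1) G d dual_form[OF \<psi>] y] .
      also have "\<dots> = finsum (ground_space K) (\<lambda>i. (\<psi> (v i) \<odot>\<^bsub>dual K V\<^esub> \<phi> i) y) {..<n}"
        using dD f y by (intro G.M.finsum_cong') (auto simp: dual_app V.R.m_comm)
      also have "\<dots> = ?s y"
        using module_hom_finsum[OF D.vectorspace_axioms G linear_form_eval[OF y], of "{..<n}"] t by simp
      finally show "\<psi> y = ?s y" .
    qed
    then have "u \<psi> = u ?s" by simp
    also have "\<dots> = finsum (ground_space K) (\<lambda>i. u (\<psi> (v i) \<odot>\<^bsub>dual K V\<^esub> \<phi> i)) {..<n}"
      by (intro module_hom_finsum[OF D.vectorspace_axioms G u]) (auto intro: t)
    also have "\<dots> = finsum (ground_space K) (\<lambda>i. \<psi> (u (\<phi> i) \<odot>\<^bsub>V\<^esub> v i)) {..<n}"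
      using dD f uK linear_formD[OF u] by (intro G.M.finsum_cong') (auto simp: V.R.m_comm)
    also have "\<dots> = \<psi> ?x"
      using dD uK by (intro module_hom_finsum[OF V(1) G dual_form[OF \<psi>], symmetric]) auto
    finally show ?thesis .
  qed
  then show ?thesis using that x by blast
qed

text \<open>A set of forms whose only common zero is 0 spans H^*. Composed with a form on W, the
  difference of f and g is a functional on H^*, hence evaluation at some h by reflexivity; agreement
  on S makes every form in S vanish at h, so h is zero.\<close>

lemma separating_forms_span:
  assumes H: "vectorspace K H" "vectorspace.fin_dim K H" and W: "vectorspace K W" "vectorspace.fin_dim K W"
    and f: "f \<in> module_hom K (dual K H) W" and g: "g \<in> module_hom K (dual K H) W"
    and S: "S \<subseteq> carrier (dual K H)" "\<And>h. h \<in> carrier H \<Longrightarrow> (\<And>\<sigma>. \<sigma> \<in> S \<Longrightarrow> \<sigma> h = \<zero>\<^bsub>K\<^esub>) \<Longrightarrow> h = \<zero>\<^bsub>H\<^esub>"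
    and eq: "\<And>\<sigma>. \<sigma> \<in> S \<Longrightarrow> f \<sigma> = g \<sigma>" and \<zeta>: "\<zeta> \<in> carrier (dual K H)"
  shows "f \<zeta> = g \<zeta>"
proof (rule linear_forms_separate[OF W])
  interpret H: vectorspace K H by fact
  fix \<omega> assume \<omega>: "\<omega> \<in> carrier (dual K W)"
  let ?u = "\<lambda>\<psi>. \<omega> (f \<psi>) \<ominus>\<^bsub>K\<^esub> \<omega> (g \<psi>)"
  note o = linear_formD[OF dual_form[OF \<omega>]]
  have u: "?u \<in> linear_form K (dual K H)"
    using f g o by (intro module_homI)
      (auto simp: module_hom_in module_hom_add module_hom_smult a_minus_def H.R.a_ac H.R.r_distr
        H.R.r_minus H.R.minus_add)
  obtain h where h: "h \<in> carrier H" "\<And>\<phi>. \<phi> \<in> carrier (dual K H) \<Longrightarrow> ?u \<phi> = \<phi> h"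
    by (rule dual_reflexive[OF H u]) blast
  have "h = \<zero>\<^bsub>H\<^esub>"
  proof (rule S(2)[OF h(1)])
    fix \<sigma> assume "\<sigma> \<in> S"
    moreover have "?u \<sigma> = \<zero>\<^bsub>K\<^esub>" using eq S(1) \<open>\<sigma> \<in> S\<close> g o
      by (auto simp: a_minus_def module_hom_in H.R.r_neg)
    ultimately show "\<sigma> h = \<zero>\<^bsub>K\<^esub>" using h S(1) by auto
  qed
  then have "?u \<zeta> = \<zero>\<^bsub>K\<^esub>"
    using h(2)[OF \<zeta>] module_hom_zero[OF H(1) vectorspace_ground[OF H.field_axioms] dual_form[OF \<zeta>]] by simp
  then show "\<omega> (f \<zeta>) = \<omega> (g \<zeta>)" using \<zeta> f g o by (simp add: module_hom_in)
qed (use f g \<zeta> in \<open>auto simp: module_hom_in\<close>)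

text \<open>The hypothesis says that the transposed assignment \<open>W\<^sup>* \<rightarrow> H\<close> exists; the map constructed is its
  transpose, \<open>H\<^sup>* \<rightarrow> W\<^sup>*\<^sup>* = W\<close>.\<close>

lemma dual_extension:
  assumes H: "vectorspace K H" and W: "vectorspace K W" "vectorspace.fin_dim K W"
    and q: "\<And>s. s \<in> S \<Longrightarrow> q s \<in> carrier W"
    and ex: "\<And>\<omega>. \<omega> \<in> carrier (dual K W) \<Longrightarrow> \<exists>h\<in>carrier H. \<forall>s\<in>S. p s h = \<omega> (q s)"
  obtains \<Theta> where "\<Theta> \<in> module_hom K (dual K H) W" "\<And>s. s \<in> S \<Longrightarrow> \<Theta> (p s) = q s"
proof -
  interpret W: vectorspace K W by fact
  obtain n w \<omega> where d: "dual_basis K W n w \<omega>" using dual_basis_exists W by blast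
  note dD = dual_basisD[OF d]
  have "\<exists>h. \<forall>i<n. h i \<in> carrier H \<and> (\<forall>s\<in>S. p s (h i) = \<omega> i (q s))"
    using ex[OF dD(2)] by metis
  then obtain h where h: "\<And>i. i < n \<Longrightarrow> h i \<in> carrier H"
    "\<And>i s. i < n \<Longrightarrow> s \<in> S \<Longrightarrow> p s (h i) = \<omega> i (q s)" by auto
  \<comment> \<open>The transpose of the linear map W^* -> H that sends \<open>\<omega> i\<close> to
    the chosen solution \<open>h i\<close>. Choosing solutions for the basis forms only avoids
    having to make the choice linear.\<close>
  let ?T = "\<lambda>\<zeta>. finsum W (\<lambda>i. \<zeta> (h i) \<odot>\<^bsub>W\<^esub> w i) {..<n}"
  have zK: "\<zeta> (h i) \<in> carrier K" if "\<zeta> \<in> carrier (dual K H)" "i < n" for \<zeta> i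
    using that h by (auto intro: linear_formD(1)[OF dual_form])
  have "?T \<in> module_hom K (dual K H) W"
  proof (rule module_homI)
    fix \<zeta> assume z: "\<zeta> \<in> carrier (dual K H)"
    show "?T \<zeta> \<in> carrier W" using zK[OF z] dD by (intro W.M.finsum_closed) auto
    fix \<xi> assume x: "\<xi> \<in> carrier (dual K H)"
    have "?T (\<zeta> \<oplus>\<^bsub>dual K H\<^esub> \<xi>)
        = finsum W (\<lambda>i. \<zeta> (h i) \<odot>\<^bsub>W\<^esub> w i \<oplus>\<^bsub>W\<^esub> \<xi> (h i) \<odot>\<^bsub>W\<^esub> w i) {..<n}"
      using zK[OF z] zK[OF x] dD h by (intro W.M.finsum_cong') (auto simp: dual_app W.smult_l_distr)
    also have "\<dots> = ?T \<zeta> \<oplus>\<^bsub>W\<^esub> ?T \<xi>"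
      using zK[OF z] zK[OF x] dD by (intro W.M.finsum_addf) auto
    finally show "?T (\<zeta> \<oplus>\<^bsub>dual K H\<^esub> \<xi>) = ?T \<zeta> \<oplus>\<^bsub>W\<^esub> ?T \<xi>" .
  next
    fix c \<zeta> assume c: "c \<in> carrier K" and z: "\<zeta> \<in> carrier (dual K H)"
    have "?T (c \<odot>\<^bsub>dual K H\<^esub> \<zeta>) = finsum W (\<lambda>i. c \<odot>\<^bsub>W\<^esub> (\<zeta> (h i) \<odot>\<^bsub>W\<^esub> w i)) {..<n}"
      using zK[OF z] c dD h by (intro W.M.finsum_cong') (auto simp: dual_app W.smult_assoc1)
    also have "\<dots> = c \<odot>\<^bsub>W\<^esub> ?T \<zeta>"
      using zK[OF z] c dD by (intro W.finsum_smult_ldistr[symmetric]) auto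
    finally show "?T (c \<odot>\<^bsub>dual K H\<^esub> \<zeta>) = c \<odot>\<^bsub>W\<^esub> ?T \<zeta>" .
  qed
  moreover have "?T (p s) = q s" if s: "s \<in> S" for s
  proof -
    have "?T (p s) = finsum W (\<lambda>i. \<omega> i (q s) \<odot>\<^bsub>W\<^esub> w i) {..<n}"
      using h(2) s dD q by (intro W.M.finsum_cong') auto
    then show ?thesis using dD q s by simp
  qed
  ultimately show ?thesis using that by blast
qed

section \<open>Free spaces, quotients and tensor products\<close>

text \<open>The operations of Q are determined by representatives in V, so every axiom is the
  \<pi>-image of one in V. Serves both quotients and the transport of a module to
  coordinates.\<close>

lemma vectorspace_image:
  assumes "vectorspace K V" and c: "carrier Q = \<pi> ` carrier V" and z: "\<zero>\<^bsub>Q\<^esub> = \<pi> \<zero>\<^bsub>V\<^esub>"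
    and a: "\<And>x y. x \<in> carrier V \<Longrightarrow> y \<in> carrier V \<Longrightarrow> \<pi> x \<oplus>\<^bsub>Q\<^esub> \<pi> y = \<pi> (x \<oplus>\<^bsub>V\<^esub> y)"
    and s: "\<And>c x. c \<in> carrier K \<Longrightarrow> x \<in> carrier V \<Longrightarrow> c \<odot>\<^bsub>Q\<^esub> \<pi> x = \<pi> (c \<odot>\<^bsub>V\<^esub> x)"
  shows "vectorspace K Q"
proof -
  interpret V: vectorspace K V by fact
  have "\<exists>y\<in>carrier V. \<pi> (x \<oplus>\<^bsub>V\<^esub> y) = \<pi> \<zero>\<^bsub>V\<^esub>" if "x \<in> carrier V" for x
    using V.M.r_neg[OF that] V.M.a_inv_closed[OF that] by (intro bexI[of _ "\<ominus>\<^bsub>V\<^esub> x"]) auto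
  then show ?thesis
    by (intro vs_criteria)
      (auto simp: c z a s V.field_axioms V.M.a_ac V.smult_assoc1 V.smult_l_distr V.smult_r_distr)
qed

lemma free_space_simps:
  "\<phi> \<in> carrier (free_space K S) \<longleftrightarrow>
    \<phi> \<in> S \<rightarrow> carrier K \<and> (\<forall>s. s \<notin> S \<longrightarrow> \<phi> s = \<zero>\<^bsub>K\<^esub>) \<and> finite {s. \<phi> s \<noteq> \<zero>\<^bsub>K\<^esub>}"
  "\<zero>\<^bsub>free_space K S\<^esub> = (\<lambda>s. \<zero>\<^bsub>K\<^esub>)"
  "\<phi> \<oplus>\<^bsub>free_space K S\<^esub> \<psi> = (\<lambda>s. \<phi> s \<oplus>\<^bsub>K\<^esub> \<psi> s)"
  "c \<odot>\<^bsub>free_space K S\<^esub> \<phi> = (\<lambda>s. c \<otimes>\<^bsub>K\<^esub> \<phi> s)"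
  by (simp_all add: free_space_def)

lemma free_space_closed:
  assumes "field K" "\<phi> \<in> carrier (free_space K S)"
  shows "\<phi> s \<in> carrier K"
proof -
  interpret field K by fact
  show ?thesis using assms(2) by (cases "s \<in> S") (auto simp: free_space_simps)
qed

lemma vectorspace_free_space:
  assumes "field K"
  shows "vectorspace K (free_space K S)"
proof -
  interpret field K by fact
  note cl = free_space_closed[OF assms, of _ S]
  have add: "\<phi> \<oplus>\<^bsub>free_space K S\<^esub> \<psi> \<in> carrier (free_space K S)"
    if "\<phi> \<in> carrier (free_space K S)" "\<psi> \<in> carrier (free_space K S)" for \<phi> \<psi>
  proof -
    have "{s. \<phi> s \<oplus>\<^bsub>K\<^esub> \<psi> s \<noteq> \<zero>\<^bsub>K\<^esub>} \<subseteq> {s. \<phi> s \<noteq> \<zero>\<^bsub>K\<^esub>} \<union> {s. \<psi> s \<noteq> \<zero>\<^bsub>K\<^esub>}" by auto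
    then have "finite {s. \<phi> s \<oplus>\<^bsub>K\<^esub> \<psi> s \<noteq> \<zero>\<^bsub>K\<^esub>}"
      using that by (auto simp: free_space_simps intro: finite_subset)
    then show ?thesis using that by (auto simp: free_space_simps)
  qed
  have smult: "c \<odot>\<^bsub>free_space K S\<^esub> \<phi> \<in> carrier (free_space K S)"
    if "c \<in> carrier K" "\<phi> \<in> carrier (free_space K S)" for c \<phi>
  proof -
    have "{s. c \<otimes>\<^bsub>K\<^esub> \<phi> s \<noteq> \<zero>\<^bsub>K\<^esub>} \<subseteq> {s. \<phi> s \<noteq> \<zero>\<^bsub>K\<^esub>}" using that by auto
    then have "finite {s. c \<otimes>\<^bsub>K\<^esub> \<phi> s \<noteq> \<zero>\<^bsub>K\<^esub>}"
      using that by (auto simp: free_space_simps intro: finite_subset)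
    then show ?thesis using that by (auto simp: free_space_simps)
  qed
  show ?thesis
  proof (rule vs_criteria, goal_cases)
    case 4
    show ?case
    proof
      fix \<phi> assume p: "\<phi> \<in> carrier (free_space K S)"
      have "(\<ominus>\<^bsub>K\<^esub> \<one>\<^bsub>K\<^esub>) \<odot>\<^bsub>free_space K S\<^esub> \<phi> \<in> carrier (free_space K S)" by (rule smult[OF _ p]) simp
      moreover have "\<phi> \<oplus>\<^bsub>free_space K S\<^esub> ((\<ominus>\<^bsub>K\<^esub> \<one>\<^bsub>K\<^esub>) \<odot>\<^bsub>free_space K S\<^esub> \<phi>) = \<zero>\<^bsub>free_space K S\<^esub>"
        using cl[OF p] by (simp add: free_space_simps(2-4) l_minus r_neg)
      ultimately show "\<exists>\<psi>\<in>carrier (free_space K S). \<phi> \<oplus>\<^bsub>free_space K S\<^esub> \<psi> = \<zero>\<^bsub>free_space K S\<^esub>" by blast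
    qed
  next
    case 2 show ?case by (simp add: free_space_simps)
  next
    case 1 show ?case by fact
  qed (use add smult cl in \<open>auto simp: free_space_simps(2-4) a_ac m_assoc l_distr r_distr\<close>)
qed

lemma delta_in_free_space:
  assumes "field K" "s \<in> S"
  shows "delta K s \<in> carrier (free_space K S)"
proof -
  interpret field K by fact
  have "{t. delta K s t \<noteq> \<zero>\<^bsub>K\<^esub>} \<subseteq> {s}" by (auto simp: delta_def)
  then have "finite {t. delta K s t \<noteq> \<zero>\<^bsub>K\<^esub>}" by (rule finite_subset) simp
  then show ?thesis using assms(2) by (auto simp: free_space_simps delta_def)
qed

text \<open>Induction on a finite set containing the support, splitting off the value at one point
  as a multiple of its \<open>delta\<close>.\<close>

lemma free_space_generated:
  assumes "field K" and U: "linear_subset K (free_space K S) U" "\<And>s. s \<in> S \<Longrightarrow> delta K s \<in> U"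
  shows "carrier (free_space K S) \<subseteq> U"
proof -
  interpret field K by fact
  have "\<forall>\<phi>\<in>carrier (free_space K S). {s. \<phi> s \<noteq> \<zero>\<^bsub>K\<^esub>} \<subseteq> F \<longrightarrow> \<phi> \<in> U" if "finite F" for F
    using that
  proof (induction F rule: finite_induct)
    case empty
    have "\<phi> = \<zero>\<^bsub>free_space K S\<^esub>" if "{s. \<phi> s \<noteq> \<zero>\<^bsub>K\<^esub>} \<subseteq> {}" for \<phi> :: "'b \<Rightarrow> 'a"
      using that by (auto simp: free_space_simps fun_eq_iff)
    then show ?case using U(1) by (auto simp: linear_subset_def)
  next
    case (insert s F)
    show ?case
    proof (intro ballI impI)
      fix \<phi> assume p: "\<phi> \<in> carrier (free_space K S)" and supp: "{t. \<phi> t \<noteq> \<zero>\<^bsub>K\<^esub>} \<subseteq> insert s F"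
      show "\<phi> \<in> U"
      proof (cases "s \<in> S")
        case False
        then have "{t. \<phi> t \<noteq> \<zero>\<^bsub>K\<^esub>} \<subseteq> F" using supp p by (auto simp: free_space_simps)
        then show ?thesis using insert.IH p by blast
      next
        case True
        have s: "{t. (\<phi>(s := \<zero>\<^bsub>K\<^esub>)) t \<noteq> \<zero>\<^bsub>K\<^esub>} \<subseteq> {t. \<phi> t \<noteq> \<zero>\<^bsub>K\<^esub>}" by auto
        then have "\<phi>(s := \<zero>\<^bsub>K\<^esub>) \<in> carrier (free_space K S)"
          using p finite_subset[OF s] unfolding free_space_simps by auto
        moreover have "{t. (\<phi>(s := \<zero>\<^bsub>K\<^esub>)) t \<noteq> \<zero>\<^bsub>K\<^esub>} \<subseteq> F" using supp by auto
        ultimately have 1: "\<phi>(s := \<zero>\<^bsub>K\<^esub>) \<in> U" using insert.IH by blast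
        have ps: "\<phi> t \<in> carrier K" for t using free_space_closed[OF \<open>field K\<close> p] .
        have 2: "\<phi> s \<odot>\<^bsub>free_space K S\<^esub> delta K s \<in> U"
          using U True ps by (auto simp: linear_subset_def)
        have "\<phi> = \<phi>(s := \<zero>\<^bsub>K\<^esub>) \<oplus>\<^bsub>free_space K S\<^esub> (\<phi> s \<odot>\<^bsub>free_space K S\<^esub> delta K s)"
          using ps by (auto simp: free_space_simps delta_def fun_eq_iff)
        also have "\<dots> \<in> U" using 1 2 U(1) by (auto simp: linear_subset_def)
        finally show ?thesis .
      qed
    qed
  qed
  then show ?thesis by (auto simp: free_space_simps)
qed

lemma free_space_lift:
  assumes U: "vectorspace K U" and g: "\<And>s. s \<in> S \<Longrightarrow> g s \<in> carrier U"
  obtains f where "f \<in> module_hom K (free_space K S) U" "\<And>s. s \<in> S \<Longrightarrow> f (delta K s) = g s"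
proof -
  interpret U: vectorspace K U by fact
  note cl = free_space_closed[OF U.field_axioms, of _ S]
  let ?F = "free_space K S"
  let ?supp = "\<lambda>\<phi>. {s. \<phi> s \<noteq> \<zero>\<^bsub>K\<^esub>}"
  define f where "f \<phi> = finsum U (\<lambda>s. \<phi> s \<odot>\<^bsub>U\<^esub> g s) (?supp \<phi>)" for \<phi>
  have supp: "finite (?supp \<phi>)" "?supp \<phi> \<subseteq> S" if "\<phi> \<in> carrier ?F" for \<phi>
    using that by (auto simp: free_space_simps)
  \<comment> \<open>The support varies with \<phi>, so f is re-expressed as a sum over any finite
    set between the support and S; the additional terms vanish.\<close>
  have f_eq: "f \<phi> = finsum U (\<lambda>s. \<phi> s \<odot>\<^bsub>U\<^esub> g s) D"
    if "\<phi> \<in> carrier ?F" "finite D" "?supp \<phi> \<subseteq> D" "D \<subseteq> S" for \<phi> D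
    unfolding f_def using that cl[OF that(1)] g
    by (intro U.M.add.finprod_mono_neutral_cong_left) auto
  have "f \<in> module_hom K ?F U"
  proof (rule module_homI)
    fix \<phi> assume p: "\<phi> \<in> carrier ?F"
    show "f \<phi> \<in> carrier U" unfolding f_def
      using supp[OF p] cl[OF p] g by (intro U.M.finsum_closed) auto
    fix \<psi> assume q: "\<psi> \<in> carrier ?F"
    let ?D = "?supp \<phi> \<union> ?supp \<psi>"
    have D: "finite ?D" "?D \<subseteq> S" using supp[OF p] supp[OF q] by auto
    have "f (\<phi> \<oplus>\<^bsub>?F\<^esub> \<psi>) = finsum U (\<lambda>s. (\<phi> \<oplus>\<^bsub>?F\<^esub> \<psi>) s \<odot>\<^bsub>U\<^esub> g s) ?D"
      using D by (intro f_eq vectorspace_add[OF vectorspace_free_space] U.field_axioms p q)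
        (auto simp: free_space_simps(3))
    also have "\<dots> = finsum U (\<lambda>s. \<phi> s \<odot>\<^bsub>U\<^esub> g s \<oplus>\<^bsub>U\<^esub> \<psi> s \<odot>\<^bsub>U\<^esub> g s) ?D"
      using D cl[OF p] cl[OF q] g
      by (intro U.M.finsum_cong') (auto simp: free_space_simps(3) subset_iff intro!: U.smult_l_distr)
    also have "\<dots> = finsum U (\<lambda>s. \<phi> s \<odot>\<^bsub>U\<^esub> g s) ?D \<oplus>\<^bsub>U\<^esub> finsum U (\<lambda>s. \<psi> s \<odot>\<^bsub>U\<^esub> g s) ?D"
      using D cl[OF p] cl[OF q] g by (intro U.M.finsum_addf) auto
    also have "\<dots> = f \<phi> \<oplus>\<^bsub>U\<^esub> f \<psi>"
      using f_eq[OF p D(1) _ D(2)] f_eq[OF q D(1) _ D(2)] by auto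
    finally show "f (\<phi> \<oplus>\<^bsub>?F\<^esub> \<psi>) = f \<phi> \<oplus>\<^bsub>U\<^esub> f \<psi>" .
  next
    fix c \<phi> assume c: "c \<in> carrier K" and p: "\<phi> \<in> carrier ?F"
    have "f (c \<odot>\<^bsub>?F\<^esub> \<phi>) = finsum U (\<lambda>s. (c \<odot>\<^bsub>?F\<^esub> \<phi>) s \<odot>\<^bsub>U\<^esub> g s) (?supp \<phi>)"
      using supp[OF p] c
      by (intro f_eq vectorspace_smult[OF vectorspace_free_space] U.field_axioms p c)
        (auto simp: free_space_simps(4))
    also have "\<dots> = finsum U (\<lambda>s. c \<odot>\<^bsub>U\<^esub> (\<phi> s \<odot>\<^bsub>U\<^esub> g s)) (?supp \<phi>)"
      using supp[OF p] c cl[OF p] g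
      by (intro U.M.finsum_cong') (auto simp: free_space_simps(4) subset_iff intro!: U.smult_assoc1)
    also have "\<dots> = c \<odot>\<^bsub>U\<^esub> f \<phi>" unfolding f_def
      using supp[OF p] c cl[OF p] g by (intro U.finsum_smult_ldistr[symmetric]) auto
    finally show "f (c \<odot>\<^bsub>?F\<^esub> \<phi>) = c \<odot>\<^bsub>U\<^esub> f \<phi>" .
  qed
  moreover have "f (delta K s) = g s" if s: "s \<in> S" for s
  proof -
    have "f (delta K s) = finsum U (\<lambda>t. delta K s t \<odot>\<^bsub>U\<^esub> g t) {s}"
      using s by (intro f_eq delta_in_free_space U.field_axioms) (auto simp: delta_def)
    then show ?thesis using g[OF s] by (simp add: delta_def)
  qed
  ultimately show ?thesis using that by blast
qed

section \<open>Quotients by linear subsets\<close>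

locale linear_quotient =
  fixes K :: "'k ring" and V :: "('k, 'v) module" and W :: "'v set"
  assumes V: "vectorspace K V" and W: "linear_subset K V W"
begin

interpretation V: vectorspace K V by (rule V)

interpretation abelian_subgroup W V
proof (rule abelian_subgroupI3)
  have "x \<in> W \<Longrightarrow> \<ominus>\<^bsub>V\<^esub> x \<in> W" for x
    using linear_subset_minus[OF V W, of "\<zero>\<^bsub>V\<^esub>" x] W
    by (auto simp: linear_subset_def a_minus_def subset_iff)
  then show "additive_subgroup W V"
    using W by (auto simp: additive_subgroup_def linear_subset_def a_inv_def intro!: subgroup.intro)
qed (rule V.M.abelian_group_axioms)

abbreviation (input) proj :: "'v \<Rightarrow> 'v set" where "proj v \<equiv> W +>\<^bsub>V\<^esub> v"

lemma proj_eq: "x \<in> carrier V \<Longrightarrow> y \<in> carrier V \<Longrightarrow> proj x = proj y \<longleftrightarrow> x \<ominus>\<^bsub>V\<^esub> y \<in> W"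
  using a_rcos_module[of y x] a_repr_independence'[of x y] a_rcos_self[of x]
  by (auto simp: a_minus_def)

lemma mem_proj: "x \<in> carrier V \<Longrightarrow> v \<in> proj x \<Longrightarrow> v \<in> carrier V \<and> proj v = proj x"
  using a_repr_independence'[of v x] a_elemrcos_carrier[of x v] by auto

lemma quotient_simps:
  "carrier (quotient_space V W) = proj ` carrier V" "\<zero>\<^bsub>quotient_space V W\<^esub> = proj \<zero>\<^bsub>V\<^esub>"
  "x \<in> carrier V \<Longrightarrow> y \<in> carrier V \<Longrightarrow> proj x \<oplus>\<^bsub>quotient_space V W\<^esub> proj y = proj (x \<oplus>\<^bsub>V\<^esub> y)"
  "c \<in> carrier K \<Longrightarrow> x \<in> carrier V \<Longrightarrow> c \<odot>\<^bsub>quotient_space V W\<^esub> proj x = proj (c \<odot>\<^bsub>V\<^esub> x)"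
proof -
  show "carrier (quotient_space V W) = proj ` carrier V"
    by (auto simp: quotient_space_def A_RCOSETS_def')
  show "\<zero>\<^bsub>quotient_space V W\<^esub> = proj \<zero>\<^bsub>V\<^esub>"
    using W by (simp add: quotient_space_def linear_subset_def)
  show "proj x \<oplus>\<^bsub>quotient_space V W\<^esub> proj y = proj (x \<oplus>\<^bsub>V\<^esub> y)" if "x \<in> carrier V" "y \<in> carrier V"
    using that by (simp add: quotient_space_def a_rcos_sum)
  assume c: "c \<in> carrier K" and x: "x \<in> carrier V"
  \<comment> \<open>The scalar multiple of a coset is defined as a union of cosets; all of them are
    shown to be the same one.\<close>
  have "proj (c \<odot>\<^bsub>V\<^esub> v) = proj (c \<odot>\<^bsub>V\<^esub> x)" if "v \<in> proj x" for v
  proof -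
    have v: "v \<in> carrier V" "v \<ominus>\<^bsub>V\<^esub> x \<in> W" using mem_proj[OF x that] proj_eq x by auto
    have "c \<odot>\<^bsub>V\<^esub> v \<ominus>\<^bsub>V\<^esub> c \<odot>\<^bsub>V\<^esub> x = c \<odot>\<^bsub>V\<^esub> (v \<ominus>\<^bsub>V\<^esub> x)"
      using c x v by (simp add: a_minus_def V.smult_r_distr V.smult_r_minus)
    also have "\<dots> \<in> W" using v c W by (auto simp: linear_subset_def)
    finally show ?thesis using c v x by (subst proj_eq) auto
  qed
  moreover have "x \<in> proj x" using x by (rule a_rcos_self)
  ultimately have "(\<Union>v\<in>proj x. proj (c \<odot>\<^bsub>V\<^esub> v)) = proj (c \<odot>\<^bsub>V\<^esub> x)" by blast
  then show "c \<odot>\<^bsub>quotient_space V W\<^esub> proj x = proj (c \<odot>\<^bsub>V\<^esub> x)" by (simp add: quotient_space_def)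
qed

lemma vectorspace_quotient: "vectorspace K (quotient_space V W)"
  by (rule vectorspace_image[OF V]) (auto simp: quotient_simps)

lemma proj_hom: "proj \<in> module_hom K V (quotient_space V W)"
  by (rule module_homI) (auto simp: quotient_simps)

lemma quotient_lift:
  assumes U: "vectorspace K U" and f: "f \<in> module_hom K V U" and null: "\<And>w. w \<in> W \<Longrightarrow> f w = \<zero>\<^bsub>U\<^esub>"
  obtains h where "h \<in> module_hom K (quotient_space V W) U"
    "h \<in> extensional (carrier (quotient_space V W))" "\<And>x. x \<in> carrier V \<Longrightarrow> h (proj x) = f x"
proof -
  interpret U: vectorspace K U by (rule U)
  \<comment> \<open>The choice of representative does not matter: two representatives differ by an
    element of W, which f kills.\<close>
  let ?h = "\<lambda>C\<in>carrier (quotient_space V W). f (SOME v. v \<in> C)"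
  have h: "?h (proj x) = f x" if x: "x \<in> carrier V" for x
  proof -
    let ?v = "SOME v. v \<in> proj x"
    have "?v \<in> proj x" using a_rcos_self[OF x] by (rule someI)
    from mem_proj[OF x this] have v: "?v \<in> carrier V" "?v \<ominus>\<^bsub>V\<^esub> x \<in> W"
      using proj_eq[of ?v x] x by auto
    have fc: "f ?v \<in> carrier U" "f x \<in> carrier U" using f v x by (auto simp: module_hom_in)
    have "f (?v \<ominus>\<^bsub>V\<^esub> x) = f ?v \<ominus>\<^bsub>U\<^esub> f x"
      using f v x fc vectorspace_add_minus[OF V v(1) x] vectorspace_add_minus[OF U fc]
      by (simp add: module_hom_add module_hom_smult)
    then have "f ?v \<oplus>\<^bsub>U\<^esub> (\<ominus>\<^bsub>U\<^esub> f x) = \<zero>\<^bsub>U\<^esub>" using null[OF v(2)] by (simp add: a_minus_def)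
    then have "f ?v = f x" using fc U.M.minus_equality[of "f ?v" "\<ominus>\<^bsub>U\<^esub> f x"] by simp
    then show ?thesis using x by (simp add: quotient_simps)
  qed
  have "?h \<in> module_hom K (quotient_space V W) U"
  proof (rule module_homI)
    fix C assume "C \<in> carrier (quotient_space V W)"
    then obtain x where x: "x \<in> carrier V" "C = proj x" by (auto simp: quotient_simps)
    then show "?h C \<in> carrier U" using h f by (simp add: module_hom_in)
    show "?h (c \<odot>\<^bsub>quotient_space V W\<^esub> C) = c \<odot>\<^bsub>U\<^esub> ?h C" if "c \<in> carrier K" for c
      using that x h f by (simp add: quotient_simps(3,4) module_hom_smult)
    fix D assume "D \<in> carrier (quotient_space V W)"
    then obtain y where y: "y \<in> carrier V" "D = proj y" by (auto simp: quotient_simps)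
    then show "?h (C \<oplus>\<^bsub>quotient_space V W\<^esub> D) = ?h C \<oplus>\<^bsub>U\<^esub> ?h D"
      using x h f by (simp add: quotient_simps(3,4) module_hom_add)
  qed
  then show ?thesis using that[of ?h] h by simp
qed

end

section \<open>Tensor products and their universal property\<close>

definition balanced_map ::
  "'k ring \<Rightarrow> ('r, 'z) ring_scheme \<Rightarrow> ('k, 'r, 'm, 'x) rmod_scheme \<Rightarrow> ('k, 'r, 'n, 'y) lmod_scheme
    \<Rightarrow> ('k, 'u, 'w) module_scheme \<Rightarrow> ('m \<Rightarrow> 'n \<Rightarrow> 'u) \<Rightarrow> bool"
  where "balanced_map K R M N U b \<longleftrightarrow>
    (\<forall>n\<in>carrier N. (\<lambda>m. b m n) \<in> module_hom K M U) \<and> (\<forall>m\<in>carrier M. b m \<in> module_hom K N U)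
    \<and> (\<forall>m\<in>carrier M. \<forall>r\<in>carrier R. \<forall>n\<in>carrier N. b (ract M m r) n = b m (lact N r n))"

text \<open>Closure of the actions keeps the balancing relations inside the free space. The same
  interface serves tensor products over K of plain vector spaces and the tensor product over A with
  the co-regular bimodule.\<close>

locale tensor_factors =
  fixes K :: "'k ring" and R :: "('r, 'z) ring_scheme"
    and M :: "('k, 'r, 'm, 'x) rmod_scheme" and N :: "('k, 'r, 'n, 'y) lmod_scheme"
  assumes M: "vectorspace K M" and N: "vectorspace K N"
    and ract_closed: "\<And>m r. m \<in> carrier M \<Longrightarrow> r \<in> carrier R \<Longrightarrow> ract M m r \<in> carrier M"
    and lact_closed: "\<And>r n. r \<in> carrier R \<Longrightarrow> n \<in> carrier N \<Longrightarrow> lact N r n \<in> carrier N"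
begin

abbreviation (input) F where "F \<equiv> free_space K (carrier M \<times> carrier N)"
abbreviation (input) T where "T \<equiv> tensor K R M N"
abbreviation (input) pt where "pt \<equiv> pure_tensor K R M N"
abbreviation (input) d where "d m n \<equiv> delta K (m, n)"

lemma field: "field K"
  using M by (rule vectorspace_field)

lemma F: "vectorspace K F"
  by (rule vectorspace_free_space[OF field])

interpretation F: vectorspace K F by (rule F)

lemma d_in_F: "m \<in> carrier M \<Longrightarrow> n \<in> carrier N \<Longrightarrow> d m n \<in> carrier F"
  by (rule delta_in_free_space[OF field]) simp

lemma rels_subset: "tensor_rels K R M N \<subseteq> carrier F"
  unfolding tensor_rels_def Let_def
  by (auto intro!: F.M.minus_closed F.M.a_closed F.smult_closed d_in_F vectorspace_add[OF M] vectorspace_add[OF N]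
      vectorspace_smult[OF M] vectorspace_smult[OF N] ract_closed lact_closed)

lemma null: "linear_subset K F (tensor_null K R M N)" "tensor_rels K R M N \<subseteq> tensor_null K R M N"
  unfolding tensor_null_def using linear_subset_span[OF F rels_subset] by auto

sublocale Q: linear_quotient K F "tensor_null K R M N"
  by unfold_locales (rule F null)+

lemma vectorspace_tensor: "vectorspace K T"
  unfolding tensor_def by (rule Q.vectorspace_quotient)

lemma proj_tensor: "Q.proj \<in> module_hom K F T"
  unfolding tensor_def by (rule Q.proj_hom)

lemma pure_eqI:
  assumes "x \<in> carrier F" "y \<in> carrier F" "x \<ominus>\<^bsub>F\<^esub> y \<in> tensor_rels K R M N"
  shows "Q.proj x = Q.proj y"
  using assms null(2) by (subst Q.proj_eq) auto

lemma pure_closed: "m \<in> carrier M \<Longrightarrow> n \<in> carrier N \<Longrightarrow> pt m n \<in> carrier T"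
  unfolding pure_tensor_def by (rule module_hom_in[OF proj_tensor d_in_F])

lemma pure_hom_left:
  assumes "n \<in> carrier N" shows "(\<lambda>m. pt m n) \<in> module_hom K M T"
proof (rule module_homI)
  fix m assume m: "m \<in> carrier M"
  show "pt m n \<in> carrier T" using assms m by (simp add: pure_closed)
  fix m' assume m': "m' \<in> carrier M"
  have "Q.proj (d (m \<oplus>\<^bsub>M\<^esub> m') n) = Q.proj (d m n \<oplus>\<^bsub>F\<^esub> d m' n)"
    using assms m m'
    by (intro pure_eqI F.M.a_closed d_in_F vectorspace_add[OF M]) (auto simp: tensor_rels_def Let_def)
  then show "pt (m \<oplus>\<^bsub>M\<^esub> m') n = pt m n \<oplus>\<^bsub>T\<^esub> pt m' n"
    using assms m m' unfolding pure_tensor_def by (simp add: module_hom_add[OF proj_tensor] d_in_F)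
next
  fix c m assume c: "c \<in> carrier K" and m: "m \<in> carrier M"
  have "Q.proj (d (c \<odot>\<^bsub>M\<^esub> m) n) = Q.proj (c \<odot>\<^bsub>F\<^esub> d m n)"
    using assms m c
    by (intro pure_eqI F.smult_closed d_in_F vectorspace_smult[OF M]) (auto simp: tensor_rels_def Let_def)
  then show "pt (c \<odot>\<^bsub>M\<^esub> m) n = c \<odot>\<^bsub>T\<^esub> pt m n"
    using assms m c unfolding pure_tensor_def by (simp add: module_hom_smult[OF proj_tensor] d_in_F)
qed

lemma pure_hom_right:
  assumes "m \<in> carrier M" shows "pt m \<in> module_hom K N T"
proof (rule module_homI)
  fix n assume n: "n \<in> carrier N"
  show "pt m n \<in> carrier T" using assms n by (simp add: pure_closed)
  fix n' assume n': "n' \<in> carrier N"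
  have "Q.proj (d m (n \<oplus>\<^bsub>N\<^esub> n')) = Q.proj (d m n \<oplus>\<^bsub>F\<^esub> d m n')"
    using assms n n'
    by (intro pure_eqI F.M.a_closed d_in_F vectorspace_add[OF N]) (auto simp: tensor_rels_def Let_def)
  then show "pt m (n \<oplus>\<^bsub>N\<^esub> n') = pt m n \<oplus>\<^bsub>T\<^esub> pt m n'"
    using assms n n' unfolding pure_tensor_def by (simp add: module_hom_add[OF proj_tensor] d_in_F)
next
  fix c n assume c: "c \<in> carrier K" and n: "n \<in> carrier N"
  have "Q.proj (d m (c \<odot>\<^bsub>N\<^esub> n)) = Q.proj (c \<odot>\<^bsub>F\<^esub> d m n)"
    using assms n c
    by (intro pure_eqI F.smult_closed d_in_F vectorspace_smult[OF N]) (auto simp: tensor_rels_def Let_def)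
  then show "pt m (c \<odot>\<^bsub>N\<^esub> n) = c \<odot>\<^bsub>T\<^esub> pt m n"
    using assms n c unfolding pure_tensor_def by (simp add: module_hom_smult[OF proj_tensor] d_in_F)
qed

lemma pure_balanced:
  assumes "m \<in> carrier M" "r \<in> carrier R" "n \<in> carrier N"
  shows "pt (ract M m r) n = pt m (lact N r n)"
  unfolding pure_tensor_def using assms
  by (intro pure_eqI d_in_F ract_closed lact_closed) (auto simp: tensor_rels_def Let_def)

text \<open>A linear subset containing the pure tensors pulls back to a linear subset of the free
  space containing all \<open>delta\<close>s, and the projection is onto.\<close>

lemma tensor_generated:
  assumes U: "linear_subset K T U" "\<And>m n. m \<in> carrier M \<Longrightarrow> n \<in> carrier N \<Longrightarrow> pt m n \<in> U"
  shows "carrier T \<subseteq> U"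
proof -
  have "carrier F \<subseteq> {x \<in> carrier F. Q.proj x \<in> U}"
  proof (rule free_space_generated[OF field])
    show "linear_subset K F {x \<in> carrier F. Q.proj x \<in> U}"
      using linear_subset_vimage[OF F vectorspace_tensor proj_tensor U(1)] .
  qed (use U(2) in \<open>auto simp: d_in_F pure_tensor_def\<close>)
  then show ?thesis unfolding tensor_def Q.quotient_simps by auto
qed

text \<open>The equalizer of f and g is a linear subset. Identities about tensor products are
  reduced to pure tensors in this way throughout.\<close>

lemma tensor_hom_eqI:
  assumes "vectorspace K U" "f \<in> module_hom K T U" "g \<in> module_hom K T U"
    and "\<And>m n. m \<in> carrier M \<Longrightarrow> n \<in> carrier N \<Longrightarrow> f (pt m n) = g (pt m n)" and "t \<in> carrier T"
  shows "f t = g t"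
proof -
  have "carrier T \<subseteq> {x \<in> carrier T. f x = g x}"
    by (rule tensor_generated)
      (use assms in \<open>auto intro: linear_subset_equalizer[OF vectorspace_tensor] simp: pure_closed\<close>)
  then show ?thesis using assms(5) by auto
qed

lemma tensor_lift:
  assumes U: "vectorspace K U" and b: "balanced_map K R M N U b"
  obtains h where "h \<in> module_hom K T U" "h \<in> extensional (carrier T)"
    "\<And>m n. m \<in> carrier M \<Longrightarrow> n \<in> carrier N \<Longrightarrow> h (pt m n) = b m n"
proof -
  interpret U: vectorspace K U by (rule U)
  have bl: "(\<lambda>m. b m n) \<in> module_hom K M U" if "n \<in> carrier N" for n
    using b that by (simp add: balanced_map_def)
  have br: "b m \<in> module_hom K N U" if "m \<in> carrier M" for m
    using b that by (simp add: balanced_map_def)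
  have bin: "b m n \<in> carrier U" if "m \<in> carrier M" "n \<in> carrier N" for m n
    using module_hom_in[OF br] that by auto
  have bb: "b (ract M m r) n = b m (lact N r n)"
    if "m \<in> carrier M" "r \<in> carrier R" "n \<in> carrier N" for m r n
    using b that by (simp add: balanced_map_def)
  obtain f where f: "f \<in> module_hom K F U"
    "\<And>s. s \<in> carrier M \<times> carrier N \<Longrightarrow> f (delta K s) = (case s of (m, n) \<Rightarrow> b m n)"
    using free_space_lift[OF U, of "carrier M \<times> carrier N" "\<lambda>(m, n). b m n"] bin by auto
  have fd: "f (d m n) = b m n" if "m \<in> carrier M" "n \<in> carrier N" for m n using f(2) that by auto
  \<comment> \<open>Every relator is a difference, so killing it amounts to an equality of f-values
    at its two ends, which bilinearity or balancedness of b supplies.\<close>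
  have minus: "f (x \<ominus>\<^bsub>F\<^esub> y) = \<zero>\<^bsub>U\<^esub>" if "x \<in> carrier F" "y \<in> carrier F" "f x = f y" for x y
  proof -
    have fc: "f x \<in> carrier U" "f y \<in> carrier U" using f(1) that by (auto simp: module_hom_in)
    have "f (x \<ominus>\<^bsub>F\<^esub> y) = f x \<ominus>\<^bsub>U\<^esub> f y"
      using f(1) that(1,2) vectorspace_add_minus[OF F that(1,2)] vectorspace_add_minus[OF U fc]
      by (simp add: module_hom_add module_hom_smult)
    then show ?thesis using that(3) fc by (simp add: a_minus_def U.M.r_neg)
  qed
  let ?ker = "{x \<in> carrier F. f x \<in> {\<zero>\<^bsub>U\<^esub>}}"
  have "tensor_rels K R M N \<subseteq> ?ker"
  proof
    fix x assume x: "x \<in> tensor_rels K R M N"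
    then have "f x = \<zero>\<^bsub>U\<^esub>"
      unfolding tensor_rels_def Let_def
      by (auto intro!: minus F.M.a_closed F.smult_closed d_in_F vectorspace_add[OF M] vectorspace_add[OF N]
        vectorspace_smult[OF M] vectorspace_smult[OF N] ract_closed lact_closed
        simp: module_hom_add[OF f(1)] module_hom_smult[OF f(1)] d_in_F fd vectorspace_add[OF M] vectorspace_add[OF N]
        vectorspace_smult[OF M] vectorspace_smult[OF N] ract_closed lact_closed
        module_hom_add[OF bl] module_hom_smult[OF bl] module_hom_add[OF br] module_hom_smult[OF br] bb)
    then show "x \<in> ?ker" using x rels_subset by auto
  qed
  moreover have "linear_subset K F ?ker"
    by (rule linear_subset_vimage[OF F U f(1)]) (auto simp: linear_subset_def)
  ultimately have "tensor_null K R M N \<subseteq> ?ker"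
    unfolding tensor_null_def by (intro span_subset_linear[OF F])
  then obtain h where "h \<in> module_hom K T U" "h \<in> extensional (carrier T)"
    "\<And>x. x \<in> carrier F \<Longrightarrow> h (Q.proj x) = f x"
    using Q.quotient_lift[OF U f(1)] unfolding tensor_def by blast
  then show ?thesis using that fd d_in_F by (auto simp: pure_tensor_def)
qed

text \<open>Generators propagate one variable at a time: for a fixed generator n, the m with m
  \<otimes> n in U form a linear subset, hence all of M; then the same in the other
  variable.\<close>

lemma fin_dim_tensor:
  assumes "vectorspace.fin_dim K M" "vectorspace.fin_dim K N"
  shows "vectorspace.fin_dim K T"
proof -
  obtain S where S: "finite S" "S \<subseteq> carrier M"
    "\<And>U. linear_subset K M U \<Longrightarrow> S \<subseteq> U \<Longrightarrow> carrier M \<subseteq> U"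
    using fin_dim_cases[OF M assms(1)] by blast
  obtain S' where S': "finite S'" "S' \<subseteq> carrier N"
    "\<And>U. linear_subset K N U \<Longrightarrow> S' \<subseteq> U \<Longrightarrow> carrier N \<subseteq> U"
    using fin_dim_cases[OF N assms(2)] by blast
  show ?thesis
  proof (rule fin_dimI[OF vectorspace_tensor, of "(\<lambda>(m, n). pt m n) ` (S \<times> S')"])
    show "finite ((\<lambda>(m, n). pt m n) ` (S \<times> S'))" using S S' by simp
    show "(\<lambda>(m, n). pt m n) ` (S \<times> S') \<subseteq> carrier T" using S(2) S'(2) by (auto intro!: pure_closed)
    fix U assume U: "linear_subset K T U" "(\<lambda>(m, n). pt m n) ` (S \<times> S') \<subseteq> U"
    have *: "pt m n \<in> U" if "m \<in> carrier M" "n \<in> S'" for m n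
    proof -
      have "carrier M \<subseteq> {m \<in> carrier M. pt m n \<in> U}"
        by (rule S(3)[OF linear_subset_vimage[OF M vectorspace_tensor pure_hom_left U(1)]])
          (use S' S U that in auto)
      then show ?thesis using that by auto
    qed
    have "pt m n \<in> U" if "m \<in> carrier M" "n \<in> carrier N" for m n
    proof -
      have "carrier N \<subseteq> {n \<in> carrier N. pt m n \<in> U}"
        by (rule S'(3)[OF linear_subset_vimage[OF N vectorspace_tensor pure_hom_right U(1)]])
          (use S' * that in auto)
      then show ?thesis using that by auto
    qed
    then show "carrier T \<subseteq> U" by (rule tensor_generated[OF U(1)])
  qed
qed

end

text \<open>Discharges the definite description in \<open>tensor_map\<close>: existence is the
  universal property, and uniqueness holds because extensional linear maps that agree on pure
  tensors coincide.\<close>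

lemma tensor_map_characterization:
  assumes "tensor_factors K R M N" "tensor_factors K R M' N'"
    and f: "f \<in> module_hom K M M'" "\<And>m r. m \<in> carrier M \<Longrightarrow> r \<in> carrier R \<Longrightarrow> f (ract M m r) = ract M' (f m) r"
    and g: "g \<in> module_hom K N N'" "\<And>n r. n \<in> carrier N \<Longrightarrow> r \<in> carrier R \<Longrightarrow> g (lact N r n) = lact N' r (g n)"
  shows "tensor_map K R M N M' N' f g \<in> module_hom K (tensor K R M N) (tensor K R M' N')"
    and "tensor_map K R M N M' N' f g \<in> extensional (carrier (tensor K R M N))"
    and "\<And>m n. m \<in> carrier M \<Longrightarrow> n \<in> carrier N \<Longrightarrow>
      tensor_map K R M N M' N' f g (pure_tensor K R M N m n) = pure_tensor K R M' N' (f m) (g n)"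
proof -
  interpret A: tensor_factors K R M N by fact
  interpret B: tensor_factors K R M' N' by fact
  let ?P = "\<lambda>h. h \<in> module_hom K (tensor K R M N) (tensor K R M' N') \<inter> extensional (carrier (tensor K R M N))
      \<and> (\<forall>m\<in>carrier M. \<forall>n\<in>carrier N.
            h (pure_tensor K R M N m n) = pure_tensor K R M' N' (f m) (g n))"
  have "balanced_map K R M N (tensor K R M' N') (\<lambda>m n. pure_tensor K R M' N' (f m) (g n))"
    unfolding balanced_map_def
    using module_hom_compose[OF f(1) B.pure_hom_left] module_hom_compose[OF g(1) B.pure_hom_right]
    by (auto simp: f(2) g(2) module_hom_in[OF f(1)] module_hom_in[OF g(1)] B.pure_balanced)
  then obtain h where h: "h \<in> module_hom K (tensor K R M N) (tensor K R M' N')"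
    "h \<in> extensional (carrier (tensor K R M N))"
    "\<And>m n. m \<in> carrier M \<Longrightarrow> n \<in> carrier N \<Longrightarrow> h (pure_tensor K R M N m n) = pure_tensor K R M' N' (f m) (g n)"
    by (rule A.tensor_lift[OF B.vectorspace_tensor]) blast
  have "?P (tensor_map K R M N M' N' f g)"
    unfolding tensor_map_def
  proof (rule theI[of ?P])
    show "?P h" using h by simp
    fix h' assume h': "?P h'"
    show "h' = h"
    proof (rule extensionalityI)
      show "h' \<in> extensional (carrier (tensor K R M N))" using h' by simp
      fix t assume t: "t \<in> carrier (tensor K R M N)"
      show "h' t = h t"
        by (rule A.tensor_hom_eqI[OF B.vectorspace_tensor _ h(1) _ t]) (use h' h(3) in simp_all)
    qed (rule h(2))
  qed
  then show "tensor_map K R M N M' N' f g \<in> module_hom K (tensor K R M N) (tensor K R M' N')"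
    and "tensor_map K R M N M' N' f g \<in> extensional (carrier (tensor K R M N))"
    and "\<And>m n. m \<in> carrier M \<Longrightarrow> n \<in> carrier N \<Longrightarrow>
      tensor_map K R M N M' N' f g (pure_tensor K R M N m n) = pure_tensor K R M' N' (f m) (g n)"
    by auto
qed

lemma space_mod_simps [simp]:
  "carrier (space_rmod V) = carrier V" "\<zero>\<^bsub>space_rmod V\<^esub> = \<zero>\<^bsub>V\<^esub>" "add (space_rmod V) = add V"
  "smult (space_rmod V) = smult V" "ract (space_rmod V) v c = c \<odot>\<^bsub>V\<^esub> v"
  "carrier (space_lmod V) = carrier V" "\<zero>\<^bsub>space_lmod V\<^esub> = \<zero>\<^bsub>V\<^esub>" "add (space_lmod V) = add V"
  "smult (space_lmod V) = smult V" "lact (space_lmod V) c v = c \<odot>\<^bsub>V\<^esub> v"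
  by (simp_all add: space_rmod_def space_lmod_def)

lemma module_hom_space_mod [simp]:
  "module_hom K (space_rmod V) W = module_hom K V W" "module_hom K (space_lmod V) W = module_hom K V W"
  "module_hom K U (space_rmod V) = module_hom K U V" "module_hom K U (space_lmod V) = module_hom K U V"
  by (simp_all add: module_hom_def)

lemma tensor_factors_space:
  assumes "vectorspace K V" "vectorspace K W"
  shows "tensor_factors K K (space_rmod V) (space_lmod W)"
proof (rule tensor_factors.intro)
  show "vectorspace K (space_rmod V)" by (rule vectorspace_transfer[OF assms(1)]) simp_all
  show "vectorspace K (space_lmod W)" by (rule vectorspace_transfer[OF assms(2)]) simp_all
qed (use assms in \<open>auto simp: vectorspace_smult\<close>)

abbreviation space_pure :: "'k ring \<Rightarrow> ('k, 'v) module \<Rightarrow> ('k, 'w) module \<Rightarrow> 'v \<Rightarrow> 'w \<Rightarrow> ('v \<times> 'w \<Rightarrow> 'k) set"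
  where "space_pure K V W \<equiv> pure_tensor K K (space_rmod V) (space_lmod W)"

text \<open>Over the ground field balancedness is automatic: linearity in each argument turns both
  sides into the same scalar multiple.\<close>

lemma space_tensor_lift:
  assumes "vectorspace K V" "vectorspace K W" "vectorspace K U"
    and "\<And>w. w \<in> carrier W \<Longrightarrow> (\<lambda>v. b v w) \<in> module_hom K V U"
    and "\<And>v. v \<in> carrier V \<Longrightarrow> b v \<in> module_hom K W U"
  obtains h where "h \<in> module_hom K (space_tensor K V W) U"
    "\<And>v w. v \<in> carrier V \<Longrightarrow> w \<in> carrier W \<Longrightarrow> h (space_pure K V W v w) = b v w"
proof -
  interpret tensor_factors K K "space_rmod V" "space_lmod W" using assms by (simp add: tensor_factors_space)
  have "b (r \<odot>\<^bsub>V\<^esub> v) w = b v (r \<odot>\<^bsub>W\<^esub> w)"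
    if "v \<in> carrier V" "r \<in> carrier K" "w \<in> carrier W" for v r w
    using module_hom_smult[OF assms(4)] module_hom_smult[OF assms(5)] that by simp
  then have "balanced_map K K (space_rmod V) (space_lmod W) U b"
    using assms(4,5) by (auto simp: balanced_map_def)
  then show ?thesis using tensor_lift[OF assms(3)] that unfolding space_tensor_def by (metis space_mod_simps(1,6))
qed

lemma space_tensor_map_characterization:
  assumes "vectorspace K V" "vectorspace K W" "vectorspace K V'" "vectorspace K W'"
    and "f \<in> module_hom K V V'" "g \<in> module_hom K W W'"
  shows "space_tensor_map K V W V' W' f g \<in> module_hom K (space_tensor K V W) (space_tensor K V' W')"
    and "\<And>v w. v \<in> carrier V \<Longrightarrow> w \<in> carrier W \<Longrightarrow>
      space_tensor_map K V W V' W' f g (space_pure K V W v w) = space_pure K V' W' (f v) (g w)"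
  using tensor_map_characterization[OF tensor_factors_space[OF assms(1,2)] tensor_factors_space[OF assms(3,4)],
      of f g] assms(5,6)
  unfolding space_tensor_map_def space_tensor_def by (auto simp: module_hom_smult)

section \<open>Copowers and coends in a linear category\<close>

context linear_category
begin

lemma cmp_closed:
  assumes "x \<in> Obj \<X>" "y \<in> Obj \<X>" "z \<in> Obj \<X>" "f \<in> arr \<X> x y" "g \<in> arr \<X> y z"
  shows "cmp \<X> x y z g f \<in> arr \<X> x z"
  using module_hom_in[OF precomp_linear[OF assms(1-4)] assms(5)] .

end

section \<open>Copowers as universal objects for outgoing morphisms\<close>

text \<open>The Yoneda element of the representing isomorphism, in the form of the universal linear
  map V -> Hom(x, V \<otimes> x). Coends are later handled through this map rather than through
  \<beta>.\<close>

definition copower_inj ::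
  "'k ring \<Rightarrow> ('o, 'm, 'k) lcat \<Rightarrow> ('k, 'v) module \<Rightarrow> 'o \<Rightarrow> ('o \<Rightarrow> ('v \<times> 'm \<Rightarrow> 'k) set \<Rightarrow> 'm) \<Rightarrow> 'v \<Rightarrow> 'm"
  where "copower_inj K \<X> V x \<beta> v = \<beta> x (space_pure K V (Hom \<X> x x) v (idt \<X> x))"

locale copower = linear_category K \<X>
  for K :: "'k ring" and \<X> :: "('o, 'm, 'k) lcat" +
  fixes V :: "('k, 'v) module" and x p :: 'o and \<beta> :: "'o \<Rightarrow> ('v \<times> 'm \<Rightarrow> 'k) set \<Rightarrow> 'm"
  assumes V: "vectorspace K V" and x: "x \<in> Obj \<X>" and rep: "represents_copower K \<X> V x p \<beta>"
begin

abbreviation (input) e where "e \<equiv> copower_inj K \<X> V x \<beta>"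
abbreviation (input) VH where "VH z \<equiv> space_tensor K V (Hom \<X> z x)"

lemma p: "p \<in> Obj \<X>"
  using rep by (simp add: represents_copower_def)

lemma H: "z \<in> Obj \<X> \<Longrightarrow> vectorspace K (Hom \<X> z x)"
  using Hom_vectorspace x by blast

lemma VH_eqI:
  assumes "z \<in> Obj \<X>" "vectorspace K U" "f \<in> module_hom K (VH z) U" "g \<in> module_hom K (VH z) U"
    and "\<And>v h. v \<in> carrier V \<Longrightarrow> h \<in> arr \<X> z x \<Longrightarrow>
      f (space_pure K V (Hom \<X> z x) v h) = g (space_pure K V (Hom \<X> z x) v h)"
    and "t \<in> carrier (VH z)"
  shows "f t = g t"
  using tensor_factors.tensor_hom_eqI[OF tensor_factors_space[OF V H[OF assms(1)]] assms(2), of f g t]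
    assms(3-6) by (simp add: space_tensor_def)

lemma pure_closed:
  assumes "z \<in> Obj \<X>" "v \<in> carrier V" "h \<in> arr \<X> z x"
  shows "space_pure K V (Hom \<X> z x) v h \<in> carrier (VH z)"
  using tensor_factors.pure_closed[OF tensor_factors_space[OF V H[OF assms(1)]], of v h] assms(2,3)
  by (simp add: space_tensor_def)

lemma beta_hom: "z \<in> Obj \<X> \<Longrightarrow> \<beta> z \<in> module_hom K (VH z) (Hom \<X> z p)"
  and beta_bij: "z \<in> Obj \<X> \<Longrightarrow> bij_betw (\<beta> z) (carrier (VH z)) (arr \<X> z p)"
  using rep by (auto simp: represents_copower_def)

text \<open>Yoneda: naturality of \<beta> along h, applied to v \<otimes> id.\<close>

lemma beta_pure:
  assumes z: "z \<in> Obj \<X>" and v: "v \<in> carrier V" and h: "h \<in> arr \<X> z x"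
  shows "\<beta> z (space_pure K V (Hom \<X> z x) v h) = cmp \<X> z x p (e v) h"
proof -
  note i = idt_arr[OF x]
  have "\<beta> z (space_tensor_map K V (Hom \<X> x x) V (Hom \<X> z x) (\<lambda>v. v) (\<lambda>g. cmp \<X> z x x g h)
      (space_pure K V (Hom \<X> x x) v (idt \<X> x))) = cmp \<X> z x p (e v) h"
    using rep z h x pure_closed[OF x v i] unfolding represents_copower_def copower_inj_def by auto
  also have "space_tensor_map K V (Hom \<X> x x) V (Hom \<X> z x) (\<lambda>v. v) (\<lambda>g. cmp \<X> z x x g h)
      (space_pure K V (Hom \<X> x x) v (idt \<X> x)) = space_pure K V (Hom \<X> z x) v h"
    using cmp_idt_left[OF z x h]
    by (subst space_tensor_map_characterization(2)[OF V H[OF x] V H[OF z] _ precomp_linear[OF z x x h] v i])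
      (auto intro: module_homI)
  finally show ?thesis .
qed

lemma inj_hom: "e \<in> module_hom K V (Hom \<X> x p)"
proof -
  interpret t: tensor_factors K K "space_rmod V" "space_lmod (Hom \<X> x x)"
    by (rule tensor_factors_space[OF V H[OF x]])
  have "(\<lambda>v. space_pure K V (Hom \<X> x x) v (idt \<X> x)) \<in> module_hom K V (VH x)"
    using t.pure_hom_left[of "idt \<X> x"] idt_arr[OF x] by (simp add: space_tensor_def)
  from module_hom_compose[OF this beta_hom[OF x]] show ?thesis
    unfolding copower_inj_def[abs_def] .
qed

lemma inj_arr: "v \<in> carrier V \<Longrightarrow> e v \<in> arr \<X> x p"
  using module_hom_in[OF inj_hom] .

text \<open>The definition of a copower concerns morphisms into p only. This tensor in V \<otimes>
  Hom(p, x) gives access to morphisms out of p: through \<beta> it writes the identity of p as a sum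
  of composites of a morphism p -> x with some \<open>e v\<close>.\<close>

lemma idt_preimage:
  obtains t where "t \<in> carrier (VH p)" "\<beta> p t = idt \<X> p"
proof -
  have "idt \<X> p \<in> \<beta> p ` carrier (VH p)"
    using beta_bij[OF p] idt_arr[OF p] by (simp add: bij_betw_def)
  then show ?thesis using that by auto
qed

lemma copower_hom_eqI:
  assumes d: "d \<in> Obj \<X>" and q: "q \<in> arr \<X> p d" and r: "r \<in> arr \<X> p d"
    and eq: "\<And>v. v \<in> carrier V \<Longrightarrow> cmp \<X> x p d q (e v) = cmp \<X> x p d r (e v)"
  shows "q = r"
proof -
  obtain t where t: "t \<in> carrier (VH p)" "\<beta> p t = idt \<X> p" by (rule idt_preimage)
  have "cmp \<X> p p d q (\<beta> p t) = cmp \<X> p p d r (\<beta> p t)"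
  proof (rule VH_eqI[OF p Hom_vectorspace[OF p d] _ _ _ t(1)])
    show "(\<lambda>t. cmp \<X> p p d q (\<beta> p t)) \<in> module_hom K (VH p) (Hom \<X> p d)"
      by (rule module_hom_compose[OF beta_hom[OF p] postcomp_linear[OF p p d q]])
    show "(\<lambda>t. cmp \<X> p p d r (\<beta> p t)) \<in> module_hom K (VH p) (Hom \<X> p d)"
      by (rule module_hom_compose[OF beta_hom[OF p] postcomp_linear[OF p p d r]])
    fix v h assume v: "v \<in> carrier V" and h: "h \<in> arr \<X> p x"
    show "cmp \<X> p p d q (\<beta> p (space_pure K V (Hom \<X> p x) v h))
        = cmp \<X> p p d r (\<beta> p (space_pure K V (Hom \<X> p x) v h))"
      by (simp add: beta_pure[OF p v h] cmp_assoc[OF p x p d h inj_arr[OF v]] q r eq[OF v])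
  qed
  then show ?thesis using t(2) by (simp add: cmp_idt_right[OF p d] q r)
qed

text \<open>The required morphism is the image of the preimage t of the identity of p under v
  \<otimes> h -> \<phi> v after h. Naturality of \<beta> along \<open>e v\<close>, with injectivity
  of \<beta> at x, carries t to v \<otimes> id, and this produces the value \<phi> v.\<close>

lemma copower_extend:
  assumes d: "d \<in> Obj \<X>" and \<phi>: "\<phi> \<in> module_hom K V (Hom \<X> x d)"
  obtains q where "q \<in> arr \<X> p d" "\<And>v. v \<in> carrier V \<Longrightarrow> cmp \<X> x p d q (e v) = \<phi> v"
proof -
  have \<phi>a: "v \<in> carrier V \<Longrightarrow> \<phi> v \<in> arr \<X> x d" for v using module_hom_in[OF \<phi>] .
  have "\<exists>\<psi>. \<psi> \<in> module_hom K (VH z) (Hom \<X> z d) \<and> (\<forall>v\<in>carrier V. \<forall>h\<in>arr \<X> z x.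
      \<psi> (space_pure K V (Hom \<X> z x) v h) = cmp \<X> z x d (\<phi> v) h)" if z: "z \<in> Obj \<X>" for z
  proof -
    obtain \<psi> where "\<psi> \<in> module_hom K (VH z) (Hom \<X> z d)" "\<And>v h. v \<in> carrier V \<Longrightarrow> h \<in> arr \<X> z x \<Longrightarrow>
      \<psi> (space_pure K V (Hom \<X> z x) v h) = cmp \<X> z x d (\<phi> v) h"
    proof (rule space_tensor_lift[OF V H[OF z] Hom_vectorspace[OF z d], of "\<lambda>v h. cmp \<X> z x d (\<phi> v) h"])
      show "(\<lambda>v. cmp \<X> z x d (\<phi> v) h) \<in> module_hom K V (Hom \<X> z d)" if "h \<in> arr \<X> z x" for h
        by (rule module_hom_compose[OF \<phi> precomp_linear[OF z x d that]])
      show "(\<lambda>h. cmp \<X> z x d (\<phi> v) h) \<in> module_hom K (Hom \<X> z x) (Hom \<X> z d)" if "v \<in> carrier V" for v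
        by (rule postcomp_linear[OF z x d \<phi>a[OF that]])
    qed blast
    then show ?thesis by blast
  qed
  then obtain \<psi> where \<psi>: "\<And>z. z \<in> Obj \<X> \<Longrightarrow> \<psi> z \<in> module_hom K (VH z) (Hom \<X> z d)"
    "\<And>z v h. z \<in> Obj \<X> \<Longrightarrow> v \<in> carrier V \<Longrightarrow> h \<in> arr \<X> z x \<Longrightarrow>
      \<psi> z (space_pure K V (Hom \<X> z x) v h) = cmp \<X> z x d (\<phi> v) h" by metis
  obtain t where t: "t \<in> carrier (VH p)" "\<beta> p t = idt \<X> p" by (rule idt_preimage)
  have "cmp \<X> x p d (\<psi> p t) (e v) = \<phi> v" if v: "v \<in> carrier V" for v
  proof -
    note ev = inj_arr[OF v] and i = idt_arr[OF x]
    let ?S = "space_tensor_map K V (Hom \<X> p x) V (Hom \<X> x x) (\<lambda>v. v) (\<lambda>h. cmp \<X> x p x h (e v))"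
    have id: "(\<lambda>v. v) \<in> module_hom K V V" by (rule module_homI) auto
    note S = space_tensor_map_characterization[OF V H[OF p] V H[OF x] id precomp_linear[OF x p x ev]]
    have "\<beta> x (?S t) = cmp \<X> x p p (\<beta> p t) (e v)"
      using rep t(1) x p ev unfolding represents_copower_def by blast
    also have "\<dots> = e v" by (simp add: t(2) cmp_idt_left[OF x p ev])
    also have "\<dots> = \<beta> x (space_pure K V (Hom \<X> x x) v (idt \<X> x))" by (simp add: copower_inj_def)
    finally have "?S t = space_pure K V (Hom \<X> x x) v (idt \<X> x)"
      using beta_bij[OF x] pure_closed[OF x v i] module_hom_in[OF S(1) t(1)]
      by (auto simp: bij_betw_def inj_on_def)
    moreover have "\<psi> x (?S t) = cmp \<X> x p d (\<psi> p t) (e v)"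
    proof (rule VH_eqI[OF p Hom_vectorspace[OF x d] _ _ _ t(1)])
      show "(\<lambda>t. \<psi> x (?S t)) \<in> module_hom K (VH p) (Hom \<X> x d)"
        by (rule module_hom_compose[OF S(1) \<psi>(1)[OF x]])
      show "(\<lambda>t. cmp \<X> x p d (\<psi> p t) (e v)) \<in> module_hom K (VH p) (Hom \<X> x d)"
        by (rule module_hom_compose[OF \<psi>(1)[OF p] precomp_linear[OF x p d ev]])
      fix w h assume w: "w \<in> carrier V" and h: "h \<in> arr \<X> p x"
      show "\<psi> x (?S (space_pure K V (Hom \<X> p x) w h))
          = cmp \<X> x p d (\<psi> p (space_pure K V (Hom \<X> p x) w h)) (e v)"
        by (simp add: S(2)[OF w h] \<psi>(2)[OF p w h] \<psi>(2)[OF x w cmp_closed[OF x p x ev h]]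
            cmp_assoc[OF x p x d ev h \<phi>a[OF w]])
    qed
    ultimately show ?thesis by (simp add: \<psi>(2)[OF x v i] cmp_idt_right[OF x d \<phi>a[OF v]])
  qed
  then show ?thesis using that[OF module_hom_in[OF \<psi>(1)[OF p] t(1)]] by blast
qed

end

text \<open>The condition defining \<open>copower_map\<close> ranges over all test objects and
  tensors. It is equivalent to the equation on injections, for which \<open>copower_extend\<close>
  and \<open>copower_hom_eqI\<close> give existence and uniqueness.\<close>

lemma copower_map_characterization:
  assumes "copower K \<X> V x (P V x) (\<beta> V x)" "copower K \<X> W y (P W y) (\<beta> W y)"
    and \<alpha>: "\<alpha> \<in> module_hom K V W" and g: "g \<in> arr \<X> x y"
  shows "copower_map K \<X> P \<beta> V x W y \<alpha> g \<in> arr \<X> (P V x) (P W y)"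
    and "\<And>v. v \<in> carrier V \<Longrightarrow>
      cmp \<X> x (P V x) (P W y) (copower_map K \<X> P \<beta> V x W y \<alpha> g) (copower_inj K \<X> V x (\<beta> V x) v)
      = cmp \<X> x y (P W y) (copower_inj K \<X> W y (\<beta> W y) (\<alpha> v)) g"
proof -
  interpret A: copower K \<X> V x "P V x" "\<beta> V x" by fact
  interpret B: copower K \<X> W y "P W y" "\<beta> W y" by fact
  note x = A.x and y = B.x and p = A.p and r = B.p
  have \<alpha>W: "\<alpha> v \<in> carrier W" if "v \<in> carrier V" for v using module_hom_in[OF \<alpha> that] .
  let ?S = "\<lambda>z. space_tensor_map K V (Hom \<X> z x) W (Hom \<X> z y) \<alpha> (\<lambda>h. cmp \<X> z x y g h)"
  note S = space_tensor_map_characterization[OF A.V A.H B.V B.H \<alpha> A.postcomp_linear[OF _ x y g]]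
  let ?Q = "\<lambda>q. q \<in> arr \<X> (P V x) (P W y) \<and> (\<forall>z\<in>Obj \<X>. \<forall>t\<in>carrier (space_tensor K V (Hom \<X> z x)).
      cmp \<X> z (P V x) (P W y) q (\<beta> V x z t) = \<beta> W y z (?S z t))"
  let ?R = "\<lambda>q. \<forall>v\<in>carrier V. cmp \<X> x (P V x) (P W y) q (copower_inj K \<X> V x (\<beta> V x) v)
      = cmp \<X> x y (P W y) (copower_inj K \<X> W y (\<beta> W y) (\<alpha> v)) g"
  have QR: "?R q" if "?Q q" for q
  proof
    fix v assume v: "v \<in> carrier V"
    note i = A.idt_arr[OF x]
    have "cmp \<X> x (P V x) (P W y) q (copower_inj K \<X> V x (\<beta> V x) v)
        = \<beta> W y x (?S x (space_pure K V (Hom \<X> x x) v (idt \<X> x)))"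
      unfolding copower_inj_def using that A.pure_closed[OF x v i] x by blast
    also have "\<dots> = cmp \<X> x y (P W y) (copower_inj K \<X> W y (\<beta> W y) (\<alpha> v)) g"
      by (simp add: S(2)[OF x x x v i] A.cmp_idt_right[OF x y g] B.beta_pure[OF x \<alpha>W[OF v] g])
    finally show "cmp \<X> x (P V x) (P W y) q (copower_inj K \<X> V x (\<beta> V x) v)
        = cmp \<X> x y (P W y) (copower_inj K \<X> W y (\<beta> W y) (\<alpha> v)) g" .
  qed
  have RQ: "?Q q" if q: "q \<in> arr \<X> (P V x) (P W y)" and R: "?R q" for q
  proof (intro conjI ballI q)
    fix z t assume z: "z \<in> Obj \<X>" and t: "t \<in> carrier (space_tensor K V (Hom \<X> z x))"
    show "cmp \<X> z (P V x) (P W y) q (\<beta> V x z t) = \<beta> W y z (?S z t)"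
    proof (rule A.VH_eqI[OF z A.Hom_vectorspace[OF z r] _ _ _ t])
      show "(\<lambda>t. cmp \<X> z (P V x) (P W y) q (\<beta> V x z t))
          \<in> module_hom K (space_tensor K V (Hom \<X> z x)) (Hom \<X> z (P W y))"
        by (rule module_hom_compose[OF A.beta_hom[OF z] A.postcomp_linear[OF z p r q]])
      show "(\<lambda>t. \<beta> W y z (?S z t)) \<in> module_hom K (space_tensor K V (Hom \<X> z x)) (Hom \<X> z (P W y))"
        by (rule module_hom_compose[OF S(1)[OF z z z] B.beta_hom[OF z]])
      fix v h assume v: "v \<in> carrier V" and h: "h \<in> arr \<X> z x"
      show "cmp \<X> z (P V x) (P W y) q (\<beta> V x z (space_pure K V (Hom \<X> z x) v h))
          = \<beta> W y z (?S z (space_pure K V (Hom \<X> z x) v h))"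
        by (simp add: S(2)[OF z z z v h] A.beta_pure[OF z v h] R[rule_format, OF v]
            B.beta_pure[OF z \<alpha>W[OF v] A.cmp_closed[OF z x y h g]]
            A.cmp_assoc[OF z x p r h A.inj_arr[OF v] q]
            A.cmp_assoc[OF z x y r h g B.inj_arr[OF \<alpha>W[OF v]]])
    qed
  qed
  have \<phi>: "(\<lambda>v. cmp \<X> x y (P W y) (copower_inj K \<X> W y (\<beta> W y) (\<alpha> v)) g)
      \<in> module_hom K V (Hom \<X> x (P W y))"
    by (rule module_hom_compose[OF module_hom_compose[OF \<alpha> B.inj_hom] A.precomp_linear[OF x y r g]])
  obtain q where q: "q \<in> arr \<X> (P V x) (P W y)" "?R q"
    by (rule A.copower_extend[OF r \<phi>]) blast
  have "?Q (copower_map K \<X> P \<beta> V x W y \<alpha> g)"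
    unfolding copower_map_def
  proof (rule theI[of ?Q, OF RQ[OF q]])
    fix q' assume Q: "?Q q'"
    show "q' = q"
      by (rule A.copower_hom_eqI[OF r _ q(1)]) (use Q QR[OF Q] q(2) in simp_all)
  qed
  then show "copower_map K \<X> P \<beta> V x W y \<alpha> g \<in> arr \<X> (P V x) (P W y)"
    and "\<And>v. v \<in> carrier V \<Longrightarrow>
      cmp \<X> x (P V x) (P W y) (copower_map K \<X> P \<beta> V x W y \<alpha> g) (copower_inj K \<X> V x (\<beta> V x) v)
      = cmp \<X> x y (P W y) (copower_inj K \<X> W y (\<beta> W y) (\<alpha> v)) g"
    using QR by blast+
qed

lemma dual_map_hom:
  assumes V: "vectorspace K V" and W: "vectorspace K W" and f: "f \<in> module_hom K V W"
  shows "dual_map K V W f \<in> module_hom K (dual K W) (dual K V)"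
    and "\<And>\<phi>. \<phi> \<in> carrier (dual K W) \<Longrightarrow> dual_map K V W f \<phi> = (\<lambda>v\<in>carrier V. \<phi> (f v))"
proof -
  interpret W: vectorspace K "dual K W" using W by (rule vectorspace_dual)
  show eq: "dual_map K V W f \<phi> = (\<lambda>v\<in>carrier V. \<phi> (f v))" if "\<phi> \<in> carrier (dual K W)" for \<phi>
    using that by (simp add: dual_map_def compose_def)
  show "dual_map K V W f \<in> module_hom K (dual K W) (dual K V)"
  proof (rule module_homI)
    fix \<phi> assume p: "\<phi> \<in> carrier (dual K W)"
    show "dual_map K V W f \<phi> \<in> carrier (dual K V)"
      unfolding eq[OF p] by (rule dual_restrictI[OF V module_hom_compose[OF f dual_form[OF p]]])
    show "dual_map K V W f (\<phi> \<oplus>\<^bsub>dual K W\<^esub> \<psi>) = dual_map K V W f \<phi> \<oplus>\<^bsub>dual K V\<^esub> dual_map K V W f \<psi>"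
      if "\<psi> \<in> carrier (dual K W)" for \<psi>
      using module_hom_in[OF f] unfolding eq[OF p] eq[OF that] eq[OF W.M.a_closed[OF p that]] dual_simps(3)[where V = V]
      by (auto simp: dual_app(2)[where V = W])
    show "dual_map K V W f (c \<odot>\<^bsub>dual K W\<^esub> \<phi>) = c \<odot>\<^bsub>dual K V\<^esub> dual_map K V W f \<phi>"
      if "c \<in> carrier K" for c
      using module_hom_in[OF f] unfolding eq[OF p] eq[OF W.smult_closed[OF that p]] dual_simps(4)[where V = V]
      by (auto simp: dual_app(3)[where V = W])
  qed
qed

section \<open>Natural families and their universal property\<close>

text \<open>
  \<open>dual_family K \<X> y d \<Theta>\<close>: \<open>\<Theta>\<close> is a natural transformation \<open>Hom(y, -)\<^sup>* \<rightarrow> Hom(-, d)\<close>.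
\<close>

definition dual_family ::
  "'k ring \<Rightarrow> ('o, 'm, 'k) lcat \<Rightarrow> 'o \<Rightarrow> 'o \<Rightarrow> ('o \<Rightarrow> ('m \<Rightarrow> 'k) \<Rightarrow> 'm) \<Rightarrow> bool"
  where "dual_family K \<X> y d \<Theta> \<longleftrightarrow>
    (\<forall>x\<in>Obj \<X>. \<Theta> x \<in> module_hom K (dual K (Hom \<X> y x)) (Hom \<X> x d))
    \<and> (\<forall>x\<in>Obj \<X>. \<forall>x'\<in>Obj \<X>. \<forall>f\<in>arr \<X> x x'. \<forall>\<zeta>\<in>carrier (dual K (Hom \<X> y x')).
        \<Theta> x (\<lambda>h\<in>arr \<X> y x. \<zeta> (cmp \<X> y x x' f h)) = cmp \<X> x x' d (\<Theta> x' \<zeta>) f)"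

text \<open>Mentions no copowers, so objects obtained from different choices of \<open>P\<close> and
  \<open>\<beta>\<close> become comparable. The object c represents the functor d -> Nat(Hom(y,
  -)^*, Hom(-, d)).\<close>

definition universal_family ::
  "'k ring \<Rightarrow> ('o, 'm, 'k) lcat \<Rightarrow> 'o \<Rightarrow> 'o \<Rightarrow> ('o \<Rightarrow> ('m \<Rightarrow> 'k) \<Rightarrow> 'm) \<Rightarrow> bool"
  where "universal_family K \<X> y c \<Theta> \<longleftrightarrow>
    c \<in> Obj \<X> \<and> dual_family K \<X> y c \<Theta>
    \<and> (\<forall>d\<in>Obj \<X>. \<forall>\<Theta>'. dual_family K \<X> y d \<Theta>' \<longrightarrow>
        (\<exists>!u. u \<in> arr \<X> c d \<and> (\<forall>x\<in>Obj \<X>. \<forall>\<zeta>\<in>carrier (dual K (Hom \<X> y x)).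
          cmp \<X> x c d u (\<Theta> x \<zeta>) = \<Theta>' x \<zeta>)))"

text \<open>The form that \<open>right_nakayama\<close> takes once the copower data is eliminated;
  the last clause is naturality in the parameter y.\<close>

definition family_functor ::
  "'k ring \<Rightarrow> ('o, 'm, 'k) lcat \<Rightarrow> ('o, 'm, 'o, 'm) functr \<Rightarrow> ('o \<Rightarrow> 'o \<Rightarrow> ('m \<Rightarrow> 'k) \<Rightarrow> 'm) \<Rightarrow> bool"
  where "family_functor K \<X> N \<Theta> \<longleftrightarrow>
    linear_functor K \<X> \<X> N \<and> (\<forall>y\<in>Obj \<X>. universal_family K \<X> y (ob N y) (\<Theta> y))
    \<and> (\<forall>y\<in>Obj \<X>. \<forall>y'\<in>Obj \<X>. \<forall>k\<in>arr \<X> y y'. \<forall>x\<in>Obj \<X>. \<forall>\<zeta>\<in>carrier (dual K (Hom \<X> y x)).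
        cmp \<X> x (ob N y) (ob N y') (mor N y y' k) (\<Theta> y x \<zeta>)
        = \<Theta> y' x (\<lambda>h\<in>arr \<X> y' x. \<zeta> (cmp \<X> y y' x h k)))"

lemma dual_familyD:
  assumes "dual_family K \<X> y d \<Theta>" "x \<in> Obj \<X>"
  shows "\<Theta> x \<in> module_hom K (dual K (Hom \<X> y x)) (Hom \<X> x d)"
    and "\<zeta> \<in> carrier (dual K (Hom \<X> y x)) \<Longrightarrow> \<Theta> x \<zeta> \<in> arr \<X> x d"
    and "x' \<in> Obj \<X> \<Longrightarrow> f \<in> arr \<X> x x' \<Longrightarrow> \<zeta>' \<in> carrier (dual K (Hom \<X> y x')) \<Longrightarrow>
        \<Theta> x (\<lambda>h\<in>arr \<X> y x. \<zeta>' (cmp \<X> y x x' f h)) = cmp \<X> x x' d (\<Theta> x' \<zeta>') f"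
  using assms by (auto simp: dual_family_def module_hom_in)

context linear_category
begin

lemma dual_pull:
  assumes "x \<in> Obj \<X>" "x' \<in> Obj \<X>" "y \<in> Obj \<X>" "f \<in> arr \<X> x x'" "\<zeta> \<in> carrier (dual K (Hom \<X> y x'))"
  shows "(\<lambda>h\<in>arr \<X> y x. \<zeta> (cmp \<X> y x x' f h)) \<in> carrier (dual K (Hom \<X> y x))"
  using assms Hom_vectorspace
  by (intro dual_restrictI module_hom_compose[OF postcomp_linear] dual_form) auto

lemma dual_push:
  assumes "x \<in> Obj \<X>" "y' \<in> Obj \<X>" "y \<in> Obj \<X>" "k \<in> arr \<X> y y'" "\<zeta> \<in> carrier (dual K (Hom \<X> y x))"
  shows "(\<lambda>h\<in>arr \<X> y' x. \<zeta> (cmp \<X> y y' x h k)) \<in> carrier (dual K (Hom \<X> y' x))"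
  using assms Hom_vectorspace
  by (intro dual_restrictI module_hom_compose[OF precomp_linear] dual_form) auto

lemma universal_familyD:
  assumes "universal_family K \<X> y c \<Theta>"
  shows "c \<in> Obj \<X>" "dual_family K \<X> y c \<Theta>"
  using assms by (simp_all add: universal_family_def)

lemma universal_family_factor:
  assumes "universal_family K \<X> y c \<Theta>" "d \<in> Obj \<X>" "dual_family K \<X> y d \<Theta>'"
  obtains u where "u \<in> arr \<X> c d"
    "\<And>x \<zeta>. x \<in> Obj \<X> \<Longrightarrow> \<zeta> \<in> carrier (dual K (Hom \<X> y x)) \<Longrightarrow> cmp \<X> x c d u (\<Theta> x \<zeta>) = \<Theta>' x \<zeta>"
proof -
  have "\<exists>u. u \<in> arr \<X> c d \<and> (\<forall>x\<in>Obj \<X>. \<forall>\<zeta>\<in>carrier (dual K (Hom \<X> y x)).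
          cmp \<X> x c d u (\<Theta> x \<zeta>) = \<Theta>' x \<zeta>)"
    using assms unfolding universal_family_def by blast
  then show ?thesis using that by blast
qed

lemma dual_family_postcomp:
  assumes y: "y \<in> Obj \<X>" and c: "c \<in> Obj \<X>" and d: "d \<in> Obj \<X>"
    and fam: "dual_family K \<X> y c \<Theta>" and u: "u \<in> arr \<X> c d"
  shows "dual_family K \<X> y d (\<lambda>x \<zeta>. cmp \<X> x c d u (\<Theta> x \<zeta>))"
  unfolding dual_family_def
proof (intro conjI ballI)
  fix x assume x: "x \<in> Obj \<X>"
  show "(\<lambda>\<zeta>. cmp \<X> x c d u (\<Theta> x \<zeta>)) \<in> module_hom K (dual K (Hom \<X> y x)) (Hom \<X> x d)"
    by (rule module_hom_compose[OF dual_familyD(1)[OF fam x] postcomp_linear[OF x c d u]])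
  fix x' f \<zeta> assume x': "x' \<in> Obj \<X>" and f: "f \<in> arr \<X> x x'" and z: "\<zeta> \<in> carrier (dual K (Hom \<X> y x'))"
  show "cmp \<X> x c d u (\<Theta> x (\<lambda>h\<in>arr \<X> y x. \<zeta> (cmp \<X> y x x' f h)))
      = cmp \<X> x x' d (cmp \<X> x' c d u (\<Theta> x' \<zeta>)) f"
    by (simp add: dual_familyD(3)[OF fam x x' f z] cmp_assoc[OF x x' c d f dual_familyD(2)[OF fam x' z] u])
qed

text \<open>The uniqueness clause is applied to the family obtained by composing \<Theta> with u,
  which both u and v factor.\<close>

lemma universal_family_eqI:
  assumes y: "y \<in> Obj \<X>" and univ: "universal_family K \<X> y c \<Theta>" and d: "d \<in> Obj \<X>"
    and u: "u \<in> arr \<X> c d" and v: "v \<in> arr \<X> c d"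
    and eq: "\<And>x \<zeta>. x \<in> Obj \<X> \<Longrightarrow> \<zeta> \<in> carrier (dual K (Hom \<X> y x)) \<Longrightarrow>
      cmp \<X> x c d u (\<Theta> x \<zeta>) = cmp \<X> x c d v (\<Theta> x \<zeta>)"
  shows "u = v"
proof -
  note D = universal_familyD[OF univ]
  have "dual_family K \<X> y d (\<lambda>x \<zeta>. cmp \<X> x c d u (\<Theta> x \<zeta>))"
    using dual_family_postcomp[OF y D(1) d D(2) u] .
  then have "\<exists>!w. w \<in> arr \<X> c d \<and> (\<forall>x\<in>Obj \<X>. \<forall>\<zeta>\<in>carrier (dual K (Hom \<X> y x)).
          cmp \<X> x c d w (\<Theta> x \<zeta>) = cmp \<X> x c d u (\<Theta> x \<zeta>))"
    using univ d unfolding universal_family_def by simp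
  then show ?thesis using u v eq by (elim ex1E) (metis (mono_tags, lifting))
qed

text \<open>Uniqueness of representing objects, naturally in y: the comparison morphisms are the
  factorisations, and every equation between them is tested against the universal family.\<close>

lemma family_functors_isomorphic:
  assumes N: "family_functor K \<X> N \<Theta>" and M: "family_functor K \<X> M \<Psi>"
  shows "naturally_isomorphic \<X> \<X> N M"
proof -
  have univ: "universal_family K \<X> y (ob N y) (\<Theta> y)" "universal_family K \<X> y (ob M y) (\<Psi> y)"
    if "y \<in> Obj \<X>" for y using N M that by (simp_all add: family_functor_def)
  note uD = universal_familyD[OF univ(1)] and vD = universal_familyD[OF univ(2)]
  interpret N: linear_functor K \<X> \<X> N using N by (simp add: family_functor_def)
  interpret M: linear_functor K \<X> \<X> M using M by (simp add: family_functor_def)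
  have "\<exists>u. u \<in> arr \<X> (ob N y) (ob M y) \<and> (\<forall>x\<in>Obj \<X>. \<forall>\<zeta>\<in>carrier (dual K (Hom \<X> y x)).
      cmp \<X> x (ob N y) (ob M y) u (\<Theta> y x \<zeta>) = \<Psi> y x \<zeta>)" if "y \<in> Obj \<X>" for y
    using universal_family_factor[OF univ(1) vD(1) vD(2), OF that that that] by metis
  then obtain u where u: "\<And>y. y \<in> Obj \<X> \<Longrightarrow> u y \<in> arr \<X> (ob N y) (ob M y)"
    "\<And>y x \<zeta>. y \<in> Obj \<X> \<Longrightarrow> x \<in> Obj \<X> \<Longrightarrow> \<zeta> \<in> carrier (dual K (Hom \<X> y x)) \<Longrightarrow>
      cmp \<X> x (ob N y) (ob M y) (u y) (\<Theta> y x \<zeta>) = \<Psi> y x \<zeta>" by metis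
  have "\<exists>v. v \<in> arr \<X> (ob M y) (ob N y) \<and> (\<forall>x\<in>Obj \<X>. \<forall>\<zeta>\<in>carrier (dual K (Hom \<X> y x)).
      cmp \<X> x (ob M y) (ob N y) v (\<Psi> y x \<zeta>) = \<Theta> y x \<zeta>)" if "y \<in> Obj \<X>" for y
    using universal_family_factor[OF univ(2) uD(1) uD(2), OF that that that] by metis
  then obtain v where v: "\<And>y. y \<in> Obj \<X> \<Longrightarrow> v y \<in> arr \<X> (ob M y) (ob N y)"
    "\<And>y x \<zeta>. y \<in> Obj \<X> \<Longrightarrow> x \<in> Obj \<X> \<Longrightarrow> \<zeta> \<in> carrier (dual K (Hom \<X> y x)) \<Longrightarrow>
      cmp \<X> x (ob M y) (ob N y) (v y) (\<Psi> y x \<zeta>) = \<Theta> y x \<zeta>" by metis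
  show ?thesis
    unfolding naturally_isomorphic_def
  proof (intro exI[of _ u] conjI ballI)
    fix y assume y: "y \<in> Obj \<X>"
    note n = uD(1)[OF y] and m = vD(1)[OF y]
    have "cmp \<X> (ob N y) (ob M y) (ob N y) (v y) (u y) = idt \<X> (ob N y)"
    proof (rule universal_family_eqI[OF y univ(1)[OF y] n])
      fix x \<zeta> assume x: "x \<in> Obj \<X>" and z: "\<zeta> \<in> carrier (dual K (Hom \<X> y x))"
      note t = dual_familyD(2)[OF uD(2)[OF y] x z]
      show "cmp \<X> x (ob N y) (ob N y) (cmp \<X> (ob N y) (ob M y) (ob N y) (v y) (u y)) (\<Theta> y x \<zeta>)
          = cmp \<X> x (ob N y) (ob N y) (idt \<X> (ob N y)) (\<Theta> y x \<zeta>)"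
        by (simp add: cmp_assoc[OF x n m n t u(1)[OF y] v(1)[OF y], symmetric] u(2)[OF y x z] v(2)[OF y x z]
            cmp_idt_left[OF x n t])
    qed (use cmp_closed[OF n m n u(1)[OF y] v(1)[OF y]] idt_arr[OF n] in auto)
    moreover have "cmp \<X> (ob M y) (ob N y) (ob M y) (u y) (v y) = idt \<X> (ob M y)"
    proof (rule universal_family_eqI[OF y univ(2)[OF y] m])
      fix x \<zeta> assume x: "x \<in> Obj \<X>" and z: "\<zeta> \<in> carrier (dual K (Hom \<X> y x))"
      note t = dual_familyD(2)[OF vD(2)[OF y] x z]
      show "cmp \<X> x (ob M y) (ob M y) (cmp \<X> (ob M y) (ob N y) (ob M y) (u y) (v y)) (\<Psi> y x \<zeta>)
          = cmp \<X> x (ob M y) (ob M y) (idt \<X> (ob M y)) (\<Psi> y x \<zeta>)"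
        by (simp add: cmp_assoc[OF x m n m t v(1)[OF y] u(1)[OF y], symmetric] u(2)[OF y x z] v(2)[OF y x z]
            cmp_idt_left[OF x m t])
    qed (use cmp_closed[OF m n m v(1)[OF y] u(1)[OF y]] idt_arr[OF m] in auto)
    ultimately show "u y \<in> iso_arr \<X> (ob N y) (ob M y)"
      using u(1)[OF y] v(1)[OF y] by (auto simp: iso_arr_def)
    fix y' k assume y': "y' \<in> Obj \<X>" and k: "k \<in> arr \<X> y y'"
    note n' = uD(1)[OF y'] and m' = vD(1)[OF y']
    note Nk = module_hom_in[OF N.mor_linear[OF y y'] k] and Mk = module_hom_in[OF M.mor_linear[OF y y'] k]
    \<comment> \<open>Both composites send \<open>\<Theta> y x \<zeta>\<close> to the value of
      \<open>\<Psi> y' x\<close> at \<zeta> pushed along k: one by naturality for N, the other by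
      naturality for M.\<close>
    show "cmp \<X> (ob N y) (ob N y') (ob M y') (u y') (mor N y y' k)
        = cmp \<X> (ob N y) (ob M y) (ob M y') (mor M y y' k) (u y)"
    proof (rule universal_family_eqI[OF y univ(1)[OF y] m'])
      fix x \<zeta> assume x: "x \<in> Obj \<X>" and z: "\<zeta> \<in> carrier (dual K (Hom \<X> y x))"
      note t = dual_familyD(2)[OF uD(2)[OF y] x z]
      let ?z = "\<lambda>h\<in>arr \<X> y' x. \<zeta> (cmp \<X> y y' x h k)"
      have "cmp \<X> x (ob N y) (ob M y') (cmp \<X> (ob N y) (ob N y') (ob M y') (u y') (mor N y y' k)) (\<Theta> y x \<zeta>)
          = cmp \<X> x (ob N y') (ob M y') (u y') (cmp \<X> x (ob N y) (ob N y') (mor N y y' k) (\<Theta> y x \<zeta>))"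
        by (simp add: cmp_assoc[OF x n n' m' t Nk u(1)[OF y']])
      also have "cmp \<X> x (ob N y) (ob N y') (mor N y y' k) (\<Theta> y x \<zeta>) = \<Theta> y' x ?z"
        using N x y y' k z by (simp add: family_functor_def)
      also have "cmp \<X> x (ob N y') (ob M y') (u y') (\<Theta> y' x ?z) = \<Psi> y' x ?z"
        by (rule u(2)[OF y' x dual_push[OF x y' y k z]])
      also have "\<dots> = cmp \<X> x (ob M y) (ob M y') (mor M y y' k) (\<Psi> y x \<zeta>)"
        using M x y y' k z by (simp add: family_functor_def)
      also have "\<dots> = cmp \<X> x (ob N y) (ob M y') (cmp \<X> (ob N y) (ob M y) (ob M y') (mor M y y' k) (u y)) (\<Theta> y x \<zeta>)"
        by (simp add: cmp_assoc[OF x n m m' t u(1)[OF y] Mk, symmetric] u(2)[OF y x z])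
      finally show "cmp \<X> x (ob N y) (ob M y') (cmp \<X> (ob N y) (ob N y') (ob M y') (u y') (mor N y y' k)) (\<Theta> y x \<zeta>)
        = cmp \<X> x (ob N y) (ob M y') (cmp \<X> (ob N y) (ob M y) (ob M y') (mor M y y' k) (u y)) (\<Theta> y x \<zeta>)" .
    qed (use cmp_closed[OF n n' m' Nk u(1)[OF y']] cmp_closed[OF n m m' u(1)[OF y] Mk] in auto)
  qed
qed

end

section \<open>From coends of copowers to universal families and back\<close>

locale nakayama_integrand = linear_category K \<X>
  for K :: "'k ring" and \<X> :: "('o, 'm, 'k) lcat" +
  fixes P :: "('k, 'm \<Rightarrow> 'k) module \<Rightarrow> 'o \<Rightarrow> 'o"
    and \<beta> :: "('k, 'm \<Rightarrow> 'k) module \<Rightarrow> 'o \<Rightarrow> 'o \<Rightarrow> (('m \<Rightarrow> 'k) \<times> 'm \<Rightarrow> 'k) set \<Rightarrow> 'm"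
  assumes choice: "copower_choice K \<X> P \<beta>"
    and fin_dim_Hom: "\<And>x y. x \<in> Obj \<X> \<Longrightarrow> y \<in> Obj \<X> \<Longrightarrow> vectorspace.fin_dim K (Hom \<X> x y)"
begin

abbreviation (input) D where "D y x \<equiv> dual K (Hom \<X> y x)"
abbreviation (input) Q where "Q y a b \<equiv> nakayama_ob K \<X> P y a b"
abbreviation (input) inj where "inj y a b \<equiv> copower_inj K \<X> (dual K (Hom \<X> y a)) b (\<beta> (dual K (Hom \<X> y a)) b)"

lemma D: "y \<in> Obj \<X> \<Longrightarrow> x \<in> Obj \<X> \<Longrightarrow> vectorspace K (D y x)"
  using Hom_vectorspace vectorspace_dual by blast

lemma copower: "y \<in> Obj \<X> \<Longrightarrow> a \<in> Obj \<X> \<Longrightarrow> b \<in> Obj \<X> \<Longrightarrow> copower K \<X> (D y a) b (P (D y a) b) (\<beta> (D y a) b)"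
  using choice fin_dim_dual[OF Hom_vectorspace fin_dim_Hom] unfolding copower_choice_def
  by (intro copower.intro copower_axioms.intro linear_category_axioms) (simp_all add: D)

lemma Q_Obj: "y \<in> Obj \<X> \<Longrightarrow> a \<in> Obj \<X> \<Longrightarrow> b \<in> Obj \<X> \<Longrightarrow> Q y a b \<in> Obj \<X>"
  unfolding nakayama_ob_def by (rule copower.p[OF copower])

lemma inj_arr:
  "y \<in> Obj \<X> \<Longrightarrow> a \<in> Obj \<X> \<Longrightarrow> b \<in> Obj \<X> \<Longrightarrow> \<zeta> \<in> carrier (D y a) \<Longrightarrow> inj y a b \<zeta> \<in> arr \<X> b (Q y a b)"
  unfolding nakayama_ob_def by (rule copower.inj_arr[OF copower])

lemma Q_hom_eqI:
  assumes "y \<in> Obj \<X>" "a \<in> Obj \<X>" "b \<in> Obj \<X>" "d \<in> Obj \<X>" "q \<in> arr \<X> (Q y a b) d" "r \<in> arr \<X> (Q y a b) d"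
    and "\<And>\<zeta>. \<zeta> \<in> carrier (D y a) \<Longrightarrow>
      cmp \<X> b (Q y a b) d q (inj y a b \<zeta>) = cmp \<X> b (Q y a b) d r (inj y a b \<zeta>)"
  shows "q = r"
  using copower.copower_hom_eqI[OF copower[OF assms(1-3)] assms(4)] assms(5-7) unfolding nakayama_ob_def by blast

lemma nakayama_mor_characterization:
  assumes y: "y \<in> Obj \<X>" and y': "y' \<in> Obj \<X>" and k: "k \<in> arr \<X> y y'"
    and a: "a \<in> Obj \<X>" and a': "a' \<in> Obj \<X>" and b: "b \<in> Obj \<X>" and b': "b' \<in> Obj \<X>"
    and f: "f \<in> arr \<X> a' a" and g: "g \<in> arr \<X> b b'"
  shows "nakayama_mor K \<X> P \<beta> y y' k a b a' b' f g \<in> arr \<X> (Q y a b) (Q y' a' b')"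
    and "\<And>\<zeta>. \<zeta> \<in> carrier (D y a) \<Longrightarrow>
      cmp \<X> b (Q y a b) (Q y' a' b') (nakayama_mor K \<X> P \<beta> y y' k a b a' b' f g) (inj y a b \<zeta>)
      = cmp \<X> b b' (Q y' a' b')
          (inj y' a' b' (\<lambda>h\<in>arr \<X> y' a'. \<zeta> (cmp \<X> y a' a f (cmp \<X> y y' a' h k)))) g"
proof -
  have l: "(\<lambda>h. cmp \<X> y a' a f (cmp \<X> y y' a' h k)) \<in> module_hom K (Hom \<X> y' a') (Hom \<X> y a)"
    by (rule module_hom_compose[OF precomp_linear[OF y y' a' k] postcomp_linear[OF y a' a f]])
  note dm = dual_map_hom[OF Hom_vectorspace[OF y' a'] Hom_vectorspace[OF y a] l]
  note cm = copower_map_characterization[where P = P and \<beta> = \<beta>, OF copower[OF y a b] copower[OF y' a' b'] dm(1) g]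
  show "nakayama_mor K \<X> P \<beta> y y' k a b a' b' f g \<in> arr \<X> (Q y a b) (Q y' a' b')"
    using cm(1) by (simp add: nakayama_mor_def nakayama_ob_def)
  show "cmp \<X> b (Q y a b) (Q y' a' b') (nakayama_mor K \<X> P \<beta> y y' k a b a' b' f g) (inj y a b \<zeta>)
      = cmp \<X> b b' (Q y' a' b')
          (inj y' a' b' (\<lambda>h\<in>arr \<X> y' a'. \<zeta> (cmp \<X> y a' a f (cmp \<X> y y' a' h k)))) g"
    if "\<zeta> \<in> carrier (D y a)" for \<zeta>
    using cm(2)[OF that] dm(2)[OF that] by (simp add: nakayama_mor_def nakayama_ob_def)
qed

text \<open>On the injection of \<zeta>, one side of the dinaturality condition becomes the
  component at x of \<zeta>(f -), the other the component at x' of \<zeta> precomposed with f.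
  Testing on injections thus turns dinaturality into naturality of the family.\<close>

lemma dinatural_iff:
  assumes y: "y \<in> Obj \<X>" and d: "d \<in> Obj \<X>"
  shows "dinatural \<X> \<X> (nakayama_ob K \<X> P y) (nakayama_mor K \<X> P \<beta> y y (idt \<X> y)) d \<theta> \<longleftrightarrow>
    (\<forall>x\<in>Obj \<X>. \<theta> x \<in> arr \<X> (Q y x x) d)
    \<and> dual_family K \<X> y d (\<lambda>x \<zeta>. cmp \<X> x (Q y x x) d (\<theta> x) (inj y x x \<zeta>))"
proof (cases "\<forall>x\<in>Obj \<X>. \<theta> x \<in> arr \<X> (Q y x x) d")
  case True
  then have \<theta>: "\<And>x. x \<in> Obj \<X> \<Longrightarrow> \<theta> x \<in> arr \<X> (Q y x x) d" by blast
  note iy = idt_arr[OF y]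
  have "cmp \<X> (Q y x' x) (Q y x x) d (\<theta> x) (nakayama_mor K \<X> P \<beta> y y (idt \<X> y) x' x x x f (idt \<X> x))
        = cmp \<X> (Q y x' x) (Q y x' x') d (\<theta> x') (nakayama_mor K \<X> P \<beta> y y (idt \<X> y) x' x x' x' (idt \<X> x') f)
      \<longleftrightarrow> (\<forall>\<zeta>\<in>carrier (D y x'). cmp \<X> x (Q y x x) d (\<theta> x) (inj y x x (\<lambda>h\<in>arr \<X> y x. \<zeta> (cmp \<X> y x x' f h)))
        = cmp \<X> x x' d (cmp \<X> x' (Q y x' x') d (\<theta> x') (inj y x' x' \<zeta>)) f)"
    (is "?l = ?r \<longleftrightarrow> ?R")
    if x: "x \<in> Obj \<X>" and x': "x' \<in> Obj \<X>" and f: "f \<in> arr \<X> x x'" for x x' f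
  proof -
    note q1 = Q_Obj[OF y x' x] and q2 = Q_Obj[OF y x x] and q3 = Q_Obj[OF y x' x']
    note m1 = nakayama_mor_characterization[OF y y iy x' x x x f idt_arr[OF x]]
    note m2 = nakayama_mor_characterization[OF y y iy x' x' x x' idt_arr[OF x'] f]
    have l: "cmp \<X> x (Q y x' x) d ?l (inj y x' x \<zeta>)
        = cmp \<X> x (Q y x x) d (\<theta> x) (inj y x x (\<lambda>h\<in>arr \<X> y x. \<zeta> (cmp \<X> y x x' f h)))"
      if z: "\<zeta> \<in> carrier (D y x')" for \<zeta>
    proof -
      have "(\<lambda>h\<in>arr \<X> y x. \<zeta> (cmp \<X> y x x' f (cmp \<X> y y x h (idt \<X> y)))) = (\<lambda>h\<in>arr \<X> y x. \<zeta> (cmp \<X> y x x' f h))"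
        by (auto simp: cmp_idt_right[OF y x])
      then show ?thesis
        by (simp add: cmp_assoc[OF x q1 q2 d inj_arr[OF y x' x z] m1(1) \<theta>[OF x], symmetric] m1(2)[OF z]
            cmp_idt_right[OF x q2 inj_arr[OF y x x dual_pull[OF x x' y f z]]])
    qed
    have r: "cmp \<X> x (Q y x' x) d ?r (inj y x' x \<zeta>)
        = cmp \<X> x x' d (cmp \<X> x' (Q y x' x') d (\<theta> x') (inj y x' x' \<zeta>)) f"
      if z: "\<zeta> \<in> carrier (D y x')" for \<zeta>
    proof -
      have "(\<lambda>h\<in>arr \<X> y x'. \<zeta> (cmp \<X> y x' x' (idt \<X> x') (cmp \<X> y y x' h (idt \<X> y)))) = restrict \<zeta> (arr \<X> y x')"
        by (auto simp: cmp_idt_right[OF y x'] cmp_idt_left[OF y x'])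
      also have "\<dots> = \<zeta>" using z by (simp add: dual_simps extensional_restrict)
      finally show ?thesis
        by (simp add: cmp_assoc[OF x q1 q3 d inj_arr[OF y x' x z] m2(1) \<theta>[OF x'], symmetric] m2(2)[OF z]
            cmp_assoc[OF x x' q3 d f inj_arr[OF y x' x' z] \<theta>[OF x']])
    qed
    have "?l = ?r" if ?R
      using that l r
      by (intro Q_hom_eqI[OF y x' x d cmp_closed[OF q1 q2 d m1(1) \<theta>[OF x]] cmp_closed[OF q1 q3 d m2(1) \<theta>[OF x']]]) simp
    moreover have ?R if "?l = ?r"
      using l r that by simp
    ultimately show ?thesis by blast
  qed
  moreover have "(\<lambda>\<zeta>. cmp \<X> x (Q y x x) d (\<theta> x) (inj y x x \<zeta>)) \<in> module_hom K (D y x) (Hom \<X> x d)"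
    if x: "x \<in> Obj \<X>" for x
    using module_hom_compose[OF copower.inj_hom[OF copower[OF y x x]]
        postcomp_linear[OF x _ d, of "P (D y x) x"]] \<theta>[OF x] Q_Obj[OF y x x]
    by (simp add: nakayama_ob_def)
  ultimately show ?thesis
    using True unfolding dinatural_def dual_family_def by simp
next
  case False
  then show ?thesis by (auto simp: dinatural_def)
qed

text \<open>Inverse to the passage in \<open>dinatural_iff\<close>: a linear map out of the dual
  extends along the injections to a morphism out of the copower.\<close>

lemma dinatural_of_family:
  assumes y: "y \<in> Obj \<X>" and d: "d \<in> Obj \<X>" and fam: "dual_family K \<X> y d \<Theta>"
  obtains \<theta> where "dinatural \<X> \<X> (nakayama_ob K \<X> P y) (nakayama_mor K \<X> P \<beta> y y (idt \<X> y)) d \<theta>"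
    "\<And>x \<zeta>. x \<in> Obj \<X> \<Longrightarrow> \<zeta> \<in> carrier (D y x) \<Longrightarrow> cmp \<X> x (Q y x x) d (\<theta> x) (inj y x x \<zeta>) = \<Theta> x \<zeta>"
proof -
  have "\<exists>q. q \<in> arr \<X> (Q y x x) d \<and> (\<forall>\<zeta>\<in>carrier (D y x). cmp \<X> x (Q y x x) d q (inj y x x \<zeta>) = \<Theta> x \<zeta>)"
    if x: "x \<in> Obj \<X>" for x
    using copower.copower_extend[OF copower[OF y x x] d dual_familyD(1)[OF fam x]]
    unfolding nakayama_ob_def by metis
  then obtain \<theta> where \<theta>: "\<And>x. x \<in> Obj \<X> \<Longrightarrow> \<theta> x \<in> arr \<X> (Q y x x) d"
    "\<And>x \<zeta>. x \<in> Obj \<X> \<Longrightarrow> \<zeta> \<in> carrier (D y x) \<Longrightarrow> cmp \<X> x (Q y x x) d (\<theta> x) (inj y x x \<zeta>) = \<Theta> x \<zeta>"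
    by metis
  have "dual_family K \<X> y d (\<lambda>x \<zeta>. cmp \<X> x (Q y x x) d (\<theta> x) (inj y x x \<zeta>))"
    unfolding dual_family_def
  proof (intro conjI ballI)
    fix x assume x: "x \<in> Obj \<X>"
    show "(\<lambda>\<zeta>. cmp \<X> x (Q y x x) d (\<theta> x) (inj y x x \<zeta>)) \<in> module_hom K (D y x) (Hom \<X> x d)"
      using \<theta>(2)[OF x] by (rule module_hom_cong[OF dual_familyD(1)[OF fam x] D[OF y x]])
    fix x' f \<zeta> assume x': "x' \<in> Obj \<X>" and f: "f \<in> arr \<X> x x'" and z: "\<zeta> \<in> carrier (D y x')"
    show "cmp \<X> x (Q y x x) d (\<theta> x) (inj y x x (\<lambda>h\<in>arr \<X> y x. \<zeta> (cmp \<X> y x x' f h)))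
        = cmp \<X> x x' d (cmp \<X> x' (Q y x' x') d (\<theta> x') (inj y x' x' \<zeta>)) f"
      by (simp add: \<theta>(2)[OF x dual_pull[OF x x' y f z]] \<theta>(2)[OF x' z] dual_familyD(3)[OF fam x x' f z])
  qed
  then show ?thesis using that[of \<theta>] \<theta> by (simp add: dinatural_iff[OF y d])
qed

text \<open>Morphisms out of a copower agree as soon as they agree on injections, so u factors a
  dinatural family exactly when it factors the associated dual family.\<close>

lemma factor_iff:
  assumes y: "y \<in> Obj \<X>" and c: "c \<in> Obj \<X>" and d: "d \<in> Obj \<X>" and u: "u \<in> arr \<X> c d"
    and \<iota>: "\<And>x. x \<in> Obj \<X> \<Longrightarrow> \<iota> x \<in> arr \<X> (Q y x x) c" and \<theta>: "\<And>x. x \<in> Obj \<X> \<Longrightarrow> \<theta> x \<in> arr \<X> (Q y x x) d"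
  shows "(\<forall>x\<in>Obj \<X>. cmp \<X> (Q y x x) c d u (\<iota> x) = \<theta> x) \<longleftrightarrow>
    (\<forall>x\<in>Obj \<X>. \<forall>\<zeta>\<in>carrier (D y x). cmp \<X> x c d u (cmp \<X> x (Q y x x) c (\<iota> x) (inj y x x \<zeta>))
      = cmp \<X> x (Q y x x) d (\<theta> x) (inj y x x \<zeta>))"
proof (intro ball_cong refl)
  fix x assume x: "x \<in> Obj \<X>"
  note q = Q_Obj[OF y x x]
  have *: "cmp \<X> x c d u (cmp \<X> x (Q y x x) c (\<iota> x) (inj y x x \<zeta>))
      = cmp \<X> x (Q y x x) d (cmp \<X> (Q y x x) c d u (\<iota> x)) (inj y x x \<zeta>)" if "\<zeta> \<in> carrier (D y x)" for \<zeta>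
    by (rule cmp_assoc[OF x q c d inj_arr[OF y x x that] \<iota>[OF x] u])
  show "cmp \<X> (Q y x x) c d u (\<iota> x) = \<theta> x \<longleftrightarrow> (\<forall>\<zeta>\<in>carrier (D y x).
      cmp \<X> x c d u (cmp \<X> x (Q y x x) c (\<iota> x) (inj y x x \<zeta>)) = cmp \<X> x (Q y x x) d (\<theta> x) (inj y x x \<zeta>))"
    using * Q_hom_eqI[OF y x x d cmp_closed[OF q c d \<iota>[OF x] u] \<theta>[OF x]] by auto
qed

text \<open>Dinatural families to d correspond to dual families to d with the same factorisations,
  so the two universal properties coincide.\<close>

lemma coend_iff:
  assumes y: "y \<in> Obj \<X>" and c: "c \<in> Obj \<X>"
    and din: "dinatural \<X> \<X> (nakayama_ob K \<X> P y) (nakayama_mor K \<X> P \<beta> y y (idt \<X> y)) c \<iota>"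
    and \<Theta>: "\<And>x \<zeta>. x \<in> Obj \<X> \<Longrightarrow> \<zeta> \<in> carrier (D y x) \<Longrightarrow> cmp \<X> x (Q y x x) c (\<iota> x) (inj y x x \<zeta>) = \<Theta> x \<zeta>"
    and fam: "dual_family K \<X> y c \<Theta>"
  shows "is_coend \<X> \<X> (nakayama_ob K \<X> P y) (nakayama_mor K \<X> P \<beta> y y (idt \<X> y)) c \<iota> \<longleftrightarrow>
    universal_family K \<X> y c \<Theta>"
proof
  have \<iota>: "\<iota> x \<in> arr \<X> (Q y x x) c" if "x \<in> Obj \<X>" for x using din that by (simp add: dinatural_def)
  note fi = factor_iff[OF y c _ _ \<iota>]
  {
    assume L: "is_coend \<X> \<X> (nakayama_ob K \<X> P y) (nakayama_mor K \<X> P \<beta> y y (idt \<X> y)) c \<iota>"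
    show "universal_family K \<X> y c \<Theta>"
      unfolding universal_family_def
    proof (intro conjI c fam ballI allI impI)
      fix d \<Theta>' assume d: "d \<in> Obj \<X>" and fam': "dual_family K \<X> y d \<Theta>'"
      obtain \<theta> where \<theta>: "dinatural \<X> \<X> (nakayama_ob K \<X> P y) (nakayama_mor K \<X> P \<beta> y y (idt \<X> y)) d \<theta>"
        "\<And>x \<zeta>. x \<in> Obj \<X> \<Longrightarrow> \<zeta> \<in> carrier (D y x) \<Longrightarrow> cmp \<X> x (Q y x x) d (\<theta> x) (inj y x x \<zeta>) = \<Theta>' x \<zeta>"
        using dinatural_of_family[OF y d fam'] by metis
      have \<theta>a: "\<theta> x \<in> arr \<X> (Q y x x) d" if "x \<in> Obj \<X>" for x using \<theta>(1) that by (simp add: dinatural_def)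
      have "\<exists>!u. u \<in> arr \<X> c d \<and> (\<forall>x\<in>Obj \<X>. cmp \<X> (Q y x x) c d u (\<iota> x) = \<theta> x)"
        using L d \<theta>(1) unfolding is_coend_def by blast
      moreover have "u \<in> arr \<X> c d \<and> (\<forall>x\<in>Obj \<X>. cmp \<X> (Q y x x) c d u (\<iota> x) = \<theta> x) \<longleftrightarrow>
        u \<in> arr \<X> c d \<and> (\<forall>x\<in>Obj \<X>. \<forall>\<zeta>\<in>carrier (D y x). cmp \<X> x c d u (\<Theta> x \<zeta>) = \<Theta>' x \<zeta>)" for u
        using fi[OF d _ _ \<theta>a, of u] by (auto simp: \<Theta> \<theta>(2))
      ultimately show "\<exists>!u. u \<in> arr \<X> c d \<and> (\<forall>x\<in>Obj \<X>. \<forall>\<zeta>\<in>carrier (D y x). cmp \<X> x c d u (\<Theta> x \<zeta>) = \<Theta>' x \<zeta>)"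
        by simp
    qed
  next
    assume R: "universal_family K \<X> y c \<Theta>"
    show "is_coend \<X> \<X> (nakayama_ob K \<X> P y) (nakayama_mor K \<X> P \<beta> y y (idt \<X> y)) c \<iota>"
      unfolding is_coend_def
    proof (intro conjI c din ballI allI impI)
      fix d \<theta> assume d: "d \<in> Obj \<X>"
        and \<theta>: "dinatural \<X> \<X> (nakayama_ob K \<X> P y) (nakayama_mor K \<X> P \<beta> y y (idt \<X> y)) d \<theta>"
      have \<theta>a: "\<theta> x \<in> arr \<X> (Q y x x) d" if "x \<in> Obj \<X>" for x using \<theta> that by (simp add: dinatural_def)
      have "\<exists>!u. u \<in> arr \<X> c d \<and> (\<forall>x\<in>Obj \<X>. \<forall>\<zeta>\<in>carrier (D y x).
          cmp \<X> x c d u (\<Theta> x \<zeta>) = cmp \<X> x (Q y x x) d (\<theta> x) (inj y x x \<zeta>))"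
        using R d \<theta> unfolding universal_family_def dinatural_iff[OF y d] by simp
      moreover have "u \<in> arr \<X> c d \<and> (\<forall>x\<in>Obj \<X>. cmp \<X> (Q y x x) c d u (\<iota> x) = \<theta> x) \<longleftrightarrow>
        u \<in> arr \<X> c d \<and> (\<forall>x\<in>Obj \<X>. \<forall>\<zeta>\<in>carrier (D y x).
          cmp \<X> x c d u (\<Theta> x \<zeta>) = cmp \<X> x (Q y x x) d (\<theta> x) (inj y x x \<zeta>))" for u
        using fi[OF d _ _ \<theta>a, of u] by (auto simp: \<Theta>)
      ultimately show "\<exists>!u. u \<in> arr \<X> c d \<and> (\<forall>x\<in>Obj \<X>. cmp \<X> (Q y x x) c d u (\<iota> x) = \<theta> x)" by simp
    qed
  }
qed

text \<open>Naturality in the parameter y, again tested on injections: k acts by pushing functionals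
  forward.\<close>

lemma structure_natural_iff:
  assumes y: "y \<in> Obj \<X>" and y': "y' \<in> Obj \<X>" and k: "k \<in> arr \<X> y y'" and x: "x \<in> Obj \<X>"
    and n: "n \<in> Obj \<X>" and n': "n' \<in> Obj \<X>" and m: "m \<in> arr \<X> n n'"
    and i: "i \<in> arr \<X> (Q y x x) n" and i': "i' \<in> arr \<X> (Q y' x x) n'"
  shows "cmp \<X> (Q y x x) n n' m i
        = cmp \<X> (Q y x x) (Q y' x x) n' i' (nakayama_mor K \<X> P \<beta> y y' k x x x x (idt \<X> x) (idt \<X> x)) \<longleftrightarrow>
    (\<forall>\<zeta>\<in>carrier (D y x). cmp \<X> x n n' m (cmp \<X> x (Q y x x) n i (inj y x x \<zeta>))
        = cmp \<X> x (Q y' x x) n' i' (inj y' x x (\<lambda>h\<in>arr \<X> y' x. \<zeta> (cmp \<X> y y' x h k))))"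
proof -
  note q = Q_Obj[OF y x x] and q' = Q_Obj[OF y' x x] and ix = idt_arr[OF x]
  note mc = nakayama_mor_characterization[OF y y' k x x x x ix ix]
  let ?l = "cmp \<X> (Q y x x) n n' m i"
  let ?r = "cmp \<X> (Q y x x) (Q y' x x) n' i' (nakayama_mor K \<X> P \<beta> y y' k x x x x (idt \<X> x) (idt \<X> x))"
  have l: "cmp \<X> x (Q y x x) n' ?l (inj y x x \<zeta>) = cmp \<X> x n n' m (cmp \<X> x (Q y x x) n i (inj y x x \<zeta>))"
    if z: "\<zeta> \<in> carrier (D y x)" for \<zeta>
    by (rule cmp_assoc[OF x q n n' inj_arr[OF y x x z] i m, symmetric])
  have r: "cmp \<X> x (Q y x x) n' ?r (inj y x x \<zeta>)
      = cmp \<X> x (Q y' x x) n' i' (inj y' x x (\<lambda>h\<in>arr \<X> y' x. \<zeta> (cmp \<X> y y' x h k)))"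
    if z: "\<zeta> \<in> carrier (D y x)" for \<zeta>
  proof -
    have "(\<lambda>h\<in>arr \<X> y' x. \<zeta> (cmp \<X> y x x (idt \<X> x) (cmp \<X> y y' x h k))) = (\<lambda>h\<in>arr \<X> y' x. \<zeta> (cmp \<X> y y' x h k))"
      by (auto simp: cmp_idt_left[OF y x cmp_closed[OF y y' x k]])
    then show ?thesis
      by (simp add: cmp_assoc[OF x q q' n' inj_arr[OF y x x z] mc(1) i', symmetric] mc(2)[OF z]
          cmp_idt_right[OF x q' inj_arr[OF y' x x dual_push[OF x y' y k z]]])
  qed
  show ?thesis
    using l r Q_hom_eqI[OF y x x n' cmp_closed[OF q n n' i m] cmp_closed[OF q q' n' mc(1) i']] by auto
qed

text \<open>The structure morphisms are the extensions of \<Theta> along the injections of the given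
  copower choice.\<close>

lemma right_nakayama_of_family_functor:
  assumes N: "family_functor K \<X> N \<Theta>"
  shows "right_nakayama K \<X> N"
proof -
  interpret N: linear_functor K \<X> \<X> N using N by (simp add: family_functor_def)
  have univ: "universal_family K \<X> y (ob N y) (\<Theta> y)" if "y \<in> Obj \<X>" for y
    using N that by (simp add: family_functor_def)
  note U = universal_familyD[OF univ]
  have "\<exists>\<iota>. dinatural \<X> \<X> (nakayama_ob K \<X> P y) (nakayama_mor K \<X> P \<beta> y y (idt \<X> y)) (ob N y) \<iota> \<and>
    (\<forall>x\<in>Obj \<X>. \<forall>\<zeta>\<in>carrier (D y x). cmp \<X> x (Q y x x) (ob N y) (\<iota> x) (inj y x x \<zeta>) = \<Theta> y x \<zeta>)"
    if y: "y \<in> Obj \<X>" for y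
    using dinatural_of_family[OF y U(1)[OF y] U(2)[OF y]] by metis
  then obtain \<iota> where \<iota>: "\<And>y. y \<in> Obj \<X> \<Longrightarrow>
      dinatural \<X> \<X> (nakayama_ob K \<X> P y) (nakayama_mor K \<X> P \<beta> y y (idt \<X> y)) (ob N y) (\<iota> y)"
    "\<And>y x \<zeta>. y \<in> Obj \<X> \<Longrightarrow> x \<in> Obj \<X> \<Longrightarrow> \<zeta> \<in> carrier (D y x) \<Longrightarrow>
      cmp \<X> x (Q y x x) (ob N y) (\<iota> y x) (inj y x x \<zeta>) = \<Theta> y x \<zeta>" by metis
  have \<iota>a: "\<iota> y x \<in> arr \<X> (Q y x x) (ob N y)" if "y \<in> Obj \<X>" "x \<in> Obj \<X>" for y x
    using \<iota>(1) that by (simp add: dinatural_def)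
  show ?thesis
    unfolding right_nakayama_def
  proof (intro conjI exI[of _ P] exI[of _ \<beta>] exI[of _ \<iota>] ballI choice N.linear_functor_axioms)
    fix y assume y: "y \<in> Obj \<X>"
    show "is_coend \<X> \<X> (nakayama_ob K \<X> P y) (nakayama_mor K \<X> P \<beta> y y (idt \<X> y)) (ob N y) (\<iota> y)"
      by (rule iffD2[OF coend_iff[OF y U(1)[OF y] \<iota>(1)[OF y] \<iota>(2)[OF y] U(2)[OF y]] univ[OF y]])
    fix y' k x assume y': "y' \<in> Obj \<X>" and k: "k \<in> arr \<X> y y'" and x: "x \<in> Obj \<X>"
    show "cmp \<X> (nakayama_ob K \<X> P y x x) (ob N y) (ob N y') (mor N y y' k) (\<iota> y x)
      = cmp \<X> (nakayama_ob K \<X> P y x x) (nakayama_ob K \<X> P y' x x) (ob N y') (\<iota> y' x)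
          (nakayama_mor K \<X> P \<beta> y y' k x x x x (idt \<X> x) (idt \<X> x))"
    proof (subst structure_natural_iff[OF y y' k x U(1)[OF y] U(1)[OF y'] module_hom_in[OF N.mor_linear[OF y y'] k] \<iota>a[OF y x] \<iota>a[OF y' x]],
        intro ballI)
      fix \<zeta> assume z: "\<zeta> \<in> carrier (D y x)"
      show "cmp \<X> x (ob N y) (ob N y') (mor N y y' k) (cmp \<X> x (Q y x x) (ob N y) (\<iota> y x) (inj y x x \<zeta>))
        = cmp \<X> x (Q y' x x) (ob N y') (\<iota> y' x) (inj y' x x (\<lambda>h\<in>arr \<X> y' x. \<zeta> (cmp \<X> y y' x h k)))"
        using N y y' k x z by (simp add: \<iota>(2) dual_push family_functor_def)
    qed
  qed
qed

end

text \<open>Here the hidden copower choice disappears: \<open>\<Theta> y x \<zeta>\<close> is the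
  structure morphism composed with the injection of \<zeta>.\<close>

lemma family_functor_of_right_nakayama:
  assumes "linear_category K \<X>"
    and fd: "\<And>x y. x \<in> Obj \<X> \<Longrightarrow> y \<in> Obj \<X> \<Longrightarrow> vectorspace.fin_dim K (Hom \<X> x y)"
    and "right_nakayama K \<X> N"
  obtains \<Theta> where "family_functor K \<X> N \<Theta>"
proof -
  obtain P \<beta> \<iota> where lin: "linear_functor K \<X> \<X> N" and choice: "copower_choice K \<X> P \<beta>"
    and coend: "\<And>y. y \<in> Obj \<X> \<Longrightarrow> is_coend \<X> \<X> (nakayama_ob K \<X> P y) (nakayama_mor K \<X> P \<beta> y y (idt \<X> y)) (ob N y) (\<iota> y)"
    and nat: "\<And>y y' k x. y \<in> Obj \<X> \<Longrightarrow> y' \<in> Obj \<X> \<Longrightarrow> k \<in> arr \<X> y y' \<Longrightarrow> x \<in> Obj \<X> \<Longrightarrow>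
              cmp \<X> (nakayama_ob K \<X> P y x x) (ob N y) (ob N y') (mor N y y' k) (\<iota> y x)
              = cmp \<X> (nakayama_ob K \<X> P y x x) (nakayama_ob K \<X> P y' x x) (ob N y') (\<iota> y' x)
                  (nakayama_mor K \<X> P \<beta> y y' k x x x x (idt \<X> x) (idt \<X> x))"
    using assms(3) unfolding right_nakayama_def by blast
  interpret nakayama_integrand K \<X> P \<beta>
    by (intro nakayama_integrand.intro nakayama_integrand_axioms.intro assms choice)
  interpret N: linear_functor K \<X> \<X> N by (rule lin)
  define \<Theta> where "\<Theta> y x \<zeta> = cmp \<X> x (nakayama_ob K \<X> P y x x) (ob N y) (\<iota> y x)
      (copower_inj K \<X> (dual K (Hom \<X> y x)) x (\<beta> (dual K (Hom \<X> y x)) x) \<zeta>)" for y x \<zeta>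
  have din: "dinatural \<X> \<X> (nakayama_ob K \<X> P y) (nakayama_mor K \<X> P \<beta> y y (idt \<X> y)) (ob N y) (\<iota> y)"
    if "y \<in> Obj \<X>" for y using coend[OF that] by (simp add: is_coend_def)
  then have \<iota>a: "\<iota> y x \<in> arr \<X> (nakayama_ob K \<X> P y x x) (ob N y)" if "y \<in> Obj \<X>" "x \<in> Obj \<X>" for y x
    using that by (simp add: dinatural_def)
  have "family_functor K \<X> N \<Theta>"
    unfolding family_functor_def
  proof (intro conjI lin ballI)
    fix y assume y: "y \<in> Obj \<X>"
    note n = N.ob_closed[OF y]
    have "dual_family K \<X> y (ob N y) (\<Theta> y)"
      using din[OF y] unfolding dinatural_iff[OF y n] \<Theta>_def by simp
    then show "universal_family K \<X> y (ob N y) (\<Theta> y)"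
      using coend_iff[OF y n din[OF y], of "\<Theta> y"] coend[OF y] \<Theta>_def by simp
    fix y' k x \<zeta> assume y': "y' \<in> Obj \<X>" and k: "k \<in> arr \<X> y y'" and x: "x \<in> Obj \<X>"
      and z: "\<zeta> \<in> carrier (dual K (Hom \<X> y x))"
    show "cmp \<X> x (ob N y) (ob N y') (mor N y y' k) (\<Theta> y x \<zeta>)
        = \<Theta> y' x (\<lambda>h\<in>arr \<X> y' x. \<zeta> (cmp \<X> y y' x h k))"
      using structure_natural_iff[OF y y' k x n N.ob_closed[OF y'] module_hom_in[OF N.mor_linear[OF y y'] k] \<iota>a[OF y x] \<iota>a[OF y' x]]
        nat[OF y y' k x] z unfolding \<Theta>_def by blast
  qed
  then show ?thesis using that by blast
qed

section \<open>Equivalences\<close>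

context linear_category
begin

lemma iso_arr_right_cancel:
  assumes x: "x \<in> Obj \<X>" and y: "y \<in> Obj \<X>" and z: "z \<in> Obj \<X>" and e: "e \<in> iso_arr \<X> x y"
    and f: "f \<in> arr \<X> y z" and g: "g \<in> arr \<X> y z" and eq: "cmp \<X> x y z f e = cmp \<X> x y z g e"
  shows "f = g"
proof -
  obtain e' where e': "e' \<in> arr \<X> y x" "cmp \<X> y x y e e' = idt \<X> y" and ea: "e \<in> arr \<X> x y"
    using e by (auto simp: iso_arr_def)
  have "cmp \<X> y x z (cmp \<X> x y z f e) e' = cmp \<X> y x z (cmp \<X> x y z g e) e'" using eq by simp
  then show ?thesis
    by (simp add: cmp_assoc[OF y x y z e'(1) ea f, symmetric] cmp_assoc[OF y x y z e'(1) ea g, symmetric]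
        e'(2) cmp_idt_right[OF y z f] cmp_idt_right[OF y z g])
qed

end

lemma retract_isoE:
  assumes "naturally_isomorphic \<X> \<X> (comp_functor G F) id_functor"
  obtains \<eta> where "\<And>x. x \<in> Obj \<X> \<Longrightarrow> \<eta> x \<in> iso_arr \<X> (ob G (ob F x)) x"
    "\<And>x y f. x \<in> Obj \<X> \<Longrightarrow> y \<in> Obj \<X> \<Longrightarrow> f \<in> arr \<X> x y \<Longrightarrow>
      cmp \<X> (ob G (ob F x)) (ob G (ob F y)) y (\<eta> y) (mor G (ob F x) (ob F y) (mor F x y f))
      = cmp \<X> (ob G (ob F x)) x y f (\<eta> x)"
  using assms unfolding naturally_isomorphic_def comp_functor_def id_functor_def by simp blast

text \<open>By naturality, f after \<eta> x depends on F f alone, and the isomorphism \<eta> x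
  cancels. Applied below to G as well as to F.\<close>

lemma faithful_of_retract:
  assumes "linear_category K \<X>" and F: "linear_functor K \<X> Y F" and G: "linear_functor K Y \<X> G"
    and iso: "naturally_isomorphic \<X> \<X> (comp_functor G F) id_functor"
    and x: "x \<in> Obj \<X>" and y: "y \<in> Obj \<X>"
  shows "inj_on (mor F x y) (arr \<X> x y)"
proof (rule inj_onI)
  interpret linear_category K \<X> by fact
  interpret F: linear_functor K \<X> Y F by fact
  interpret G: linear_functor K Y \<X> G by fact
  fix f g assume f: "f \<in> arr \<X> x y" and g: "g \<in> arr \<X> x y" and eq: "mor F x y f = mor F x y g"
  obtain \<eta> where \<eta>: "\<And>x. x \<in> Obj \<X> \<Longrightarrow> \<eta> x \<in> iso_arr \<X> (ob G (ob F x)) x"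
    "\<And>x y f. x \<in> Obj \<X> \<Longrightarrow> y \<in> Obj \<X> \<Longrightarrow> f \<in> arr \<X> x y \<Longrightarrow>
      cmp \<X> (ob G (ob F x)) (ob G (ob F y)) y (\<eta> y) (mor G (ob F x) (ob F y) (mor F x y f))
      = cmp \<X> (ob G (ob F x)) x y f (\<eta> x)"
    by (rule retract_isoE[OF iso]) blast
  show "f = g"
  proof (rule iso_arr_right_cancel[OF _ x y \<eta>(1)[OF x] f g])
    show "cmp \<X> (ob G (ob F x)) x y f (\<eta> x) = cmp \<X> (ob G (ob F x)) x y g (\<eta> x)"
      using \<eta>(2)[OF x y f] \<eta>(2)[OF x y g] eq by simp
  qed (use x in \<open>simp add: F.ob_closed G.ob_closed\<close>)
qed

lemma linear_equivalence_fully_faithful: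
  assumes "linear_category K \<X>" and "linear_category K Y" and equiv: "linear_equivalence K \<X> Y F"
    and x: "x \<in> Obj \<X>" and y: "y \<in> Obj \<X>"
  shows "bij_betw (mor F x y) (arr \<X> x y) (arr Y (ob F x) (ob F y))"
proof -
  interpret linear_category K \<X> by fact
  obtain G where F: "linear_functor K \<X> Y F" and G: "linear_functor K Y \<X> G"
    and iso: "naturally_isomorphic \<X> \<X> (comp_functor G F) id_functor"
    and iso': "naturally_isomorphic Y Y (comp_functor F G) id_functor"
    using equiv by (auto simp: linear_equivalence_def)
  interpret F: linear_functor K \<X> Y F by fact
  interpret G: linear_functor K Y \<X> G by fact
  obtain \<eta> where \<eta>: "\<And>x. x \<in> Obj \<X> \<Longrightarrow> \<eta> x \<in> iso_arr \<X> (ob G (ob F x)) x"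
    "\<And>x y f. x \<in> Obj \<X> \<Longrightarrow> y \<in> Obj \<X> \<Longrightarrow> f \<in> arr \<X> x y \<Longrightarrow>
      cmp \<X> (ob G (ob F x)) (ob G (ob F y)) y (\<eta> y) (mor G (ob F x) (ob F y) (mor F x y f))
      = cmp \<X> (ob G (ob F x)) x y f (\<eta> x)"
    by (rule retract_isoE[OF iso]) blast
  note fx = F.ob_closed[OF x] and fy = F.ob_closed[OF y]
  note gx = G.ob_closed[OF fx] and gy = G.ob_closed[OF fy]
  obtain ex ey where ex: "ex \<in> arr \<X> x (ob G (ob F x))"
      "cmp \<X> (ob G (ob F x)) x (ob G (ob F x)) ex (\<eta> x) = idt \<X> (ob G (ob F x))"
    and ey: "ey \<in> arr \<X> y (ob G (ob F y))"
      "cmp \<X> (ob G (ob F y)) y (ob G (ob F y)) ey (\<eta> y) = idt \<X> (ob G (ob F y))"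
    using \<eta>(1)[OF x] \<eta>(1)[OF y] by (auto simp: iso_arr_def)
  have \<eta>a: "\<eta> x \<in> arr \<X> (ob G (ob F x)) x" "\<eta> y \<in> arr \<X> (ob G (ob F y)) y"
    using \<eta>(1) x y by (auto simp: iso_arr_def)
  have "h \<in> mor F x y ` arr \<X> x y" if h: "h \<in> arr Y (ob F x) (ob F y)" for h
  proof -
    define k where "k = mor G (ob F x) (ob F y) h"
    have k: "k \<in> arr \<X> (ob G (ob F x)) (ob G (ob F y))"
      unfolding k_def using module_hom_in[OF G.mor_linear[OF fx fy] h] .
    \<comment> \<open>The only candidate: G h conjugated by \<eta>. It satisfies G (F f) = G h, and
      faithfulness of G yields F f = h.\<close>
    define f where "f = cmp \<X> x (ob G (ob F y)) y (\<eta> y) (cmp \<X> x (ob G (ob F x)) (ob G (ob F y)) k ex)"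
    have kx: "cmp \<X> x (ob G (ob F x)) (ob G (ob F y)) k ex \<in> arr \<X> x (ob G (ob F y))"
      by (rule cmp_closed[OF x gx gy ex(1) k])
    have f: "f \<in> arr \<X> x y" unfolding f_def by (rule cmp_closed[OF x gy y kx \<eta>a(2)])
    define k' where "k' = mor G (ob F x) (ob F y) (mor F x y f)"
    have k': "k' \<in> arr \<X> (ob G (ob F x)) (ob G (ob F y))"
      unfolding k'_def using module_hom_in[OF G.mor_linear[OF fx fy] module_hom_in[OF F.mor_linear[OF x y] f]] .
    have "cmp \<X> (ob G (ob F x)) (ob G (ob F y)) y (\<eta> y) k' = cmp \<X> (ob G (ob F x)) x y f (\<eta> x)"
      unfolding k'_def by (rule \<eta>(2)[OF x y f])
    also have "\<dots> = cmp \<X> (ob G (ob F x)) (ob G (ob F y)) y (\<eta> y) k"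
      by (simp add: f_def cmp_assoc[OF gx x gy y \<eta>a(1) kx \<eta>a(2), symmetric]
          cmp_assoc[OF gx x gx gy \<eta>a(1) ex(1) k, symmetric] ex(2) cmp_idt_right[OF gx gy k])
    finally have "cmp \<X> (ob G (ob F x)) y (ob G (ob F y)) ey (cmp \<X> (ob G (ob F x)) (ob G (ob F y)) y (\<eta> y) k')
        = cmp \<X> (ob G (ob F x)) y (ob G (ob F y)) ey (cmp \<X> (ob G (ob F x)) (ob G (ob F y)) y (\<eta> y) k)" by simp
    then have "k' = k"
      by (simp add: cmp_assoc[OF gx gy y gy _ \<eta>a(2) ey(1)] k k' ey(2) cmp_idt_left[OF gx gy])
    then have "mor F x y f = h"
      using faithful_of_retract[OF assms(2) G F iso' fx fy] h module_hom_in[OF F.mor_linear[OF x y] f]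
      by (auto simp: k_def k'_def inj_on_def)
    then show ?thesis using f by blast
  qed
  then show ?thesis
    using faithful_of_retract[OF assms(1) F G iso x y] module_hom_in[OF F.mor_linear[OF x y]]
    by (auto simp: bij_betw_def)
qed

lemma linear_equivalence_essentially_surjective:
  assumes equiv: "linear_equivalence K \<X> Y F" and M: "M \<in> Obj Y"
  obtains x f where "x \<in> Obj \<X>" "f \<in> iso_arr Y (ob F x) M"
proof -
  obtain G where G: "linear_functor K Y \<X> G" and iso': "naturally_isomorphic Y Y (comp_functor F G) id_functor"
    using equiv by (auto simp: linear_equivalence_def)
  then show ?thesis using that[of "ob G M"] M linear_functor.ob_closed[OF G M]
    by (auto simp: naturally_isomorphic_def comp_functor_def id_functor_def)
qed

section \<open>Modules over a finite-dimensional algebra\<close>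

lemma mod_category_simps [simp]:
  "M \<in> Obj (mod_category K A) \<longleftrightarrow> fd_lmodule K A M"
  "Hom (mod_category K A) M N = map_space (carrier M) N (lmod_hom K A M N)"
  "idt (mod_category K A) M = (\<lambda>m\<in>carrier M. m)"
  "cmp (mod_category K A) L M N g f = compose (carrier L) g f"
  by (simp_all add: mod_category_def)

lemma lmod_homI:
  assumes "f \<in> module_hom K M N" "f \<in> extensional (carrier M)"
    and "\<And>a m. a \<in> carrier A \<Longrightarrow> m \<in> carrier M \<Longrightarrow> f (lact M a m) = lact N a (f m)"
  shows "f \<in> lmod_hom K A M N"
  using assms by (simp add: lmod_hom_def)

lemma lmod_homD:
  assumes "f \<in> lmod_hom K A M N"
  shows "f \<in> module_hom K M N" "f \<in> extensional (carrier M)"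
    and "a \<in> carrier A \<Longrightarrow> m \<in> carrier M \<Longrightarrow> f (lact M a m) = lact N a (f m)"
    and "m \<in> carrier M \<Longrightarrow> f m \<in> carrier N"
  using assms by (auto simp: lmod_hom_def module_hom_in)

lemma (in fd_lmodule) lact_hom: "a \<in> carrier A \<Longrightarrow> lact M a \<in> module_hom K M M"
  by (rule module_homI) (simp_all add: lact_closed lact_add_right lact_smult_right)

lemma (in fd_lmodule) lact_zero: "a \<in> carrier A \<Longrightarrow> lact M a \<zero>\<^bsub>M\<^esub> = \<zero>\<^bsub>M\<^esub>"
  by (rule module_hom_zero[OF vectorspace vectorspace lact_hom])

lemma lmod_hom_restrictI:
  assumes "fd_lmodule K A M" "f \<in> module_hom K M N"
    and "\<And>a m. a \<in> carrier A \<Longrightarrow> m \<in> carrier M \<Longrightarrow> f (lact M a m) = lact N a (f m)"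
  shows "(\<lambda>m\<in>carrier M. f m) \<in> lmod_hom K A M N"
proof -
  interpret M: fd_lmodule K A M by fact
  show ?thesis
    using assms M.lact_closed
    by (intro lmod_homI module_hom_cong[OF assms(2) M.vectorspace]) auto
qed

lemma lmod_hom_compose:
  assumes "fd_lmodule K A L" "f \<in> lmod_hom K A L M" "g \<in> lmod_hom K A M N"
  shows "compose (carrier L) g f \<in> lmod_hom K A L N"
  unfolding compose_def
  by (rule lmod_hom_restrictI[OF assms(1)])
    (use assms in \<open>auto simp: lmod_homD(3,4) intro: module_hom_compose[OF lmod_homD(1) lmod_homD(1)]\<close>)

lemma vectorspace_lmod_hom:
  assumes "fd_lmodule K A M" "fd_lmodule K A N"
  shows "vectorspace K (map_space (carrier M) N (lmod_hom K A M N))"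
proof -
  interpret M: fd_lmodule K A M by fact
  interpret N: fd_lmodule K A N by fact
  interpret V: vectorspace K N by (rule N.vectorspace)
  show ?thesis
  proof (rule vectorspace_map_space[OF N.vectorspace])
    show "(\<lambda>s\<in>carrier M. \<zero>\<^bsub>N\<^esub>) \<in> lmod_hom K A M N"
      by (rule lmod_hom_restrictI[OF assms(1)]) (auto intro: module_homI simp: N.lact_zero)
    show "(\<lambda>s\<in>carrier M. f s \<oplus>\<^bsub>N\<^esub> g s) \<in> lmod_hom K A M N"
      if f: "f \<in> lmod_hom K A M N" and g: "g \<in> lmod_hom K A M N" for f g
    proof (rule lmod_hom_restrictI[OF assms(1)])
      show "(\<lambda>s. f s \<oplus>\<^bsub>N\<^esub> g s) \<in> module_hom K M N"
        using lmod_homD(4)[OF f] lmod_homD(4)[OF g]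
        by (intro module_homI)
          (auto simp: module_hom_add[OF lmod_homD(1)[OF f]] module_hom_add[OF lmod_homD(1)[OF g]]
            module_hom_smult[OF lmod_homD(1)[OF f]] module_hom_smult[OF lmod_homD(1)[OF g]]
            V.M.a_ac V.smult_r_distr)
    qed (simp add: lmod_homD[OF f] lmod_homD[OF g] N.lact_add_right)
    show "(\<lambda>s\<in>carrier M. c \<odot>\<^bsub>N\<^esub> f s) \<in> lmod_hom K A M N"
      if c: "c \<in> carrier K" and f: "f \<in> lmod_hom K A M N" for c f
    proof (rule lmod_hom_restrictI[OF assms(1)])
      show "(\<lambda>s. c \<odot>\<^bsub>N\<^esub> f s) \<in> module_hom K M N"
        using lmod_homD(4)[OF f] c
        by (intro module_homI)
          (auto simp: module_hom_add[OF lmod_homD(1)[OF f]] module_hom_smult[OF lmod_homD(1)[OF f]]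
            V.smult_r_distr V.smult_assoc1[symmetric] V.R.m_comm)
    qed (simp add: lmod_homD[OF f] c N.lact_smult_right)
  qed (auto simp: lmod_homD)
qed

lemma linear_category_mod_category:
  assumes "field K"
  shows "linear_category K (mod_category K A)"
proof (rule linear_category.intro, goal_cases)
  case 1 show ?case by fact
next
  case (2 M N) then show ?case by (simp add: vectorspace_lmod_hom)
next
  case (3 M)
  then have M: "fd_lmodule K A M" by simp
  show ?case using lmod_hom_restrictI[OF M, of "\<lambda>m. m" M] by (auto intro: module_homI)
next
  case (4 L M N f)
  then have o: "fd_lmodule K A L" "fd_lmodule K A M" "fd_lmodule K A N" and f: "f \<in> lmod_hom K A L M" by auto
  show ?case
    by (rule module_homI)
      (auto simp: lmod_hom_compose[OF o(1) f, unfolded compose_def] compose_def lmod_homD(4)[OF f] intro!: restrict_ext)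
next
  case (5 L M N g)
  then have o: "fd_lmodule K A L" "fd_lmodule K A M" "fd_lmodule K A N" and g: "g \<in> lmod_hom K A M N" by auto
  show ?case
    by (rule module_homI)
      (auto simp: lmod_hom_compose[OF o(1) _ g, unfolded compose_def] compose_def lmod_homD(4) module_hom_add[OF lmod_homD(1)[OF g]]
        module_hom_smult[OF lmod_homD(1)[OF g]] intro!: restrict_ext)
next
  case (6 M N f)
  then have f: "f \<in> lmod_hom K A M N" by simp
  show ?case using compose_Id[OF _ lmod_homD(2)[OF f]] lmod_homD(4)[OF f] by auto
next
  case (7 M N f)
  then have f: "f \<in> lmod_hom K A M N" by simp
  show ?case using Id_compose[OF _ lmod_homD(2)[OF f]] lmod_homD(4)[OF f] by auto
next
  case (8 L M N O' f g h)
  then have f: "f \<in> lmod_hom K A L M" by simp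
  show ?case using compose_assoc[of f "carrier L" "carrier M" h g] lmod_homD(4)[OF f] by auto
qed

lemma lmod_iso_inv:
  assumes "fd_lmodule K A M" "fd_lmodule K A N" and f: "f \<in> lmod_iso K A M N"
  shows "(\<lambda>n\<in>carrier N. inv_into (carrier M) f n) \<in> lmod_iso K A N M"
proof -
  interpret M: fd_lmodule K A M by fact
  interpret N: fd_lmodule K A N by fact
  have fh: "f \<in> lmod_hom K A M N" and b: "bij_betw f (carrier M) (carrier N)" using f by (auto simp: lmod_iso_def)
  let ?g = "inv_into (carrier M) f"
  have inj: "inj_on f (carrier M)" and im: "f ` carrier M = carrier N" using b by (auto simp: bij_betw_def)
  have fg: "f (?g n) = n" and g: "?g n \<in> carrier M" if "n \<in> carrier N" for n
    using that im by (auto simp: f_inv_into_f inv_into_into)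
  have "?g (lact N a n) = lact M a (?g n)" if "a \<in> carrier A" "n \<in> carrier N" for a n
    by (rule inv_into_f_eq[OF inj]) (use that in \<open>auto simp: g fg M.lact_closed lmod_homD(3)[OF fh]\<close>)
  then have "(\<lambda>n\<in>carrier N. ?g n) \<in> lmod_hom K A N M"
    using module_hom_inv_into[OF M.vectorspace lmod_homD(1)[OF fh] b]
    by (intro lmod_hom_restrictI assms(2)) auto
  moreover have "bij_betw (\<lambda>n\<in>carrier N. ?g n) (carrier N) (carrier M)"
    using bij_betw_inv_into[OF b] by (simp cong: bij_betw_cong)
  ultimately show ?thesis by (simp add: lmod_iso_def)
qed

lemma lmod_iso_compose:
  assumes "fd_lmodule K A L" "f \<in> lmod_iso K A L M" "g \<in> lmod_iso K A M N"
  shows "compose (carrier L) g f \<in> lmod_iso K A L N"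
  using assms lmod_hom_compose[OF assms(1), of f M g N] bij_betw_trans[of f "carrier L" "carrier M" g "carrier N"]
  by (auto simp: lmod_iso_def compose_def comp_def cong: bij_betw_cong)

lemma iso_arr_lmod_iso:
  assumes "f \<in> iso_arr (mod_category K A) M N"
  shows "f \<in> lmod_iso K A M N"
proof -
  obtain g where f: "f \<in> lmod_hom K A M N" and g: "g \<in> lmod_hom K A N M"
    and gf: "compose (carrier M) g f = (\<lambda>m\<in>carrier M. m)" and fg: "compose (carrier N) f g = (\<lambda>m\<in>carrier N. m)"
    using assms by (auto simp: iso_arr_def)
  have "g (f m) = m" if "m \<in> carrier M" for m using fun_cong[OF gf, of m] that by (simp add: compose_def)
  moreover have "f (g n) = n" if "n \<in> carrier N" for n using fun_cong[OF fg, of n] that by (simp add: compose_def)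
  ultimately have "bij_betw f (carrier M) (carrier N)"
    using lmod_homD(4)[OF f] lmod_homD(4)[OF g] by (intro bij_betw_byWitness[of _ g]) auto
  then show ?thesis using f by (simp add: lmod_iso_def)
qed

text \<open>Coordinates with respect to a basis move a module to the carrier type \<open>nat \<Rightarrow> 'k\<close>.\<close>

lemma fd_lmodule_coordinates:
  assumes "fd_lmodule K A M"
  obtains N :: "('k, 'a, nat \<Rightarrow> 'k) lmod" and f where "fd_lmodule K A N" "f \<in> lmod_iso K A M N"
proof -
  interpret M: fd_lmodule K A M by fact
  interpret V: vectorspace K M by (rule M.vectorspace)
  obtain n v \<phi> where d: "dual_basis K M n v \<phi>" using dual_basis_exists[OF M.vectorspace M.fin_dim] by blast
  \<comment> \<open>Coordinates are padded with zero from index n on.\<close>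
  define c where "c x = (\<lambda>i. if i < n then \<phi> i x else \<zero>\<^bsub>K\<^esub>)" for x
  have "x = y" if "x \<in> carrier M" "y \<in> carrier M" "c x = c y" for x y
  proof -
    have "\<phi> i x = \<phi> i y" if "i < n" for i using fun_cong[OF \<open>c x = c y\<close>, of i] that by (simp add: c_def)
    then have "finsum M (\<lambda>i. \<phi> i x \<odot>\<^bsub>M\<^esub> v i) {..<n} = finsum M (\<lambda>i. \<phi> i y \<odot>\<^bsub>M\<^esub> v i) {..<n}"
      using dual_basisD[OF d] that(1,2) by (intro V.M.finsum_cong') auto
    then show ?thesis using dual_basisD(4)[OF d] that(1,2) by simp
  qed
  then have inj: "inj_on c (carrier M)" by (rule inj_onI)
  let ?g = "inv_into (carrier M) c"
  have gc: "?g (c x) = x" if "x \<in> carrier M" for x using inj that by simp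
  define N :: "('k, 'a, nat \<Rightarrow> 'k) lmod" where "N =
    \<lparr>carrier = c ` carrier M, mult = undefined, one = undefined, zero = c \<zero>\<^bsub>M\<^esub>,
     add = (\<lambda>a b. c (?g a \<oplus>\<^bsub>M\<^esub> ?g b)), smult = (\<lambda>k a. c (k \<odot>\<^bsub>M\<^esub> ?g a)),
     lact = (\<lambda>r a. c (lact M r (?g a)))\<rparr>"
  have N: "carrier N = c ` carrier M" "\<zero>\<^bsub>N\<^esub> = c \<zero>\<^bsub>M\<^esub>"
    "\<And>x y. x \<in> carrier M \<Longrightarrow> y \<in> carrier M \<Longrightarrow> c x \<oplus>\<^bsub>N\<^esub> c y = c (x \<oplus>\<^bsub>M\<^esub> y)"
    "\<And>k x. x \<in> carrier M \<Longrightarrow> k \<odot>\<^bsub>N\<^esub> c x = c (k \<odot>\<^bsub>M\<^esub> x)"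
    "\<And>r x. x \<in> carrier M \<Longrightarrow> lact N r (c x) = c (lact M r x)"
    by (simp_all add: N_def gc)
  have vN: "vectorspace K N" by (rule vectorspace_image[OF M.vectorspace N(1,2)]) (simp_all add: N)
  have cN: "c \<in> module_hom K M N" by (rule module_homI) (auto simp: N)
  have "fd_lmodule K A N"
    by (rule fd_lmodule.intro[OF vN fin_dim_image[OF M.vectorspace M.fin_dim vN cN N(1)[symmetric]]])
      (auto simp: N M.lact_closed M.lact_add_left M.lact_add_right M.lact_smult_left M.lact_smult_right
        M.lact_one M.lact_mult)
  moreover have "(\<lambda>m\<in>carrier M. c m) \<in> lmod_iso K A M N"
    using lmod_hom_restrictI[OF assms cN] inj
    by (auto simp: lmod_iso_def bij_betw_def N cong: inj_on_cong)
  ultimately show ?thesis using that by blast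
qed

text \<open>A homomorphism is determined by its values on a finite generating set S, hence by the
  scalars \<open>\<phi> i (h s)\<close>; these finitely many forms separate the Hom-space.\<close>

lemma fin_dim_lmod_hom:
  assumes "fd_lmodule K A M" "fd_lmodule K A N"
  shows "vectorspace.fin_dim K (map_space (carrier M) N (lmod_hom K A M N))"
proof -
  interpret M: fd_lmodule K A M by fact
  interpret N: fd_lmodule K A N by fact
  interpret V: vectorspace K N by (rule N.vectorspace)
  let ?H = "map_space (carrier M) N (lmod_hom K A M N)"
  obtain n v \<phi> where d: "dual_basis K N n v \<phi>" using dual_basis_exists[OF N.vectorspace N.fin_dim] by blast
  obtain S where S: "finite S" "S \<subseteq> carrier M"
    "\<And>U. linear_subset K M U \<Longrightarrow> S \<subseteq> U \<Longrightarrow> carrier M \<subseteq> U"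
    using fin_dim_cases[OF M.vectorspace M.fin_dim] by blast
  note \<phi> = linear_formD[OF dual_form[OF dual_basisD(2)[OF d]]]
  show ?thesis
  proof (rule fin_dim_separating[OF vectorspace_lmod_hom[OF assms], of "(\<lambda>(i, s) h. \<phi> i (h s)) ` ({..<n} \<times> S)"])
    show "(\<lambda>(i, s) h. \<phi> i (h s)) ` ({..<n} \<times> S) \<subseteq> linear_form K ?H"
      using S(2) by (auto intro!: module_homI simp: \<phi> lmod_homD(4) subset_iff)
    fix h assume h: "h \<in> carrier ?H" and z: "\<forall>\<psi>\<in>(\<lambda>(i, s) h. \<phi> i (h s)) ` ({..<n} \<times> S). \<psi> h = \<zero>\<^bsub>K\<^esub>"
    have hh: "h \<in> lmod_hom K A M N" using h by simp
    have "h s = \<zero>\<^bsub>N\<^esub>" if s: "s \<in> S" for s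
    proof -
      have hs: "h s \<in> carrier N" using lmod_homD(4)[OF hh] S(2) s by auto
      have "\<phi> i (h s) = \<zero>\<^bsub>K\<^esub>" if "i < n" for i using z that s by auto
      then have "finsum N (\<lambda>i. \<phi> i (h s) \<odot>\<^bsub>N\<^esub> v i) {..<n} = finsum N (\<lambda>i. \<zero>\<^bsub>N\<^esub>) {..<n}"
        using dual_basisD(1)[OF d] by (intro V.M.finsum_cong') auto
      then show ?thesis using dual_basisD(4)[OF d hs] by simp
    qed
    then have "S \<subseteq> {m \<in> carrier M. h m \<in> {\<zero>\<^bsub>N\<^esub>}}" using S(2) by auto
    moreover have "linear_subset K M {m \<in> carrier M. h m \<in> {\<zero>\<^bsub>N\<^esub>}}"
      by (rule linear_subset_vimage[OF M.vectorspace N.vectorspace lmod_homD(1)[OF hh]]) (auto simp: linear_subset_def)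
    ultimately have "carrier M \<subseteq> {m \<in> carrier M. h m \<in> {\<zero>\<^bsub>N\<^esub>}}" using S(3) by blast
    then have "h m = \<zero>\<^bsub>N\<^esub>" if "m \<in> carrier M" for m using that by auto
    then show "h = \<zero>\<^bsub>?H\<^esub>" by (intro extensionalityI[OF lmod_homD(2)[OF hh]]) simp_all
  qed (use S(1) in simp)
qed

section \<open>Working in the category through its realization by modules\<close>

text \<open>What the argument extracts from the equivalence: full faithfulness, and an object
  realizing each module on \<open>nat \<Rightarrow> 'k\<close> up to isomorphism. The quasi-inverse
  is forgotten.\<close>

locale module_realization = linear_category K \<X> + E: linear_functor K \<X> "mod_category K A" E
  for K :: "'k ring" and A :: "('k, 'a) module" and \<X> :: "('o, 'm, 'k) lcat"
    and E :: "('o, 'm, ('k, 'a, nat \<Rightarrow> 'k) lmod, (nat \<Rightarrow> 'k) \<Rightarrow> (nat \<Rightarrow> 'k)) functr" +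
  assumes algebra: "fd_algebra K A"
    and fully_faithful: "\<And>x y. x \<in> Obj \<X> \<Longrightarrow> y \<in> Obj \<X> \<Longrightarrow>
      bij_betw (mor E x y) (arr \<X> x y) (lmod_hom K A (ob E x) (ob E y))"
    and essentially_surjective: "\<And>M :: ('k, 'a, nat \<Rightarrow> 'k) lmod. fd_lmodule K A M \<Longrightarrow> \<exists>x\<in>Obj \<X>. \<exists>f. f \<in> lmod_iso K A (ob E x) M"

lemma module_realizationI:
  fixes K :: "'k ring" and A :: "('k, 'a) module"
  assumes "fd_algebra K A" "linear_category K \<X>" "linear_equivalence K \<X> (mod_category K A) E"
  shows "module_realization K A \<X> E"
proof -
  interpret linear_category K \<X> by fact
  note Y = linear_category_mod_category[OF field]
  show ?thesis
  proof (intro module_realization.intro module_realization_axioms.intro assms(1,2))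
    show "linear_functor K \<X> (mod_category K A) E" using assms(3) by (simp add: linear_equivalence_def)
    show "bij_betw (mor E x y) (arr \<X> x y) (lmod_hom K A (ob E x) (ob E y))"
      if "x \<in> Obj \<X>" "y \<in> Obj \<X>" for x y
      using linear_equivalence_fully_faithful[OF assms(2) Y assms(3) that] by simp
    show "\<exists>x\<in>Obj \<X>. \<exists>f. f \<in> lmod_iso K A (ob E x) M" if "fd_lmodule K A M" for M :: "('k, 'a, nat \<Rightarrow> 'k) lmod"
      using linear_equivalence_essentially_surjective[OF assms(3), of M] that iso_arr_lmod_iso by (metis mod_category_simps(1))
  qed
qed

context module_realization
begin

lemma ob_E: "x \<in> Obj \<X> \<Longrightarrow> fd_lmodule K A (ob E x)"
  using E.ob_closed by simp

lemma E_vs: "x \<in> Obj \<X> \<Longrightarrow> vectorspace K (ob E x)"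
  using ob_E fd_lmodule.vectorspace by blast

lemma E_hom: "x \<in> Obj \<X> \<Longrightarrow> y \<in> Obj \<X> \<Longrightarrow> f \<in> arr \<X> x y \<Longrightarrow> mor E x y f \<in> lmod_hom K A (ob E x) (ob E y)"
  using module_hom_in[OF E.mor_linear] by simp

lemma E_in: "x \<in> Obj \<X> \<Longrightarrow> y \<in> Obj \<X> \<Longrightarrow> f \<in> arr \<X> x y \<Longrightarrow> w \<in> carrier (ob E x) \<Longrightarrow>
    mor E x y f w \<in> carrier (ob E y)"
  using lmod_homD(4)[OF E_hom] .

lemma E_cmp: "x \<in> Obj \<X> \<Longrightarrow> y \<in> Obj \<X> \<Longrightarrow> z \<in> Obj \<X> \<Longrightarrow> f \<in> arr \<X> x y \<Longrightarrow> g \<in> arr \<X> y z \<Longrightarrow>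
    w \<in> carrier (ob E x) \<Longrightarrow> mor E x z (cmp \<X> x y z g f) w = mor E y z g (mor E x y f w)"
  by (simp add: E.mor_cmp compose_def)

lemma E_add: "x \<in> Obj \<X> \<Longrightarrow> y \<in> Obj \<X> \<Longrightarrow> f \<in> arr \<X> x y \<Longrightarrow> g \<in> arr \<X> x y \<Longrightarrow> w \<in> carrier (ob E x) \<Longrightarrow>
    mor E x y (f \<oplus>\<^bsub>Hom \<X> x y\<^esub> g) w = mor E x y f w \<oplus>\<^bsub>ob E y\<^esub> mor E x y g w"
  by (simp add: module_hom_add[OF E.mor_linear])

lemma E_smult: "x \<in> Obj \<X> \<Longrightarrow> y \<in> Obj \<X> \<Longrightarrow> f \<in> arr \<X> x y \<Longrightarrow> c \<in> carrier K \<Longrightarrow> w \<in> carrier (ob E x) \<Longrightarrow>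
    mor E x y (c \<odot>\<^bsub>Hom \<X> x y\<^esub> f) w = c \<odot>\<^bsub>ob E y\<^esub> mor E x y f w"
  by (simp add: module_hom_smult[OF E.mor_linear])

lemma E_idt: "x \<in> Obj \<X> \<Longrightarrow> w \<in> carrier (ob E x) \<Longrightarrow> mor E x x (idt \<X> x) w = w"
  by (simp add: E.mor_idt)

lemma E_eqI:
  assumes "x \<in> Obj \<X>" "y \<in> Obj \<X>" "f \<in> arr \<X> x y" "g \<in> arr \<X> x y"
    and "\<And>w. w \<in> carrier (ob E x) \<Longrightarrow> mor E x y f w = mor E x y g w"
  shows "f = g"
proof -
  have "mor E x y f = mor E x y g"
    using lmod_homD(2)[OF E_hom[OF assms(1-3)]] lmod_homD(2)[OF E_hom[OF assms(1,2,4)]] assms(5)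
    by (rule extensionalityI)
  then show ?thesis using fully_faithful[OF assms(1,2)] assms(3,4) by (auto simp: bij_betw_def inj_on_def)
qed

lemma E_full:
  assumes "x \<in> Obj \<X>" "y \<in> Obj \<X>" "g \<in> module_hom K (ob E x) (ob E y)"
    "\<And>a w. a \<in> carrier A \<Longrightarrow> w \<in> carrier (ob E x) \<Longrightarrow> g (lact (ob E x) a w) = lact (ob E y) a (g w)"
  obtains f where "f \<in> arr \<X> x y" "\<And>w. w \<in> carrier (ob E x) \<Longrightarrow> mor E x y f w = g w"
proof -
  have "(\<lambda>w\<in>carrier (ob E x). g w) \<in> mor E x y ` arr \<X> x y"
    using fully_faithful[OF assms(1,2)] lmod_hom_restrictI[OF ob_E[OF assms(1)] assms(3)] assms(4)
    by (simp add: bij_betw_def)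
  then obtain f where "f \<in> arr \<X> x y" "mor E x y f = (\<lambda>w\<in>carrier (ob E x). g w)" by auto
  then show ?thesis using that by simp
qed

text \<open>Coordinates first move M to the type \<open>nat \<Rightarrow> 'k\<close>. This is how
  modules on other types, such as A^* and tensor products, acquire objects that realize
  them.\<close>

lemma E_dense:
  assumes "fd_lmodule K A M"
  obtains x f where "x \<in> Obj \<X>" "f \<in> lmod_iso K A (ob E x) M"
proof -
  obtain N :: "('k, 'a, nat \<Rightarrow> 'k) lmod" and g where N: "fd_lmodule K A N" and g: "g \<in> lmod_iso K A M N"
    using fd_lmodule_coordinates[OF assms] by blast
  obtain x f where x: "x \<in> Obj \<X>" and f: "f \<in> lmod_iso K A (ob E x) N"
    using essentially_surjective[OF N] by blast
  show ?thesis
    using that[OF x lmod_iso_compose[OF ob_E[OF x] f lmod_iso_inv[OF assms N g]]] .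
qed

text \<open>If z realizes M through \<sigma>, morphisms x -> z are the same as homomorphisms E x ->
  M. This is the existence half; \<open>E_iso_eqI\<close> is the uniqueness half.\<close>

lemma E_iso_lift:
  assumes x: "x \<in> Obj \<X>" and z: "z \<in> Obj \<X>" and M: "fd_lmodule K A M" and \<sigma>: "\<sigma> \<in> lmod_iso K A (ob E z) M"
    and g: "g \<in> module_hom K (ob E x) M"
      "\<And>a w. a \<in> carrier A \<Longrightarrow> w \<in> carrier (ob E x) \<Longrightarrow> g (lact (ob E x) a w) = lact M a (g w)"
  obtains f where "f \<in> arr \<X> x z" "\<And>w. w \<in> carrier (ob E x) \<Longrightarrow> \<sigma> (mor E x z f w) = g w"
proof -
  let ?s = "\<lambda>m\<in>carrier M. inv_into (carrier (ob E z)) \<sigma> m"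
  have s: "?s \<in> lmod_hom K A M (ob E z)" using lmod_iso_inv[OF ob_E[OF z] M \<sigma>] by (simp add: lmod_iso_def)
  have im: "\<sigma> ` carrier (ob E z) = carrier M" using \<sigma> by (simp add: lmod_iso_def bij_betw_def)
  have gM: "g w \<in> carrier M" if "w \<in> carrier (ob E x)" for w using module_hom_in[OF g(1) that] .
  obtain f where "f \<in> arr \<X> x z" "\<And>w. w \<in> carrier (ob E x) \<Longrightarrow> mor E x z f w = ?s (g w)"
  proof (rule E_full[OF x z, of "\<lambda>w. ?s (g w)"])
    show "(\<lambda>w. ?s (g w)) \<in> module_hom K (ob E x) (ob E z)"
      by (rule module_hom_compose[OF g(1) lmod_homD(1)[OF s]])
    show "?s (g (lact (ob E x) a w)) = lact (ob E z) a (?s (g w))" if "a \<in> carrier A" "w \<in> carrier (ob E x)" for a w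
      using that by (simp only: g(2) lmod_homD(3)[OF s] gM)
  qed blast
  then show ?thesis using that gM im by (simp add: f_inv_into_f)
qed

lemma E_iso_eqI:
  assumes "x \<in> Obj \<X>" "z \<in> Obj \<X>" "\<sigma> \<in> lmod_iso K A (ob E z) M" "f \<in> arr \<X> x z" "g \<in> arr \<X> x z"
    and "\<And>w. w \<in> carrier (ob E x) \<Longrightarrow> \<sigma> (mor E x z f w) = \<sigma> (mor E x z g w)"
  shows "f = g"
proof (rule E_eqI[OF assms(1,2,4,5)])
  fix w assume w: "w \<in> carrier (ob E x)"
  show "mor E x z f w = mor E x z g w"
    using assms(3) assms(6)[OF w] E_in[OF assms(1,2,4) w] E_in[OF assms(1,2,5) w]
    by (auto simp: lmod_iso_def bij_betw_def inj_on_def)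
qed

lemma fin_dim_Hom:
  assumes "x \<in> Obj \<X>" "y \<in> Obj \<X>"
  shows "vectorspace.fin_dim K (Hom \<X> x y)"
proof -
  let ?H = "map_space (carrier (ob E x)) (ob E y) (lmod_hom K A (ob E x) (ob E y))"
  have hom: "mor E x y \<in> module_hom K (Hom \<X> x y) ?H" using E.mor_linear[OF assms] by simp
  have bij: "bij_betw (mor E x y) (carrier (Hom \<X> x y)) (carrier ?H)" using fully_faithful[OF assms] by simp
  have H: "vectorspace K ?H" "vectorspace.fin_dim K ?H"
    using assms ob_E by (auto intro: vectorspace_lmod_hom fin_dim_lmod_hom)
  note V = Hom_vectorspace[OF assms]
  show ?thesis
    by (rule fin_dim_image[OF H V module_hom_inv_into[OF V hom bij]])
      (use bij_betw_inv_into[OF bij] in \<open>simp add: bij_betw_def\<close>)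
qed

end

section \<open>The co-regular bimodule\<close>

lemma coregular_simps:
  "carrier (coregular K A) = carrier (dual K A)" "\<zero>\<^bsub>coregular K A\<^esub> = \<zero>\<^bsub>dual K A\<^esub>"
  "add (coregular K A) = add (dual K A)" "smult (coregular K A) = smult (dual K A)"
  "ract (coregular K A) \<phi> a = (\<lambda>b\<in>carrier A. \<phi> (a \<otimes>\<^bsub>A\<^esub> b))"
  "blact (coregular K A) a \<phi> = (\<lambda>b\<in>carrier A. \<phi> (b \<otimes>\<^bsub>A\<^esub> a))"
  by (simp_all add: coregular_def Let_def)

text \<open>The co-regular bimodule with its right action forgotten; a record of its own because
  \<open>bimod\<close> extends \<open>rmod\<close> and not \<open>lmod\<close>.\<close>

definition coregular_lmod :: "'k ring \<Rightarrow> ('k, 'a) module \<Rightarrow> ('k, 'a, 'a \<Rightarrow> 'k) lmod"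
  where "coregular_lmod K A =
    \<lparr>carrier = carrier (dual K A), mult = undefined, one = undefined, zero = \<zero>\<^bsub>dual K A\<^esub>,
     add = add (dual K A), smult = smult (dual K A), lact = blact (coregular K A)\<rparr>"

lemma coregular_lmod_simps:
  "carrier (coregular_lmod K A) = carrier (dual K A)" "\<zero>\<^bsub>coregular_lmod K A\<^esub> = \<zero>\<^bsub>dual K A\<^esub>"
  "add (coregular_lmod K A) = add (dual K A)" "smult (coregular_lmod K A) = smult (dual K A)"
  "lact (coregular_lmod K A) = blact (coregular K A)"
  by (simp_all add: coregular_lmod_def)

lemma bimod_tensor_simps:
  "carrier (bimod_tensor K A B M) = carrier (tensor K A B M)"
  "\<zero>\<^bsub>bimod_tensor K A B M\<^esub> = \<zero>\<^bsub>tensor K A B M\<^esub>"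
  "add (bimod_tensor K A B M) = add (tensor K A B M)"
  "smult (bimod_tensor K A B M) = smult (tensor K A B M)"
  "lact (bimod_tensor K A B M) a = tensor_map K A B M B M (blact B a) (\<lambda>m. m)"
  by (simp_all add: bimod_tensor_def Let_def)

lemma module_hom_pointwise_add:
  assumes "vectorspace K W" "f \<in> module_hom K V W" "g \<in> module_hom K V W"
  shows "(\<lambda>x. f x \<oplus>\<^bsub>W\<^esub> g x) \<in> module_hom K V W"
proof -
  interpret W: vectorspace K W by fact
  show ?thesis
    by (rule module_homI)
      (use assms(2,3) in \<open>auto simp: module_hom_in module_hom_add module_hom_smult W.M.a_ac W.smult_r_distr\<close>)
qed

lemma module_hom_pointwise_smult:
  assumes "vectorspace K W" "f \<in> module_hom K V W" "c \<in> carrier K"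
  shows "(\<lambda>x. c \<odot>\<^bsub>W\<^esub> f x) \<in> module_hom K V W"
proof -
  interpret W: vectorspace K W by fact
  show ?thesis
    by (rule module_homI)
      (use assms(2,3) in \<open>auto simp: module_hom_in module_hom_add module_hom_smult W.smult_r_distr
        W.smult_assoc1[symmetric] W.R.m_comm\<close>)
qed

lemma module_hom_id: "(\<lambda>x. x) \<in> module_hom K V V"
  by (rule module_homI) auto

context fd_algebra
begin

interpretation A: ring A by (rule ring)
interpretation AV: vectorspace K A by (rule vectorspace)

abbreviation (input) D where "D \<equiv> coregular K A"

lemma vectorspace_coregular: "vectorspace K D"
  by (rule vectorspace_transfer[OF vectorspace_dual[OF vectorspace]]) (simp_all add: coregular_simps)

lemma module_hom_coregular [simp]:
  "module_hom K D W = module_hom K (dual K A) W" "module_hom K U D = module_hom K U (dual K A)"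
  "module_hom K (coregular_lmod K A) W = module_hom K (dual K A) W"
  "module_hom K U (coregular_lmod K A) = module_hom K U (dual K A)"
  by (simp_all add: module_hom_def coregular_simps coregular_lmod_simps)

lemma left_mult_hom: "a \<in> carrier A \<Longrightarrow> (\<lambda>b. a \<otimes>\<^bsub>A\<^esub> b) \<in> module_hom K A A"
  by (rule module_homI) (auto simp: A.r_distr smult_mult_right)

lemma right_mult_hom: "a \<in> carrier A \<Longrightarrow> (\<lambda>b. b \<otimes>\<^bsub>A\<^esub> a) \<in> module_hom K A A"
  by (rule module_homI) (auto simp: A.l_distr smult_mult_left)

text \<open>The right action of a is the transpose of left multiplication by a, so linearity is that
  of \<open>dual_map\<close>.\<close>

lemma coregular_ract_hom: "a \<in> carrier A \<Longrightarrow> (\<lambda>\<phi>. ract D \<phi> a) \<in> module_hom K (dual K A) (dual K A)"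
  by (rule module_hom_cong[OF dual_map_hom(1)[OF vectorspace vectorspace left_mult_hom[of a]] vectorspace_dual[OF vectorspace]])
    (simp_all only: coregular_simps(5) dual_map_hom(2)[OF vectorspace vectorspace left_mult_hom[of a]])

lemma coregular_blact_hom: "a \<in> carrier A \<Longrightarrow> blact D a \<in> module_hom K (dual K A) (dual K A)"
  by (rule module_hom_cong[OF dual_map_hom(1)[OF vectorspace vectorspace right_mult_hom[of a]] vectorspace_dual[OF vectorspace]])
    (simp_all only: coregular_simps(6) dual_map_hom(2)[OF vectorspace vectorspace right_mult_hom[of a]])

lemma coregular_ract_in: "\<phi> \<in> carrier (dual K A) \<Longrightarrow> a \<in> carrier A \<Longrightarrow> ract D \<phi> a \<in> carrier (dual K A)"
  using module_hom_in[OF coregular_ract_hom] by simp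

lemma coregular_blact_in: "\<phi> \<in> carrier (dual K A) \<Longrightarrow> a \<in> carrier A \<Longrightarrow> blact D a \<phi> \<in> carrier (dual K A)"
  using module_hom_in[OF coregular_blact_hom] .

lemma coregular_app:
  "b \<in> carrier A \<Longrightarrow> ract D \<phi> a b = \<phi> (a \<otimes>\<^bsub>A\<^esub> b)" "b \<in> carrier A \<Longrightarrow> blact D a \<phi> b = \<phi> (b \<otimes>\<^bsub>A\<^esub> a)"
  by (simp_all add: coregular_simps)

lemma coregular_bimodule:
  assumes "\<phi> \<in> carrier (dual K A)" "a \<in> carrier A" "r \<in> carrier A"
  shows "blact D a (ract D \<phi> r) = ract D (blact D a \<phi>) r"
  using assms by (intro dual_eqI[of _ K A])
    (auto simp: coregular_ract_in coregular_blact_in coregular_app A.m_assoc)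

lemma coregular_blact_add:
  assumes "\<phi> \<in> carrier (dual K A)" "a \<in> carrier A" "b \<in> carrier A"
  shows "blact D (a \<oplus>\<^bsub>A\<^esub> b) \<phi> = blact D a \<phi> \<oplus>\<^bsub>dual K A\<^esub> blact D b \<phi>"
  using assms linear_formD[OF dual_form[OF assms(1)]]
  by (intro dual_eqI[of _ K A] vectorspace_add[OF vectorspace_dual[OF vectorspace]])
    (auto simp: coregular_blact_in coregular_app dual_app A.r_distr)

lemma coregular_blact_smult:
  assumes "\<phi> \<in> carrier (dual K A)" "a \<in> carrier A" "c \<in> carrier K"
  shows "blact D (c \<odot>\<^bsub>A\<^esub> a) \<phi> = c \<odot>\<^bsub>dual K A\<^esub> blact D a \<phi>"
  using assms linear_formD[OF dual_form[OF assms(1)]]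
  by (intro dual_eqI[of _ K A] vectorspace_smult[OF vectorspace_dual[OF vectorspace]])
    (auto simp: coregular_blact_in coregular_app dual_app smult_mult_right)

lemma coregular_blact_one: "\<phi> \<in> carrier (dual K A) \<Longrightarrow> blact D \<one>\<^bsub>A\<^esub> \<phi> = \<phi>"
  by (rule dual_eqI[of _ K A]) (auto simp: coregular_blact_in coregular_app)

lemma coregular_blact_mult:
  assumes "\<phi> \<in> carrier (dual K A)" "a \<in> carrier A" "b \<in> carrier A"
  shows "blact D (a \<otimes>\<^bsub>A\<^esub> b) \<phi> = blact D a (blact D b \<phi>)"
  using assms by (intro dual_eqI[of _ K A]) (auto simp: coregular_blact_in coregular_app A.m_assoc)

lemma fd_lmodule_coregular: "fd_lmodule K A (coregular_lmod K A)"
proof -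
  let ?L = "coregular_lmod K A"
  note V = vectorspace_dual[OF vectorspace]
  have vs: "vectorspace K ?L" by (rule vectorspace_transfer[OF V]) (simp_all add: coregular_lmod_simps)
  have fd: "vectorspace.fin_dim K ?L"
    by (rule fin_dim_image[OF V fin_dim_dual[OF vectorspace fin_dim] vs, of "\<lambda>x. x"])
      (simp_all add: module_hom_id coregular_lmod_simps)
  show ?thesis
    by (rule fd_lmodule.intro[OF vs fd])
      (simp_all add: coregular_lmod_simps coregular_blact_in coregular_blact_add coregular_blact_smult
        coregular_blact_one coregular_blact_mult module_hom_add[OF coregular_blact_hom]
        module_hom_smult[OF coregular_blact_hom])
qed

end

locale coregular_tensor = fd_algebra K A + M: fd_lmodule K A M
  for K :: "'k ring" and A :: "('k, 'a) module" and M :: "('k, 'a, 'm) lmod"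
begin

abbreviation (input) TM where "TM \<equiv> bimod_tensor K A (coregular K A) M"
abbreviation (input) pt where "pt \<equiv> pure_tensor K A (coregular K A) M"

sublocale T: tensor_factors K A "coregular K A" M
  by (rule tensor_factors.intro[OF vectorspace_coregular M.vectorspace])
    (simp_all add: coregular_simps(1) coregular_ract_in M.lact_closed)

lemma vectorspace_TM: "vectorspace K TM"
  by (rule vectorspace_transfer[OF T.vectorspace_tensor]) (simp_all add: bimod_tensor_simps)

lemma module_hom_TM [simp]:
  "module_hom K TM W = module_hom K (tensor K A (coregular K A) M) W"
  "module_hom K U TM = module_hom K U (tensor K A (coregular K A) M)"
  by (simp_all add: module_hom_def bimod_tensor_simps)

lemma fin_dim_TM: "vectorspace.fin_dim K TM"
proof (rule fin_dim_image[OF T.vectorspace_tensor T.fin_dim_tensor vectorspace_TM, of "\<lambda>x. x"])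
  show "vectorspace.fin_dim K (coregular K A)"
    by (rule fin_dim_image[OF vectorspace_dual[OF vectorspace] fin_dim_dual[OF vectorspace fin_dim]
          vectorspace_coregular, of "\<lambda>x. x"]) (simp_all add: module_hom_id coregular_simps)
qed (simp_all add: M.fin_dim module_hom_id bimod_tensor_simps)

lemma pt_hom_left: "m \<in> carrier M \<Longrightarrow> (\<lambda>\<phi>. pt \<phi> m) \<in> module_hom K (dual K A) TM"
  using T.pure_hom_left[of m] by simp

lemma pt_hom_right: "\<phi> \<in> carrier (dual K A) \<Longrightarrow> pt \<phi> \<in> module_hom K M TM"
  using T.pure_hom_right[of \<phi>] by (simp add: coregular_simps)

lemma pt_balanced: "\<phi> \<in> carrier (dual K A) \<Longrightarrow> a \<in> carrier A \<Longrightarrow> m \<in> carrier M \<Longrightarrow>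
    pt (ract (coregular K A) \<phi> a) m = pt \<phi> (lact M a m)"
  using T.pure_balanced[of \<phi> a m] by (simp add: coregular_simps)

lemma TM_eqI:
  assumes "vectorspace K U" "f \<in> module_hom K TM U" "g \<in> module_hom K TM U"
    and "\<And>\<phi> m. \<phi> \<in> carrier (dual K A) \<Longrightarrow> m \<in> carrier M \<Longrightarrow> f (pt \<phi> m) = g (pt \<phi> m)" and "t \<in> carrier TM"
  shows "f t = g t"
  using T.tensor_hom_eqI[OF assms(1), of f g t] assms(2-5) by (simp add: bimod_tensor_simps coregular_simps)

lemma TM_lact:
  assumes "a \<in> carrier A"
  shows "lact TM a \<in> module_hom K TM TM"
    and "\<And>\<phi> m. \<phi> \<in> carrier (dual K A) \<Longrightarrow> m \<in> carrier M \<Longrightarrow> lact TM a (pt \<phi> m) = pt (blact (coregular K A) a \<phi>) m"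
  using tensor_map_characterization[OF T.tensor_factors_axioms T.tensor_factors_axioms, of "blact (coregular K A) a" "\<lambda>m. m"]
    coregular_blact_hom[OF assms] coregular_bimodule[OF _ assms]
  by (auto simp: bimod_tensor_simps(5) coregular_simps(1) module_hom_id)

text \<open>Each axiom relating the actions of different elements of A compares maps that are linear
  in t. It therefore reduces to pure tensors, and there to the same property of the left action on
  A^*.\<close>

lemma fd_lmodule_TM: "fd_lmodule K A TM"
proof (rule fd_lmodule.intro[OF vectorspace_TM fin_dim_TM])
  note V = vectorspace_TM and L = TM_lact
  show "lact TM a t \<in> carrier TM" if "a \<in> carrier A" "t \<in> carrier TM" for a t
    using module_hom_in[OF L(1)] that by blast
  show "lact TM a (s \<oplus>\<^bsub>TM\<^esub> t) = lact TM a s \<oplus>\<^bsub>TM\<^esub> lact TM a t"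
    if "a \<in> carrier A" "s \<in> carrier TM" "t \<in> carrier TM" for a s t using module_hom_add[OF L(1)] that by blast
  show "lact TM a (c \<odot>\<^bsub>TM\<^esub> t) = c \<odot>\<^bsub>TM\<^esub> lact TM a t"
    if "c \<in> carrier K" "a \<in> carrier A" "t \<in> carrier TM" for c a t using module_hom_smult[OF L(1)] that by blast
  show "lact TM (a \<oplus>\<^bsub>A\<^esub> b) t = lact TM a t \<oplus>\<^bsub>TM\<^esub> lact TM b t"
    if a: "a \<in> carrier A" and b: "b \<in> carrier A" and t: "t \<in> carrier TM" for a b t
  proof (rule TM_eqI[OF V _ module_hom_pointwise_add[OF V] _ t])
    fix \<phi> m assume p: "\<phi> \<in> carrier (dual K A)" and m: "m \<in> carrier M"
    have ab: "a \<oplus>\<^bsub>A\<^esub> b \<in> carrier A" using vectorspace_add[OF vectorspace a b] .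
    show "lact TM (a \<oplus>\<^bsub>A\<^esub> b) (pt \<phi> m) = lact TM a (pt \<phi> m) \<oplus>\<^bsub>TM\<^esub> lact TM b (pt \<phi> m)"
      by (simp only: L(2)[OF a p m] L(2)[OF b p m] L(2)[OF ab p m] coregular_blact_add[OF p a b]
          module_hom_add[OF pt_hom_left[OF m]] coregular_blact_in[OF p a] coregular_blact_in[OF p b])
  qed (use L(1) a b vectorspace_add[OF vectorspace a b] in auto)
  show "lact TM (c \<odot>\<^bsub>A\<^esub> a) t = c \<odot>\<^bsub>TM\<^esub> lact TM a t"
    if c: "c \<in> carrier K" and a: "a \<in> carrier A" and t: "t \<in> carrier TM" for c a t
  proof (rule TM_eqI[OF V _ module_hom_pointwise_smult[OF V _ c] _ t])
    fix \<phi> m assume p: "\<phi> \<in> carrier (dual K A)" and m: "m \<in> carrier M"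
    have ca: "c \<odot>\<^bsub>A\<^esub> a \<in> carrier A" using vectorspace_smult[OF vectorspace c a] .
    show "lact TM (c \<odot>\<^bsub>A\<^esub> a) (pt \<phi> m) = c \<odot>\<^bsub>TM\<^esub> lact TM a (pt \<phi> m)"
      by (simp only: L(2)[OF a p m] L(2)[OF ca p m] coregular_blact_smult[OF p a c]
          module_hom_smult[OF pt_hom_left[OF m]] coregular_blact_in[OF p a] c)
  qed (use L(1) a vectorspace_smult[OF vectorspace c a] in auto)
  have one: "\<one>\<^bsub>A\<^esub> \<in> carrier A" using ring by (simp add: ring.ring_simprules)
  show "lact TM \<one>\<^bsub>A\<^esub> t = t" if t: "t \<in> carrier TM" for t
  proof (rule TM_eqI[OF V _ module_hom_id _ t])
    fix \<phi> m assume p: "\<phi> \<in> carrier (dual K A)" and m: "m \<in> carrier M"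
    show "lact TM \<one>\<^bsub>A\<^esub> (pt \<phi> m) = pt \<phi> m" by (simp only: L(2)[OF one p m] coregular_blact_one[OF p])
  qed (use L(1) one in auto)
  show "lact TM (a \<otimes>\<^bsub>A\<^esub> b) t = lact TM a (lact TM b t)"
    if a: "a \<in> carrier A" and b: "b \<in> carrier A" and t: "t \<in> carrier TM" for a b t
  proof (rule TM_eqI[OF V _ module_hom_compose[of "lact TM b" K TM TM "lact TM a"] _ t])
    have ab: "a \<otimes>\<^bsub>A\<^esub> b \<in> carrier A" using ring a b by (simp add: ring.ring_simprules)
    then show "lact TM (a \<otimes>\<^bsub>A\<^esub> b) \<in> module_hom K TM TM" by (rule L(1))
    fix \<phi> m assume p: "\<phi> \<in> carrier (dual K A)" and m: "m \<in> carrier M"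
    show "lact TM (a \<otimes>\<^bsub>A\<^esub> b) (pt \<phi> m) = lact TM a (lact TM b (pt \<phi> m))"
      by (simp only: L(2)[OF ab p m] L(2)[OF b p m] L(2)[OF a coregular_blact_in[OF p b] m] coregular_blact_mult[OF p a b])
  qed (use L(1) a b in auto)
qed

text \<open>Balancedness gives the induced linear map; equivariance of b in its first argument makes
  that map A-linear, again by comparison on pure tensors.\<close>

lemma TM_lift:
  assumes N: "fd_lmodule K A N"
    and l: "\<And>m. m \<in> carrier M \<Longrightarrow> (\<lambda>\<phi>. b \<phi> m) \<in> module_hom K (dual K A) N"
    and r: "\<And>\<phi>. \<phi> \<in> carrier (dual K A) \<Longrightarrow> b \<phi> \<in> module_hom K M N"
    and bal: "\<And>\<phi> a m. \<phi> \<in> carrier (dual K A) \<Longrightarrow> a \<in> carrier A \<Longrightarrow> m \<in> carrier M \<Longrightarrow>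
      b (ract (coregular K A) \<phi> a) m = b \<phi> (lact M a m)"
    and eq: "\<And>\<phi> a m. \<phi> \<in> carrier (dual K A) \<Longrightarrow> a \<in> carrier A \<Longrightarrow> m \<in> carrier M \<Longrightarrow>
      b (blact (coregular K A) a \<phi>) m = lact N a (b \<phi> m)"
  obtains h where "h \<in> module_hom K TM N"
    "\<And>a t. a \<in> carrier A \<Longrightarrow> t \<in> carrier TM \<Longrightarrow> h (lact TM a t) = lact N a (h t)"
    "\<And>\<phi> m. \<phi> \<in> carrier (dual K A) \<Longrightarrow> m \<in> carrier M \<Longrightarrow> h (pt \<phi> m) = b \<phi> m"
proof -
  interpret N: fd_lmodule K A N by fact
  have "balanced_map K A (coregular K A) M N b"
    using l r bal by (simp add: balanced_map_def coregular_simps(1))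
  then obtain h where h: "h \<in> module_hom K TM N"
    "\<And>\<phi> m. \<phi> \<in> carrier (dual K A) \<Longrightarrow> m \<in> carrier M \<Longrightarrow> h (pt \<phi> m) = b \<phi> m"
    using T.tensor_lift[OF N.vectorspace, of b] by (metis coregular_simps(1) module_hom_TM(1))
  have "h (lact TM a t) = lact N a (h t)" if a: "a \<in> carrier A" and t: "t \<in> carrier TM" for a t
  proof (rule TM_eqI[OF N.vectorspace _ _ _ t])
    show "(\<lambda>t. h (lact TM a t)) \<in> module_hom K TM N" by (rule module_hom_compose[OF TM_lact(1)[OF a] h(1)])
    show "(\<lambda>t. lact N a (h t)) \<in> module_hom K TM N" by (rule module_hom_compose[OF h(1) N.lact_hom[OF a]])
    fix \<phi> m assume p: "\<phi> \<in> carrier (dual K A)" and m: "m \<in> carrier M"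
    show "h (lact TM a (pt \<phi> m)) = lact N a (h (pt \<phi> m))"
      by (simp only: TM_lact(2)[OF a p m] h(2)[OF coregular_blact_in[OF p a] m] h(2)[OF p m] eq[OF p a m])
  qed
  then show ?thesis using that h by blast
qed

end

lemma coregular_tensorI: "fd_algebra K A \<Longrightarrow> fd_lmodule K A M \<Longrightarrow> coregular_tensor K A M"
  by (simp add: coregular_tensor_def)

abbreviation coregular_tensor_map ::
  "'k ring \<Rightarrow> ('k, 'a) module \<Rightarrow> ('k, 'a, 'm) lmod \<Rightarrow> ('k, 'a, 'n) lmod \<Rightarrow> ('m \<Rightarrow> 'n)
    \<Rightarrow> (('a \<Rightarrow> 'k) \<times> 'm \<Rightarrow> 'k) set \<Rightarrow> (('a \<Rightarrow> 'k) \<times> 'n \<Rightarrow> 'k) set"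
  where "coregular_tensor_map K A M N f \<equiv> tensor_map K A (coregular K A) M (coregular K A) N (\<lambda>b. b) f"

lemma coregular_tensor_map_characterization:
  assumes "fd_algebra K A" and M: "fd_lmodule K A M" and N: "fd_lmodule K A N" and f: "f \<in> lmod_hom K A M N"
  shows "coregular_tensor_map K A M N f \<in> lmod_hom K A (bimod_tensor K A (coregular K A) M) (bimod_tensor K A (coregular K A) N)"
    and "\<And>\<phi> m. \<phi> \<in> carrier (dual K A) \<Longrightarrow> m \<in> carrier M \<Longrightarrow>
      coregular_tensor_map K A M N f (pure_tensor K A (coregular K A) M \<phi> m) = pure_tensor K A (coregular K A) N \<phi> (f m)"
proof -
  interpret fd_algebra K A by fact
  interpret M: coregular_tensor K A M by (intro coregular_tensorI assms)
  interpret N: coregular_tensor K A N by (intro coregular_tensorI assms)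
  note c = tensor_map_characterization[OF M.T.tensor_factors_axioms N.T.tensor_factors_axioms module_hom_id _
      lmod_homD(1)[OF f] lmod_homD(3)[OF f]]
  show p: "coregular_tensor_map K A M N f (pure_tensor K A (coregular K A) M \<phi> m) = pure_tensor K A (coregular K A) N \<phi> (f m)"
    if "\<phi> \<in> carrier (dual K A)" "m \<in> carrier M" for \<phi> m
    using c(3) that by (simp add: coregular_simps(1))
  have h: "coregular_tensor_map K A M N f \<in> module_hom K M.TM N.TM" using c(1) by simp
  show "coregular_tensor_map K A M N f \<in> lmod_hom K A M.TM N.TM"
  proof (rule lmod_homI[OF h])
    show "coregular_tensor_map K A M N f \<in> extensional (carrier M.TM)" using c(2) by (simp add: bimod_tensor_simps)
    fix a t assume a: "a \<in> carrier A" and t: "t \<in> carrier M.TM"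
    show "coregular_tensor_map K A M N f (lact M.TM a t) = lact N.TM a (coregular_tensor_map K A M N f t)"
    proof (rule M.TM_eqI[OF N.vectorspace_TM _ _ _ t])
      show "(\<lambda>t. coregular_tensor_map K A M N f (lact M.TM a t)) \<in> module_hom K M.TM N.TM"
        by (rule module_hom_compose[OF M.TM_lact(1)[OF a] h])
      show "(\<lambda>t. lact N.TM a (coregular_tensor_map K A M N f t)) \<in> module_hom K M.TM N.TM"
        by (rule module_hom_compose[OF h N.TM_lact(1)[OF a]])
      fix \<phi> m assume q: "\<phi> \<in> carrier (dual K A)" and m: "m \<in> carrier M"
      show "coregular_tensor_map K A M N f (lact M.TM a (M.pt \<phi> m)) = lact N.TM a (coregular_tensor_map K A M N f (M.pt \<phi> m))"
        by (simp only: M.TM_lact(2)[OF a q m] p[OF q m] p[OF coregular_blact_in[OF q a] m]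
            N.TM_lact(2)[OF a q lmod_homD(4)[OF f m]])
    qed
  qed
qed

section \<open>The universal family of a module category\<close>

context coregular_tensor
begin

text \<open>For fixed \<xi> this is the homomorphism M -> A^* that corresponds to \<xi> under Hom(M,
  A^* ) = M^*; evaluation at 1 recovers \<xi>, see \<open>coeff_one\<close>.\<close>

definition coeff :: "('m \<Rightarrow> 'k) \<Rightarrow> 'm \<Rightarrow> 'a \<Rightarrow> 'k"
  where "coeff \<xi> w = (\<lambda>a\<in>carrier A. \<xi> (lact M a w))"

lemma one_in: "\<one>\<^bsub>A\<^esub> \<in> carrier A"
  using ring by (simp add: ring.ring_simprules)

lemma mult_in: "a \<in> carrier A \<Longrightarrow> b \<in> carrier A \<Longrightarrow> a \<otimes>\<^bsub>A\<^esub> b \<in> carrier A"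
  using ring by (simp add: ring.ring_simprules)

lemma coeff_in:
  assumes "\<xi> \<in> carrier (dual K M)" "w \<in> carrier M"
  shows "coeff \<xi> w \<in> carrier (dual K A)"
proof -
  have "(\<lambda>a. lact M a w) \<in> module_hom K A M"
    using assms(2) by (intro module_homI) (auto simp: M.lact_closed M.lact_add_left M.lact_smult_left)
  then show ?thesis unfolding coeff_def
    by (rule dual_restrictI[OF vectorspace module_hom_compose[OF _ dual_form[OF assms(1)]]])
qed

lemma coeff_hom_right:
  assumes "\<xi> \<in> carrier (dual K M)"
  shows "coeff \<xi> \<in> module_hom K M (dual K A)"
  using linear_formD[OF dual_form[OF assms]]
  by (intro module_homI coeff_in assms)
    (auto simp: coeff_def dual_simps(3,4) M.lact_add_right M.lact_smult_right M.lact_closed intro!: restrict_ext)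

lemma coeff_hom_left:
  assumes "w \<in> carrier M"
  shows "(\<lambda>\<xi>. coeff \<xi> w) \<in> module_hom K (dual K M) (dual K A)"
  by (intro module_homI coeff_in assms)
    (use assms in \<open>auto simp: coeff_def dual_simps(3,4)[where V = A] dual_app[where V = M] M.lact_closed
      intro!: restrict_ext\<close>)

lemma coeff_lact:
  assumes "w \<in> carrier M" "a \<in> carrier A"
  shows "coeff \<xi> (lact M a w) = blact (coregular K A) a (coeff \<xi> w)"
  using assms by (auto simp: coeff_def coregular_simps(6) M.lact_mult mult_in intro!: restrict_ext)

text \<open>The right action on A^* becomes the right action on M^*: the scalar \<xi>(a b w) is the
  form \<xi>(a -) taken at b w.\<close>

lemma coeff_ract:
  assumes "w \<in> carrier M" "a \<in> carrier A"
  shows "ract (coregular K A) (coeff \<xi> w) a = coeff (\<lambda>u\<in>carrier M. \<xi> (lact M a u)) w"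
  using assms by (auto simp: coeff_def coregular_simps(5) M.lact_mult M.lact_closed mult_in intro!: restrict_ext)

lemma coeff_one: "w \<in> carrier M \<Longrightarrow> coeff \<xi> w \<one>\<^bsub>A\<^esub> = \<xi> w"
  by (simp add: coeff_def one_in M.lact_one)

lemma dual_lact_in:
  assumes "\<xi> \<in> carrier (dual K M)" "a \<in> carrier A"
  shows "(\<lambda>u\<in>carrier M. \<xi> (lact M a u)) \<in> carrier (dual K M)"
  by (rule dual_restrictI[OF M.vectorspace module_hom_compose[OF M.lact_hom[OF assms(2)] dual_form[OF assms(1)]]])

end

context module_realization
begin

abbreviation T where "T y \<equiv> bimod_tensor K A (coregular K A) (ob E y)"
abbreviation pt where "pt y \<equiv> pure_tensor K A (coregular K A) (ob E y)"
abbreviation cf where "cf x \<equiv> coregular_tensor.coeff A (ob E x)"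

lemma ct: "y \<in> Obj \<X> \<Longrightarrow> coregular_tensor K A (ob E y)"
  by (rule coregular_tensorI[OF algebra ob_E])

lemmas T_mod = coregular_tensor.fd_lmodule_TM[OF ct]

definition matrix_form :: "'o \<Rightarrow> 'o \<Rightarrow> ((nat \<Rightarrow> 'k) \<Rightarrow> 'k) \<Rightarrow> (nat \<Rightarrow> 'k) \<Rightarrow> 'm \<Rightarrow> 'k"
  where "matrix_form y x \<xi> m = (\<lambda>h\<in>arr \<X> y x. \<xi> (mor E y x h m))"

lemma matrix_form_in:
  assumes y: "y \<in> Obj \<X>" and x: "x \<in> Obj \<X>" and \<xi>: "\<xi> \<in> carrier (dual K (ob E x))" and m: "m \<in> carrier (ob E y)"
  shows "matrix_form y x \<xi> m \<in> carrier (dual K (Hom \<X> y x))"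
proof -
  have "(\<lambda>h. mor E y x h m) \<in> module_hom K (Hom \<X> y x) (ob E x)"
    by (rule module_homI) (simp_all add: E_in E_add E_smult x y m)
  then show ?thesis unfolding matrix_form_def
    by (rule dual_restrictI[OF Hom_vectorspace[OF y x] module_hom_compose[OF _ dual_form[OF \<xi>]]])
qed

lemma matrix_form_hom:
  assumes y: "y \<in> Obj \<X>" and x: "x \<in> Obj \<X>" and \<xi>: "\<xi> \<in> carrier (dual K (ob E x))"
  shows "matrix_form y x \<xi> \<in> module_hom K (ob E y) (dual K (Hom \<X> y x))"
proof (rule module_homI)
  note l = linear_formD[OF dual_form[OF \<xi>]]
  note h = lmod_homD(1)[OF E_hom[OF y x]]
  show "matrix_form y x \<xi> m \<in> carrier (dual K (Hom \<X> y x))" if "m \<in> carrier (ob E y)" for m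
    by (rule matrix_form_in[OF y x \<xi> that])
  show "matrix_form y x \<xi> (m \<oplus>\<^bsub>ob E y\<^esub> m') = matrix_form y x \<xi> m \<oplus>\<^bsub>dual K (Hom \<X> y x)\<^esub> matrix_form y x \<xi> m'"
    if "m \<in> carrier (ob E y)" "m' \<in> carrier (ob E y)" for m m'
    unfolding matrix_form_def dual_simps using that
    by (intro restrict_ext) (simp add: module_hom_add[OF h] l E_in[OF y x])
  show "matrix_form y x \<xi> (c \<odot>\<^bsub>ob E y\<^esub> m) = c \<odot>\<^bsub>dual K (Hom \<X> y x)\<^esub> matrix_form y x \<xi> m"
    if "c \<in> carrier K" "m \<in> carrier (ob E y)" for c m
    unfolding matrix_form_def dual_simps using that
    by (intro restrict_ext) (simp add: module_hom_smult[OF h] l E_in[OF y x])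
qed

text \<open>Matrix coefficients separate the points of \<open>Hom(y, x)\<close>, hence span its dual.\<close>

lemma dual_Hom_eqI:
  assumes y: "y \<in> Obj \<X>" and x: "x \<in> Obj \<X>" and W: "vectorspace K W" "vectorspace.fin_dim K W"
    and f: "f \<in> module_hom K (dual K (Hom \<X> y x)) W" and g: "g \<in> module_hom K (dual K (Hom \<X> y x)) W"
    and eq: "\<And>\<xi> m. \<xi> \<in> carrier (dual K (ob E x)) \<Longrightarrow> m \<in> carrier (ob E y) \<Longrightarrow>
      f (matrix_form y x \<xi> m) = g (matrix_form y x \<xi> m)"
    and \<zeta>: "\<zeta> \<in> carrier (dual K (Hom \<X> y x))"
  shows "f \<zeta> = g \<zeta>"
proof (rule separating_forms_span[OF Hom_vectorspace[OF y x] fin_dim_Hom[OF y x] W f g _ _ _ \<zeta>,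
      of "(\<lambda>(\<xi>, m). matrix_form y x \<xi> m) ` (carrier (dual K (ob E x)) \<times> carrier (ob E y))"])
  fix h assume h: "h \<in> arr \<X> y x"
    and z: "\<And>\<sigma>. \<sigma> \<in> (\<lambda>(\<xi>, m). matrix_form y x \<xi> m) ` (carrier (dual K (ob E x)) \<times> carrier (ob E y)) \<Longrightarrow> \<sigma> h = \<zero>\<^bsub>K\<^esub>"
  have z0: "\<zero>\<^bsub>Hom \<X> y x\<^esub> \<in> arr \<X> y x" using vectorspace_zero[OF Hom_vectorspace[OF y x]] .
  interpret X: fd_lmodule K A "ob E x" using ob_E[OF x] .
  show "h = \<zero>\<^bsub>Hom \<X> y x\<^esub>"
  proof (rule E_eqI[OF y x h z0])
    fix m assume m: "m \<in> carrier (ob E y)"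
    show "mor E y x h m = mor E y x \<zero>\<^bsub>Hom \<X> y x\<^esub> m"
    proof (rule linear_forms_separate[OF X.vectorspace X.fin_dim E_in[OF y x h m] E_in[OF y x z0 m]])
      fix \<xi> assume \<xi>: "\<xi> \<in> carrier (dual K (ob E x))"
      have "matrix_form y x \<xi> m \<zero>\<^bsub>Hom \<X> y x\<^esub> = \<zero>\<^bsub>K\<^esub>"
        using module_hom_zero[OF Hom_vectorspace[OF y x] vectorspace_ground[OF field]
            dual_form[OF matrix_form_in[OF y x \<xi> m]]] by simp
      moreover have "matrix_form y x \<xi> m h = \<zero>\<^bsub>K\<^esub>" using \<xi> m by (intro z) auto
      ultimately show "\<xi> (mor E y x h m) = \<xi> (mor E y x \<zero>\<^bsub>Hom \<X> y x\<^esub> m)"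
        using h z0 by (simp add: matrix_form_def)
    qed
  qed
qed (use eq matrix_form_in[OF y x] in auto)

section \<open>The object \<open>N0 y\<close> and its universal family\<close>

text \<open>Object and isomorphism are chosen as one pair, so that \<open>\<tau> y\<close> belongs
  to the chosen \<open>N0 y\<close>.\<close>

definition nak :: "'o \<Rightarrow> 'o \<times> ((nat \<Rightarrow> 'k) \<Rightarrow> (('a \<Rightarrow> 'k) \<times> (nat \<Rightarrow> 'k) \<Rightarrow> 'k) set)"
  where "nak y = (SOME zf. fst zf \<in> Obj \<X> \<and> snd zf \<in> lmod_iso K A (ob E (fst zf)) (T y))"

abbreviation N0 where "N0 y \<equiv> fst (nak y)"
abbreviation \<tau> where "\<tau> y \<equiv> snd (nak y)"

lemma nak: assumes "y \<in> Obj \<X>" shows N0: "N0 y \<in> Obj \<X>" and \<tau>: "\<tau> y \<in> lmod_iso K A (ob E (N0 y)) (T y)"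
proof -
  obtain z f where "z \<in> Obj \<X>" "f \<in> lmod_iso K A (ob E z) (T y)" using E_dense[OF T_mod[OF assms]] by blast
  then have "\<exists>zf. fst zf \<in> Obj \<X> \<and> snd zf \<in> lmod_iso K A (ob E (fst zf)) (T y)" by (intro exI[of _ "(z, f)"]) simp
  from someI_ex[OF this] show "N0 y \<in> Obj \<X>" "\<tau> y \<in> lmod_iso K A (ob E (N0 y)) (T y)"
    unfolding nak_def by auto
qed

lemma \<tau>_hom: "y \<in> Obj \<X> \<Longrightarrow> \<tau> y \<in> lmod_hom K A (ob E (N0 y)) (T y)"
  and \<tau>_bij: "y \<in> Obj \<X> \<Longrightarrow> bij_betw (\<tau> y) (carrier (ob E (N0 y))) (carrier (T y))"
  using \<tau> by (auto simp: lmod_iso_def)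

lemma \<tau>_add:
  assumes y: "y \<in> Obj \<X>" and x: "x \<in> Obj \<X>" and f: "f \<in> arr \<X> x (N0 y)" and g: "g \<in> arr \<X> x (N0 y)"
    and w: "w \<in> carrier (ob E x)"
  shows "\<tau> y (mor E x (N0 y) (f \<oplus>\<^bsub>Hom \<X> x (N0 y)\<^esub> g) w)
    = \<tau> y (mor E x (N0 y) f w) \<oplus>\<^bsub>T y\<^esub> \<tau> y (mor E x (N0 y) g w)"
  by (simp only: E_add[OF x N0[OF y] f g w]
      module_hom_add[OF lmod_homD(1)[OF \<tau>_hom[OF y]] E_in[OF x N0[OF y] f w] E_in[OF x N0[OF y] g w]])

lemma \<tau>_smult:
  assumes y: "y \<in> Obj \<X>" and x: "x \<in> Obj \<X>" and f: "f \<in> arr \<X> x (N0 y)" and c: "c \<in> carrier K"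
    and w: "w \<in> carrier (ob E x)"
  shows "\<tau> y (mor E x (N0 y) (c \<odot>\<^bsub>Hom \<X> x (N0 y)\<^esub> f) w) = c \<odot>\<^bsub>T y\<^esub> \<tau> y (mor E x (N0 y) f w)"
  by (simp only: E_smult[OF x N0[OF y] f c w]
      module_hom_smult[OF lmod_homD(1)[OF \<tau>_hom[OF y]] c E_in[OF x N0[OF y] f w]])

text \<open>The morphism x -> N0 y that realizes w -> \<xi>(- w) \<otimes> m: the value that the
  universal transformation is to take at the matrix coefficient of \<xi> and m.\<close>

definition pure_arr :: "'o \<Rightarrow> 'o \<Rightarrow> ((nat \<Rightarrow> 'k) \<Rightarrow> 'k) \<Rightarrow> (nat \<Rightarrow> 'k) \<Rightarrow> 'm"
  where "pure_arr y x \<xi> m = (SOME q. q \<in> arr \<X> x (N0 y)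
    \<and> (\<forall>w\<in>carrier (ob E x). \<tau> y (mor E x (N0 y) q w) = pt y (cf x \<xi> w) m))"

lemma pure_arr:
  assumes y: "y \<in> Obj \<X>" and x: "x \<in> Obj \<X>" and \<xi>: "\<xi> \<in> carrier (dual K (ob E x))" and m: "m \<in> carrier (ob E y)"
  shows "pure_arr y x \<xi> m \<in> arr \<X> x (N0 y)"
    and "\<And>w. w \<in> carrier (ob E x) \<Longrightarrow> \<tau> y (mor E x (N0 y) (pure_arr y x \<xi> m) w) = pt y (cf x \<xi> w) m"
proof -
  interpret X: coregular_tensor K A "ob E x" using ct[OF x] .
  interpret Y: coregular_tensor K A "ob E y" using ct[OF y] .
  let ?Q = "\<lambda>q. q \<in> arr \<X> x (N0 y) \<and> (\<forall>w\<in>carrier (ob E x). \<tau> y (mor E x (N0 y) q w) = pt y (cf x \<xi> w) m)"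
  obtain q where "q \<in> arr \<X> x (N0 y)" "\<And>w. w \<in> carrier (ob E x) \<Longrightarrow> \<tau> y (mor E x (N0 y) q w) = pt y (cf x \<xi> w) m"
  proof (rule E_iso_lift[OF x N0[OF y] T_mod[OF y] \<tau>[OF y], of "\<lambda>w. pt y (cf x \<xi> w) m"])
    show "(\<lambda>w. pt y (cf x \<xi> w) m) \<in> module_hom K (ob E x) (T y)"
      by (rule module_hom_compose[OF X.coeff_hom_right[OF \<xi>] Y.pt_hom_left[OF m]])
    show "pt y (cf x \<xi> (lact (ob E x) a w)) m = lact (T y) a (pt y (cf x \<xi> w) m)"
      if "a \<in> carrier A" "w \<in> carrier (ob E x)" for a w
      by (simp only: X.coeff_lact[OF that(2,1)] Y.TM_lact(2)[OF that(1) X.coeff_in[OF \<xi> that(2)] m])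
  qed blast
  then have "\<exists>q. ?Q q" by blast
  then have "?Q (pure_arr y x \<xi> m)" unfolding pure_arr_def by (rule someI_ex)
  then show "pure_arr y x \<xi> m \<in> arr \<X> x (N0 y)"
    and "\<And>w. w \<in> carrier (ob E x) \<Longrightarrow> \<tau> y (mor E x (N0 y) (pure_arr y x \<xi> m) w) = pt y (cf x \<xi> w) m" by auto
qed

lemma pure_arr_eqI:
  assumes y: "y \<in> Obj \<X>" and x: "x \<in> Obj \<X>" and \<xi>: "\<xi> \<in> carrier (dual K (ob E x))" and m: "m \<in> carrier (ob E y)"
    and q: "q \<in> arr \<X> x (N0 y)"
    and eq: "\<And>w. w \<in> carrier (ob E x) \<Longrightarrow> \<tau> y (mor E x (N0 y) q w) = pt y (cf x \<xi> w) m"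
  shows "pure_arr y x \<xi> m = q"
  by (rule E_iso_eqI[OF x N0[OF y] \<tau>[OF y] pure_arr(1)[OF y x \<xi> m] q])
    (simp add: eq pure_arr(2)[OF y x \<xi> m])

lemma pure_arr_hom_left:
  assumes y: "y \<in> Obj \<X>" and x: "x \<in> Obj \<X>" and m: "m \<in> carrier (ob E y)"
  shows "(\<lambda>\<xi>. pure_arr y x \<xi> m) \<in> module_hom K (dual K (ob E x)) (Hom \<X> x (N0 y))"
proof (rule module_homI)
  interpret X: coregular_tensor K A "ob E x" using ct[OF x] .
  interpret Y: coregular_tensor K A "ob E y" using ct[OF y] .
  note H = Hom_vectorspace[OF x N0[OF y]] and V = vectorspace_dual[OF E_vs[OF x]]
  note p = pure_arr[OF y x _ m]
  show "pure_arr y x \<xi> m \<in> arr \<X> x (N0 y)" if "\<xi> \<in> carrier (dual K (ob E x))" for \<xi> by (rule p(1)[OF that])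
  show "pure_arr y x (\<xi> \<oplus>\<^bsub>dual K (ob E x)\<^esub> \<xi>') m = pure_arr y x \<xi> m \<oplus>\<^bsub>Hom \<X> x (N0 y)\<^esub> pure_arr y x \<xi>' m"
    if a: "\<xi> \<in> carrier (dual K (ob E x))" and b: "\<xi>' \<in> carrier (dual K (ob E x))" for \<xi> \<xi>'
  proof (rule pure_arr_eqI[OF y x vectorspace_add[OF V a b] m vectorspace_add[OF H p(1)[OF a] p(1)[OF b]]])
    fix w assume w: "w \<in> carrier (ob E x)"
    show "\<tau> y (mor E x (N0 y) (pure_arr y x \<xi> m \<oplus>\<^bsub>Hom \<X> x (N0 y)\<^esub> pure_arr y x \<xi>' m) w)
        = pt y (cf x (\<xi> \<oplus>\<^bsub>dual K (ob E x)\<^esub> \<xi>') w) m"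
      by (simp only: \<tau>_add[OF y x p(1)[OF a] p(1)[OF b] w] p(2)[OF a w] p(2)[OF b w]
          module_hom_add[OF X.coeff_hom_left[OF w] a b] module_hom_add[OF Y.pt_hom_left[OF m] X.coeff_in[OF a w] X.coeff_in[OF b w]])
  qed
  show "pure_arr y x (c \<odot>\<^bsub>dual K (ob E x)\<^esub> \<xi>) m = c \<odot>\<^bsub>Hom \<X> x (N0 y)\<^esub> pure_arr y x \<xi> m"
    if c: "c \<in> carrier K" and a: "\<xi> \<in> carrier (dual K (ob E x))" for c \<xi>
  proof (rule pure_arr_eqI[OF y x vectorspace_smult[OF V c a] m vectorspace_smult[OF H c p(1)[OF a]]])
    fix w assume w: "w \<in> carrier (ob E x)"
    show "\<tau> y (mor E x (N0 y) (c \<odot>\<^bsub>Hom \<X> x (N0 y)\<^esub> pure_arr y x \<xi> m) w) = pt y (cf x (c \<odot>\<^bsub>dual K (ob E x)\<^esub> \<xi>) w) m"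
      by (simp only: \<tau>_smult[OF y x p(1)[OF a] c w] p(2)[OF a w]
          module_hom_smult[OF X.coeff_hom_left[OF w] c a] module_hom_smult[OF Y.pt_hom_left[OF m] c X.coeff_in[OF a w]])
  qed
qed

lemma pure_arr_hom_right:
  assumes y: "y \<in> Obj \<X>" and x: "x \<in> Obj \<X>" and \<xi>: "\<xi> \<in> carrier (dual K (ob E x))"
  shows "pure_arr y x \<xi> \<in> module_hom K (ob E y) (Hom \<X> x (N0 y))"
proof (rule module_homI)
  interpret X: coregular_tensor K A "ob E x" using ct[OF x] .
  interpret Y: coregular_tensor K A "ob E y" using ct[OF y] .
  note H = Hom_vectorspace[OF x N0[OF y]] and V = E_vs[OF y]
  note p = pure_arr[OF y x \<xi>]
  show "pure_arr y x \<xi> m \<in> arr \<X> x (N0 y)" if "m \<in> carrier (ob E y)" for m by (rule p(1)[OF that])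
  show "pure_arr y x \<xi> (m \<oplus>\<^bsub>ob E y\<^esub> m') = pure_arr y x \<xi> m \<oplus>\<^bsub>Hom \<X> x (N0 y)\<^esub> pure_arr y x \<xi> m'"
    if a: "m \<in> carrier (ob E y)" and b: "m' \<in> carrier (ob E y)" for m m'
  proof (rule pure_arr_eqI[OF y x \<xi> vectorspace_add[OF V a b] vectorspace_add[OF H p(1)[OF a] p(1)[OF b]]])
    fix w assume w: "w \<in> carrier (ob E x)"
    show "\<tau> y (mor E x (N0 y) (pure_arr y x \<xi> m \<oplus>\<^bsub>Hom \<X> x (N0 y)\<^esub> pure_arr y x \<xi> m') w)
        = pt y (cf x \<xi> w) (m \<oplus>\<^bsub>ob E y\<^esub> m')"
      by (simp only: \<tau>_add[OF y x p(1)[OF a] p(1)[OF b] w] p(2)[OF a w] p(2)[OF b w]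
          module_hom_add[OF Y.pt_hom_right[OF X.coeff_in[OF \<xi> w]] a b])
  qed
  show "pure_arr y x \<xi> (c \<odot>\<^bsub>ob E y\<^esub> m) = c \<odot>\<^bsub>Hom \<X> x (N0 y)\<^esub> pure_arr y x \<xi> m"
    if c: "c \<in> carrier K" and a: "m \<in> carrier (ob E y)" for c m
  proof (rule pure_arr_eqI[OF y x \<xi> vectorspace_smult[OF V c a] vectorspace_smult[OF H c p(1)[OF a]]])
    fix w assume w: "w \<in> carrier (ob E x)"
    show "\<tau> y (mor E x (N0 y) (c \<odot>\<^bsub>Hom \<X> x (N0 y)\<^esub> pure_arr y x \<xi> m) w) = pt y (cf x \<xi> w) (c \<odot>\<^bsub>ob E y\<^esub> m)"
      by (simp only: \<tau>_smult[OF y x p(1)[OF a] c w] p(2)[OF a w]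
          module_hom_smult[OF Y.pt_hom_right[OF X.coeff_in[OF \<xi> w]] c a])
  qed
qed

text \<open>In the tensor product \<xi>(- w) \<otimes> a m equals \<xi>(- w) a \<otimes> m, and
  \<open>coeff_ract\<close> absorbs a into \<xi>. This is what makes the morphism y -> x constructed
  in \<open>theta_exists\<close> A-linear.\<close>

lemma pure_arr_balanced:
  assumes y: "y \<in> Obj \<X>" and x: "x \<in> Obj \<X>" and \<xi>: "\<xi> \<in> carrier (dual K (ob E x))" and m: "m \<in> carrier (ob E y)"
    and a: "a \<in> carrier A"
  shows "pure_arr y x \<xi> (lact (ob E y) a m) = pure_arr y x (\<lambda>u\<in>carrier (ob E x). \<xi> (lact (ob E x) a u)) m"
proof -
  interpret X: coregular_tensor K A "ob E x" using ct[OF x] .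
  interpret Y: coregular_tensor K A "ob E y" using ct[OF y] .
  note \<xi>a = X.dual_lact_in[OF \<xi> a]
  show ?thesis
    by (rule pure_arr_eqI[OF y x \<xi> Y.M.lact_closed[OF a m] pure_arr(1)[OF y x \<xi>a m]])
      (simp only: pure_arr(2)[OF y x \<xi>a m] X.coeff_ract[OF _ a, symmetric] Y.pt_balanced[OF X.coeff_in[OF \<xi>] a m])
qed

text \<open>
  The map \<open>Hom(y, x)\<^sup>* \<rightarrow> Hom(x, A\<^sup>* \<otimes>\<^sub>A y)\<close> is determined by its values on matrix coefficients.  It exists
  because a functional \<open>\<omega>\<close> on the target yields, by reflexivity of \<open>x\<close>, a morphism \<open>h : y \<rightarrow> x\<close> with
  \<open>\<xi>(h m) = \<omega>(\<xi> \<otimes> m)\<close>.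
\<close>

lemma theta_exists:
  assumes y: "y \<in> Obj \<X>" and x: "x \<in> Obj \<X>"
  shows "\<exists>\<Theta>. \<Theta> \<in> module_hom K (dual K (Hom \<X> y x)) (Hom \<X> x (N0 y))
    \<and> (\<forall>\<xi>\<in>carrier (dual K (ob E x)). \<forall>m\<in>carrier (ob E y). \<Theta> (matrix_form y x \<xi> m) = pure_arr y x \<xi> m)"
proof -
  interpret X: coregular_tensor K A "ob E x" using ct[OF x] .
  interpret Y: coregular_tensor K A "ob E y" using ct[OF y] .
  note n = N0[OF y]
  let ?S = "carrier (dual K (ob E x)) \<times> carrier (ob E y)"
  have "\<exists>h\<in>arr \<X> y x. \<forall>s\<in>?S. (case s of (\<xi>, m) \<Rightarrow> matrix_form y x \<xi> m) h = \<omega> (case s of (\<xi>, m) \<Rightarrow> pure_arr y x \<xi> m)"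
    if \<omega>: "\<omega> \<in> carrier (dual K (Hom \<X> x (N0 y)))" for \<omega>
  proof -
    note o = linear_formD[OF dual_form[OF \<omega>]]
    \<comment> \<open>For fixed m, the assignment \<xi> -> \<omega>(\<xi> \<otimes> m) is a
      functional on the dual of E x, which reflexivity turns into a vector u m.\<close>
    have "\<exists>u\<in>carrier (ob E x). \<forall>\<xi>\<in>carrier (dual K (ob E x)). \<xi> u = \<omega> (pure_arr y x \<xi> m)"
      if m: "m \<in> carrier (ob E y)" for m
    proof -
      have "(\<lambda>\<xi>. \<omega> (pure_arr y x \<xi> m)) \<in> linear_form K (dual K (ob E x))"
        by (rule module_hom_compose[OF pure_arr_hom_left[OF y x m] dual_form[OF \<omega>]])
      from dual_reflexive[OF X.M.vectorspace X.M.fin_dim this] show ?thesis by metis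
    qed
    then obtain u where u: "\<And>m. m \<in> carrier (ob E y) \<Longrightarrow> u m \<in> carrier (ob E x)"
      "\<And>\<xi> m. \<xi> \<in> carrier (dual K (ob E x)) \<Longrightarrow> m \<in> carrier (ob E y) \<Longrightarrow> \<xi> (u m) = \<omega> (pure_arr y x \<xi> m)" by metis
    note sep = linear_forms_separate[OF X.M.vectorspace X.M.fin_dim]
    have "u \<in> module_hom K (ob E y) (ob E x)"
    proof (rule module_homI)
      show "u m \<in> carrier (ob E x)" if "m \<in> carrier (ob E y)" for m by (rule u(1)[OF that])
      show "u (m \<oplus>\<^bsub>ob E y\<^esub> m') = u m \<oplus>\<^bsub>ob E x\<^esub> u m'" if a: "m \<in> carrier (ob E y)" and b: "m' \<in> carrier (ob E y)" for m m'
      proof (rule sep)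
        fix \<xi> assume \<xi>: "\<xi> \<in> carrier (dual K (ob E x))"
        show "\<xi> (u (m \<oplus>\<^bsub>ob E y\<^esub> m')) = \<xi> (u m \<oplus>\<^bsub>ob E x\<^esub> u m')"
          by (simp only: u(2)[OF \<xi> vectorspace_add[OF E_vs[OF y] a b]] linear_formD(2)[OF dual_form[OF \<xi>] u(1)[OF a] u(1)[OF b]]
              u(2)[OF \<xi> a] u(2)[OF \<xi> b] module_hom_add[OF pure_arr_hom_right[OF y x \<xi>] a b]
              o(2)[OF pure_arr(1)[OF y x \<xi> a] pure_arr(1)[OF y x \<xi> b]])
      qed (use u(1) a b vectorspace_add[OF E_vs[OF y] a b] vectorspace_add[OF E_vs[OF x]] in auto)
      show "u (c \<odot>\<^bsub>ob E y\<^esub> m) = c \<odot>\<^bsub>ob E x\<^esub> u m" if c: "c \<in> carrier K" and a: "m \<in> carrier (ob E y)" for c m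
      proof (rule sep)
        fix \<xi> assume \<xi>: "\<xi> \<in> carrier (dual K (ob E x))"
        show "\<xi> (u (c \<odot>\<^bsub>ob E y\<^esub> m)) = \<xi> (c \<odot>\<^bsub>ob E x\<^esub> u m)"
          by (simp only: u(2)[OF \<xi> vectorspace_smult[OF E_vs[OF y] c a]] linear_formD(3)[OF dual_form[OF \<xi>] c u(1)[OF a]]
              u(2)[OF \<xi> a] module_hom_smult[OF pure_arr_hom_right[OF y x \<xi>] c a] o(3)[OF c pure_arr(1)[OF y x \<xi> a]])
      qed (use u(1) a c vectorspace_smult[OF E_vs[OF y] c a] vectorspace_smult[OF E_vs[OF x] c] in auto)
    qed
    \<comment> \<open>A-linearity of u is the balancing relation, seen through the separating forms
      \<xi>.\<close>
    moreover have "u (lact (ob E y) a m) = lact (ob E x) a (u m)" if a: "a \<in> carrier A" and m: "m \<in> carrier (ob E y)" for a m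
    proof (rule sep)
      fix \<xi> assume \<xi>: "\<xi> \<in> carrier (dual K (ob E x))"
      have "\<xi> (u (lact (ob E y) a m)) = \<omega> (pure_arr y x (\<lambda>u\<in>carrier (ob E x). \<xi> (lact (ob E x) a u)) m)"
        by (simp only: u(2)[OF \<xi> Y.M.lact_closed[OF a m]] pure_arr_balanced[OF y x \<xi> m a])
      also have "\<dots> = \<xi> (lact (ob E x) a (u m))"
        using u(2)[OF X.dual_lact_in[OF \<xi> a] m] u(1)[OF m] by simp
      finally show "\<xi> (u (lact (ob E y) a m)) = \<xi> (lact (ob E x) a (u m))" .
    qed (use u(1) a m X.M.lact_closed Y.M.lact_closed in auto)
    ultimately obtain h where "h \<in> arr \<X> y x" "\<And>m. m \<in> carrier (ob E y) \<Longrightarrow> mor E y x h m = u m"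
      using E_full[OF y x] by blast
    then show ?thesis using u(2) by (intro bexI[of _ h]) (auto simp: matrix_form_def)
  qed
  from dual_extension[OF Hom_vectorspace[OF y x] Hom_vectorspace[OF x n] fin_dim_Hom[OF x n], of ?S
      "\<lambda>(\<xi>, m). pure_arr y x \<xi> m" "\<lambda>(\<xi>, m). matrix_form y x \<xi> m", OF _ this]
  obtain \<Theta> where "\<Theta> \<in> module_hom K (dual K (Hom \<X> y x)) (Hom \<X> x (N0 y))"
    "\<And>s. s \<in> ?S \<Longrightarrow> \<Theta> (case s of (\<xi>, m) \<Rightarrow> matrix_form y x \<xi> m) = (case s of (\<xi>, m) \<Rightarrow> pure_arr y x \<xi> m)"
    using pure_arr(1)[OF y x] by (auto 4 3)
  then show ?thesis by (intro exI[of _ \<Theta>]) auto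
qed

definition theta :: "'o \<Rightarrow> 'o \<Rightarrow> ('m \<Rightarrow> 'k) \<Rightarrow> 'm"
  where "theta y x = (SOME \<Theta>. \<Theta> \<in> module_hom K (dual K (Hom \<X> y x)) (Hom \<X> x (N0 y))
    \<and> (\<forall>\<xi>\<in>carrier (dual K (ob E x)). \<forall>m\<in>carrier (ob E y). \<Theta> (matrix_form y x \<xi> m) = pure_arr y x \<xi> m))"

lemma theta_hom: "y \<in> Obj \<X> \<Longrightarrow> x \<in> Obj \<X> \<Longrightarrow> theta y x \<in> module_hom K (dual K (Hom \<X> y x)) (Hom \<X> x (N0 y))"
  and theta_matrix_form: "y \<in> Obj \<X> \<Longrightarrow> x \<in> Obj \<X> \<Longrightarrow> \<xi> \<in> carrier (dual K (ob E x)) \<Longrightarrow> m \<in> carrier (ob E y) \<Longrightarrow>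
    theta y x (matrix_form y x \<xi> m) = pure_arr y x \<xi> m"
  using someI_ex[OF theta_exists] unfolding theta_def by auto

lemma dual_E_in:
  assumes x: "x \<in> Obj \<X>" and x': "x' \<in> Obj \<X>" and f: "f \<in> arr \<X> x x'" and \<xi>: "\<xi> \<in> carrier (dual K (ob E x'))"
  shows "(\<lambda>u\<in>carrier (ob E x). \<xi> (mor E x x' f u)) \<in> carrier (dual K (ob E x))"
  by (rule dual_restrictI[OF E_vs[OF x] module_hom_compose[OF lmod_homD(1)[OF E_hom[OF x x' f]] dual_form[OF \<xi>]]])

text \<open>In \<xi>(f h m) the morphism f can be attached to \<xi>; the companion
  \<open>matrix_form_push\<close> attaches k to m instead.\<close>

lemma matrix_form_pull:
  assumes y: "y \<in> Obj \<X>" and x: "x \<in> Obj \<X>" and x': "x' \<in> Obj \<X>" and f: "f \<in> arr \<X> x x'"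
    and m: "m \<in> carrier (ob E y)"
  shows "(\<lambda>h\<in>arr \<X> y x. matrix_form y x' \<xi> m (cmp \<X> y x x' f h))
    = matrix_form y x (\<lambda>u\<in>carrier (ob E x). \<xi> (mor E x x' f u)) m"
  unfolding matrix_form_def
  by (intro restrict_ext) (simp add: cmp_closed[OF y x x' _ f] E_cmp[OF y x x' _ f m] E_in[OF y x _ m])

lemma matrix_form_push:
  assumes y: "y \<in> Obj \<X>" and y': "y' \<in> Obj \<X>" and x: "x \<in> Obj \<X>" and k: "k \<in> arr \<X> y y'"
    and m: "m \<in> carrier (ob E y)"
  shows "(\<lambda>h\<in>arr \<X> y' x. matrix_form y x \<xi> m (cmp \<X> y y' x h k)) = matrix_form y' x \<xi> (mor E y y' k m)"
  unfolding matrix_form_def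
  by (intro restrict_ext) (simp add: cmp_closed[OF y y' x k] E_cmp[OF y y' x k _ m])

text \<open>The morphism f is realized by an A-linear map, which passes through the action inside
  \<xi>(- w).\<close>

lemma coeff_E:
  assumes x: "x \<in> Obj \<X>" and x': "x' \<in> Obj \<X>" and f: "f \<in> arr \<X> x x'" and w: "w \<in> carrier (ob E x)"
  shows "cf x (\<lambda>u\<in>carrier (ob E x). \<xi> (mor E x x' f u)) w = cf x' \<xi> (mor E x x' f w)"
proof -
  interpret X: coregular_tensor K A "ob E x" using ct[OF x] .
  interpret X': coregular_tensor K A "ob E x'" using ct[OF x'] .
  show ?thesis unfolding X.coeff_def X'.coeff_def
    by (intro restrict_ext) (simp add: X.M.lact_closed w lmod_homD(3)[OF E_hom[OF x x' f]])
qed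

text \<open>Both sides are linear in \<zeta>, so matrix coefficients suffice. There f is absorbed
  into \<xi> on one side and applied to w on the other, which is the same by
  \<open>coeff_E\<close>.\<close>

lemma dual_family_theta:
  assumes y: "y \<in> Obj \<X>"
  shows "dual_family K \<X> y (N0 y) (theta y)"
  unfolding dual_family_def
proof (intro conjI ballI)
  note n = N0[OF y]
  fix x assume x: "x \<in> Obj \<X>"
  show "theta y x \<in> module_hom K (dual K (Hom \<X> y x)) (Hom \<X> x (N0 y))" by (rule theta_hom[OF y x])
  fix x' f \<zeta> assume x': "x' \<in> Obj \<X>" and f: "f \<in> arr \<X> x x'" and z: "\<zeta> \<in> carrier (dual K (Hom \<X> y x'))"
  note dm = dual_map_hom[OF Hom_vectorspace[OF y x] Hom_vectorspace[OF y x'] postcomp_linear[OF y x x' f]]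
  have "theta y x (dual_map K (Hom \<X> y x) (Hom \<X> y x') (\<lambda>h. cmp \<X> y x x' f h) \<zeta>) = cmp \<X> x x' (N0 y) (theta y x' \<zeta>) f"
  proof (rule dual_Hom_eqI[OF y x' Hom_vectorspace[OF x n] fin_dim_Hom[OF x n] module_hom_compose[OF dm(1) theta_hom[OF y x]]
      module_hom_compose[OF theta_hom[OF y x'] precomp_linear[OF x x' n f]] _ z])
    fix \<xi> m assume \<xi>: "\<xi> \<in> carrier (dual K (ob E x'))" and m: "m \<in> carrier (ob E y)"
    note \<xi>f = dual_E_in[OF x x' f \<xi>]
    note p = pure_arr[OF y x' \<xi> m]
    have "theta y x (dual_map K (Hom \<X> y x) (Hom \<X> y x') (\<lambda>h. cmp \<X> y x x' f h) (matrix_form y x' \<xi> m))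
        = pure_arr y x (\<lambda>u\<in>carrier (ob E x). \<xi> (mor E x x' f u)) m"
      by (simp only: dm(2)[OF matrix_form_in[OF y x' \<xi> m]] matrix_form_pull[OF y x x' f m] theta_matrix_form[OF y x \<xi>f m])
    also have "\<dots> = cmp \<X> x x' (N0 y) (pure_arr y x' \<xi> m) f"
      by (rule pure_arr_eqI[OF y x \<xi>f m cmp_closed[OF x x' n f p(1)]])
        (simp only: E_cmp[OF x x' n f p(1)] p(2) E_in[OF x x' f] coeff_E[OF x x' f])
    finally show "theta y x (dual_map K (Hom \<X> y x) (Hom \<X> y x') (\<lambda>h. cmp \<X> y x x' f h) (matrix_form y x' \<xi> m))
        = cmp \<X> x x' (N0 y) (theta y x' (matrix_form y x' \<xi> m)) f"
      by (simp only: theta_matrix_form[OF y x' \<xi> m])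
  qed
  then show "theta y x (\<lambda>h\<in>arr \<X> y x. \<zeta> (cmp \<X> y x x' f h)) = cmp \<X> x x' (N0 y) (theta y x' \<zeta>) f"
    by (simp only: dm(2)[OF z])
qed

text \<open>
  A family \<open>\<Theta>'\<close> is recovered from its component at the injective cogenerator \<open>A\<^sup>*\<close>, where
  \<open>Hom(y, A\<^sup>*)\<^sup>* = y\<close>.
\<close>

lemma universal_family_theta:
  assumes y: "y \<in> Obj \<X>"
  shows "universal_family K \<X> y (N0 y) (theta y)"
proof -
  note n = N0[OF y]
  interpret fd_algebra K A by (rule algebra)
  interpret Y: coregular_tensor K A "ob E y" using ct[OF y] .
  \<comment> \<open>J stands for A^* inside the category; j and its inverse j' translate between the
    two.\<close>
  obtain J j where J: "J \<in> Obj \<X>" and j: "j \<in> lmod_iso K A (ob E J) (coregular_lmod K A)"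
    using E_dense[OF fd_lmodule_coregular] by blast
  interpret J: coregular_tensor K A "ob E J" using ct[OF J] .
  have jh: "j \<in> lmod_hom K A (ob E J) (coregular_lmod K A)" and jb: "bij_betw j (carrier (ob E J)) (carrier (dual K A))"
    using j by (auto simp: lmod_iso_def coregular_lmod_simps)
  define j' where "j' = inv_into (carrier (ob E J)) j"
  have j'h: "j' \<in> module_hom K (dual K A) (ob E J)"
    using module_hom_inv_into[OF J.M.vectorspace lmod_homD(1)[OF jh]] jb
    by (simp add: coregular_lmod_simps(1) j'_def)
  have j'in: "j' \<phi> \<in> carrier (ob E J)" and jj': "j (j' \<phi>) = \<phi>" if "\<phi> \<in> carrier (dual K A)" for \<phi>
    using that jb by (auto simp: j'_def bij_betw_def inv_into_into f_inv_into_f)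
  have j'j: "j' (j u) = u" if "u \<in> carrier (ob E J)" for u
    using that jb by (simp add: j'_def bij_betw_def)
  have jin: "j u \<in> carrier (dual K A)" if "u \<in> carrier (ob E J)" for u
    using lmod_homD(4)[OF jh that] by (simp add: coregular_lmod_simps)
  have jl: "j (lact (ob E J) a u) = blact (coregular K A) a (j u)" if "a \<in> carrier A" "u \<in> carrier (ob E J)" for a u
    using lmod_homD(3)[OF jh that] by (simp add: coregular_lmod_simps)
  have j'l: "j' (blact (coregular K A) a \<phi>) = lact (ob E J) a (j' \<phi>)" if "a \<in> carrier A" "\<phi> \<in> carrier (dual K A)" for a \<phi>
    using jl[OF that(1) j'in[OF that(2)]] j'j[OF J.M.lact_closed[OF that(1) j'in[OF that(2)]]] jj'[OF that(2)] by simp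
  \<comment> \<open>Evaluation at 1 on A^*, transported to J. The assignment h -> \<epsilon> h
    identifies Hom(y, J) with the dual of y.\<close>
  define \<epsilon> where "\<epsilon> = (\<lambda>u\<in>carrier (ob E J). j u \<one>\<^bsub>A\<^esub>)"
  have \<epsilon>: "\<epsilon> \<in> carrier (dual K (ob E J))"
    unfolding \<epsilon>_def using module_hom_compose[OF _ linear_form_eval[OF J.one_in], of j K "ob E J"] lmod_homD(1)[OF jh]
    by (intro dual_restrictI J.M.vectorspace) simp
  \<comment> \<open>Up to j, the coefficient map of evaluation at 1 is the identity of A^*: acting
    with a on a form and evaluating at 1 gives its value at a.\<close>
  have cf_\<epsilon>: "cf J \<epsilon> u = j u" if u: "u \<in> carrier (ob E J)" for u
  proof (rule dual_eqI[OF J.coeff_in[OF \<epsilon> u] jin[OF u]])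
    interpret ring A by (rule ring)
    fix a assume a: "a \<in> carrier A"
    show "cf J \<epsilon> u a = j u a"
      using a u by (simp add: J.coeff_def \<epsilon>_def J.M.lact_closed jl coregular_app)
  qed
  \<comment> \<open>Every pure tensor \<phi> \<otimes> m is the value at j' \<phi> of the morphism
    \<open>pure_arr y J \<epsilon> m\<close>, so the component at J alone determines a morphism out
    of \<open>N0 y\<close>.\<close>
  have unique: "u = v" if d: "d \<in> Obj \<X>" and u: "u \<in> arr \<X> (N0 y) d" and v: "v \<in> arr \<X> (N0 y) d"
    and eq: "\<And>\<zeta>. \<zeta> \<in> carrier (dual K (Hom \<X> y J)) \<Longrightarrow>
      cmp \<X> J (N0 y) d u (theta y J \<zeta>) = cmp \<X> J (N0 y) d v (theta y J \<zeta>)" for d u v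
  proof (rule E_eqI[OF n d u v])
    let ?t = "inv_into (carrier (ob E (N0 y))) (\<tau> y)"
    note t = module_hom_inv_into[OF E_vs[OF n] lmod_homD(1)[OF \<tau>_hom[OF y]] \<tau>_bij[OF y]]
    fix z assume z: "z \<in> carrier (ob E (N0 y))"
    have "mor E (N0 y) d u (?t (\<tau> y z)) = mor E (N0 y) d v (?t (\<tau> y z))"
    proof (rule Y.TM_eqI[OF E_vs[OF d] module_hom_compose[OF t lmod_homD(1)[OF E_hom[OF n d u]]]
          module_hom_compose[OF t lmod_homD(1)[OF E_hom[OF n d v]]] _ lmod_homD(4)[OF \<tau>_hom[OF y] z]])
      fix \<phi> m assume p: "\<phi> \<in> carrier (dual K A)" and m: "m \<in> carrier (ob E y)"
      note q = pure_arr[OF y J \<epsilon> m]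
      have "\<tau> y (mor E J (N0 y) (pure_arr y J \<epsilon> m) (j' \<phi>)) = pt y \<phi> m"
        by (simp only: q(2)[OF j'in[OF p]] cf_\<epsilon>[OF j'in[OF p]] jj'[OF p])
      then have tp: "?t (pt y \<phi> m) = mor E J (N0 y) (pure_arr y J \<epsilon> m) (j' \<phi>)"
        using \<tau>_bij[OF y] E_in[OF J n q(1) j'in[OF p]] by (auto simp: bij_betw_def intro: inv_into_f_eq)
      have "cmp \<X> J (N0 y) d u (pure_arr y J \<epsilon> m) = cmp \<X> J (N0 y) d v (pure_arr y J \<epsilon> m)"
        using eq[OF matrix_form_in[OF y J \<epsilon> m]] by (simp only: theta_matrix_form[OF y J \<epsilon> m])
      then show "mor E (N0 y) d u (?t (pt y \<phi> m)) = mor E (N0 y) d v (?t (pt y \<phi> m))"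
        by (simp only: tp E_cmp[OF J n d q(1) u j'in[OF p], symmetric] E_cmp[OF J n d q(1) v j'in[OF p], symmetric])
    qed
    then show "mor E (N0 y) d u z = mor E (N0 y) d v z" using \<tau>_bij[OF y] z by (simp add: bij_betw_def)
  qed
  have exists: "\<exists>u. u \<in> arr \<X> (N0 y) d \<and> (\<forall>x\<in>Obj \<X>. \<forall>\<zeta>\<in>carrier (dual K (Hom \<X> y x)).
          cmp \<X> x (N0 y) d u (theta y x \<zeta>) = \<Theta> x \<zeta>)"
    if d: "d \<in> Obj \<X>" and fam: "dual_family K \<X> y d \<Theta>" for d \<Theta>
  proof -
    \<comment> \<open>The functional h -> h(m)(1) on Hom(y, J), by which m enters the dual of this
      Hom-space.\<close>
    define e where "e m = matrix_form y J \<epsilon> m" for m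
    have e: "e m \<in> carrier (dual K (Hom \<X> y J))" if "m \<in> carrier (ob E y)" for m
      unfolding e_def by (rule matrix_form_in[OF y J \<epsilon> that])
    note \<Theta>J = dual_familyD[OF fam J]
    \<comment> \<open>For every m the component of the family at J gives a morphism J -> d; b
      evaluates it at \<phi> and is to become the map out of A^* \<otimes> y.\<close>
    define b where "b \<phi> m = mor E J d (\<Theta> J (e m)) (j' \<phi>)" for \<phi> m
    have bl: "(\<lambda>\<phi>. b \<phi> m) \<in> module_hom K (dual K A) (ob E d)" if "m \<in> carrier (ob E y)" for m
      unfolding b_def by (rule module_hom_compose[OF j'h lmod_homD(1)[OF E_hom[OF J d \<Theta>J(2)[OF e[OF that]]]]])
    have br: "b \<phi> \<in> module_hom K (ob E y) (ob E d)" if p: "\<phi> \<in> carrier (dual K A)" for \<phi>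
    proof -
      have h: "(\<lambda>m. \<Theta> J (e m)) \<in> module_hom K (ob E y) (Hom \<X> J d)"
        unfolding e_def by (rule module_hom_compose[OF matrix_form_hom[OF y J \<epsilon>] \<Theta>J(1)])
      have "(\<lambda>f. mor E J d f (j' \<phi>)) \<in> module_hom K (Hom \<X> J d) (ob E d)"
        by (rule module_homI) (simp_all add: E_in E_add E_smult J d j'in[OF p])
      from module_hom_compose[OF h this] show ?thesis unfolding b_def .
    qed
    have bal: "b (ract (coregular K A) \<phi> a) m = b \<phi> (lact (ob E y) a m)"
      if p: "\<phi> \<in> carrier (dual K A)" and a: "a \<in> carrier A" and m: "m \<in> carrier (ob E y)" for \<phi> a m
    proof -
      interpret ring A by (rule ring)
      have g1: "(\<lambda>u. ract (coregular K A) (j u) a) \<in> module_hom K (ob E J) (coregular_lmod K A)"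
        using module_hom_compose[OF _ coregular_ract_hom[OF a], of j "ob E J"] lmod_homD(1)[OF jh] by simp
      have g2: "ract (coregular K A) (j (lact (ob E J) c u)) a = lact (coregular_lmod K A) c (ract (coregular K A) (j u) a)"
        if "c \<in> carrier A" "u \<in> carrier (ob E J)" for c u
        by (simp only: jl[OF that] coregular_lmod_simps(5) coregular_bimodule[OF jin[OF that(2)] that(1) a])
      \<comment> \<open>The right action of a is an A-linear endomorphism of A^*, realized by r.
        Pulling e m back along r gives e (a m), so naturality of \<Theta> along r is the balancing
        relation.\<close>
      obtain r where r: "r \<in> arr \<X> J J" "\<And>u. u \<in> carrier (ob E J) \<Longrightarrow> j (mor E J J r u) = ract (coregular K A) (j u) a"
        using E_iso_lift[OF J J fd_lmodule_coregular j g1 g2] by blast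
      have "e (lact (ob E y) a m) = (\<lambda>h\<in>arr \<X> y J. e m (cmp \<X> y J J r h))"
        unfolding e_def matrix_form_pull[OF y J J r(1) m] unfolding matrix_form_def
      proof (intro restrict_ext)
        fix h assume h: "h \<in> arr \<X> y J"
        note hm = E_in[OF y J h m]
        show "\<epsilon> (mor E y J h (lact (ob E y) a m)) = (\<lambda>u\<in>carrier (ob E J). \<epsilon> (mor E J J r u)) (mor E y J h m)"
          using hm a by (simp add: lmod_homD(3)[OF E_hom[OF y J h] a m] \<epsilon>_def J.M.lact_closed E_in[OF J J r(1)] r(2) jl
              coregular_app)
      qed
      then have "\<Theta> J (e (lact (ob E y) a m)) = cmp \<X> J J d (\<Theta> J (e m)) r"
        using \<Theta>J(3)[OF J r(1) e[OF m]] by simp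
      moreover have "mor E J J r (j' \<phi>) = j' (ract (coregular K A) \<phi> a)"
        using r(2)[OF j'in[OF p]] jj'[OF p] j'j[OF E_in[OF J J r(1) j'in[OF p]]] by simp
      ultimately show ?thesis
        by (simp only: b_def E_cmp[OF J J d r(1) \<Theta>J(2)[OF e[OF m]] j'in[OF p]])
    qed
    have beq: "b (blact (coregular K A) a \<phi>) m = lact (ob E d) a (b \<phi> m)"
      if p: "\<phi> \<in> carrier (dual K A)" and a: "a \<in> carrier A" and m: "m \<in> carrier (ob E y)" for \<phi> a m
      by (simp only: b_def j'l[OF a p] lmod_homD(3)[OF E_hom[OF J d \<Theta>J(2)[OF e[OF m]]] a j'in[OF p]])
    obtain h where h: "h \<in> module_hom K (T y) (ob E d)"
      "\<And>a t. a \<in> carrier A \<Longrightarrow> t \<in> carrier (T y) \<Longrightarrow> h (lact (T y) a t) = lact (ob E d) a (h t)"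
      "\<And>\<phi> m. \<phi> \<in> carrier (dual K A) \<Longrightarrow> m \<in> carrier (ob E y) \<Longrightarrow> h (pt y \<phi> m) = b \<phi> m"
      by (rule Y.TM_lift[OF ob_E[OF d] bl br bal beq]) blast+
    have g2: "h (\<tau> y (lact (ob E (N0 y)) a z)) = lact (ob E d) a (h (\<tau> y z))"
      if "a \<in> carrier A" "z \<in> carrier (ob E (N0 y))" for a z
      by (simp only: lmod_homD(3)[OF \<tau>_hom[OF y] that] h(2)[OF that(1) lmod_homD(4)[OF \<tau>_hom[OF y] that(2)]])
    obtain u where u: "u \<in> arr \<X> (N0 y) d" "\<And>z. z \<in> carrier (ob E (N0 y)) \<Longrightarrow> mor E (N0 y) d u z = h (\<tau> y z)"
      using E_full[OF n d module_hom_compose[OF lmod_homD(1)[OF \<tau>_hom[OF y]] h(1)] g2] by blast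
    have "cmp \<X> x (N0 y) d u (theta y x \<zeta>) = \<Theta> x \<zeta>"
      if x: "x \<in> Obj \<X>" and z: "\<zeta> \<in> carrier (dual K (Hom \<X> y x))" for x \<zeta>
    proof (rule dual_Hom_eqI[OF y x Hom_vectorspace[OF x d] fin_dim_Hom[OF x d]
          module_hom_compose[OF theta_hom[OF y x] postcomp_linear[OF x n d u(1)]] dual_familyD(1)[OF fam x] _ z])
      interpret X: coregular_tensor K A "ob E x" using ct[OF x] .
      fix \<xi> m assume \<xi>: "\<xi> \<in> carrier (dual K (ob E x))" and m: "m \<in> carrier (ob E y)"
      note q = pure_arr[OF y x \<xi> m]
      have c1: "cf x \<xi> \<in> module_hom K (ob E x) (coregular_lmod K A)" using X.coeff_hom_right[OF \<xi>] by simp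
      have c2: "cf x \<xi> (lact (ob E x) a w) = lact (coregular_lmod K A) a (cf x \<xi> w)"
        if "a \<in> carrier A" "w \<in> carrier (ob E x)" for a w
        by (simp only: X.coeff_lact[OF that(2,1)] coregular_lmod_simps(5))
      \<comment> \<open>The morphism x -> J realizing w -> \<xi>(- w). Since \<xi>(- w) has value
        \<xi> w at 1, pulling e m back along F gives the matrix coefficient of \<xi> and m;
        naturality along F then reduces the component at x to the one at J.\<close>
      obtain F where F: "F \<in> arr \<X> x J" "\<And>w. w \<in> carrier (ob E x) \<Longrightarrow> j (mor E x J F w) = cf x \<xi> w"
        using E_iso_lift[OF x J fd_lmodule_coregular j c1 c2] by blast
      have "(\<lambda>h\<in>arr \<X> y x. e m (cmp \<X> y x J F h)) = matrix_form y x \<xi> m"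
        unfolding e_def matrix_form_pull[OF y x J F(1) m] unfolding matrix_form_def
      proof (intro restrict_ext)
        fix h assume h: "h \<in> arr \<X> y x"
        note hm = E_in[OF y x h m]
        show "(\<lambda>u\<in>carrier (ob E x). \<epsilon> (mor E x J F u)) (mor E y x h m) = \<xi> (mor E y x h m)"
          using hm by (simp add: \<epsilon>_def E_in[OF x J F(1)] F(2) X.coeff_one)
      qed
      then have \<Theta>x: "\<Theta> x (matrix_form y x \<xi> m) = cmp \<X> x J d (\<Theta> J (e m)) F"
        using dual_familyD(3)[OF fam x J F(1) e[OF m]] by simp
      have "cmp \<X> x (N0 y) d u (pure_arr y x \<xi> m) = cmp \<X> x J d (\<Theta> J (e m)) F"
      proof (rule E_eqI[OF x d cmp_closed[OF x n d q(1) u(1)] cmp_closed[OF x J d F(1) \<Theta>J(2)[OF e[OF m]]]])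
        fix w assume w: "w \<in> carrier (ob E x)"
        have "j' (cf x \<xi> w) = mor E x J F w" using F(2)[OF w] j'j[OF E_in[OF x J F(1) w]] by simp
        then show "mor E x d (cmp \<X> x (N0 y) d u (pure_arr y x \<xi> m)) w = mor E x d (cmp \<X> x J d (\<Theta> J (e m)) F) w"
          by (simp only: E_cmp[OF x n d q(1) u(1) w] E_cmp[OF x J d F(1) \<Theta>J(2)[OF e[OF m]] w] u(2)[OF E_in[OF x n q(1) w]]
              q(2)[OF w] h(3)[OF X.coeff_in[OF \<xi> w] m] b_def)
      qed
      then show "cmp \<X> x (N0 y) d u (theta y x (matrix_form y x \<xi> m)) = \<Theta> x (matrix_form y x \<xi> m)"
        by (simp only: theta_matrix_form[OF y x \<xi> m] \<Theta>x)
    qed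
    then show ?thesis using u(1) by blast
  qed
  show ?thesis
    unfolding universal_family_def
  proof (intro conjI n dual_family_theta[OF y] ballI allI impI)
    fix d \<Theta> assume d: "d \<in> Obj \<X>" and fam: "dual_family K \<X> y d \<Theta>"
    show "\<exists>!u. u \<in> arr \<X> (N0 y) d \<and> (\<forall>x\<in>Obj \<X>. \<forall>\<zeta>\<in>carrier (dual K (Hom \<X> y x)).
          cmp \<X> x (N0 y) d u (theta y x \<zeta>) = \<Theta> x \<zeta>)"
    proof (rule ex_ex1I[OF exists[OF d fam]])
      fix u v
      assume u: "u \<in> arr \<X> (N0 y) d \<and> (\<forall>x\<in>Obj \<X>. \<forall>\<zeta>\<in>carrier (dual K (Hom \<X> y x)). cmp \<X> x (N0 y) d u (theta y x \<zeta>) = \<Theta> x \<zeta>)"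
        and v: "v \<in> arr \<X> (N0 y) d \<and> (\<forall>x\<in>Obj \<X>. \<forall>\<zeta>\<in>carrier (dual K (Hom \<X> y x)). cmp \<X> x (N0 y) d v (theta y x \<zeta>) = \<Theta> x \<zeta>)"
      show "u = v" by (rule unique[OF d]) (use u v J in simp_all)
    qed
  qed
qed

section \<open>The functor \<open>N0_functor\<close> and its comparison with the tensor
  functor\<close>

abbreviation Tm where "Tm y y' k \<equiv> coregular_tensor_map K A (ob E y) (ob E y') (mor E y y' k)"

lemma T_map:
  assumes "y \<in> Obj \<X>" "y' \<in> Obj \<X>" "k \<in> arr \<X> y y'"
  shows "Tm y y' k \<in> lmod_hom K A (T y) (T y')"
    and "\<And>\<phi> m. \<phi> \<in> carrier (dual K A) \<Longrightarrow> m \<in> carrier (ob E y) \<Longrightarrow>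
      Tm y y' k (pt y \<phi> m) = pt y' \<phi> (mor E y y' k m)"
  using coregular_tensor_map_characterization[OF algebra ob_E[OF assms(1)] ob_E[OF assms(2)] E_hom[OF assms]] by auto

definition N0_mor :: "'o \<Rightarrow> 'o \<Rightarrow> 'm \<Rightarrow> 'm"
  where "N0_mor y y' k = (SOME q. q \<in> arr \<X> (N0 y) (N0 y') \<and> (\<forall>z\<in>carrier (ob E (N0 y)).
    \<tau> y' (mor E (N0 y) (N0 y') q z) = Tm y y' k (\<tau> y z)))"

lemma N0_mor:
  assumes y: "y \<in> Obj \<X>" and y': "y' \<in> Obj \<X>" and k: "k \<in> arr \<X> y y'"
  shows "N0_mor y y' k \<in> arr \<X> (N0 y) (N0 y')"
    and "\<And>z. z \<in> carrier (ob E (N0 y)) \<Longrightarrow> \<tau> y' (mor E (N0 y) (N0 y') (N0_mor y y' k) z)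
      = Tm y y' k (\<tau> y z)"
proof -
  note t = T_map(1)[OF y y' k]
  let ?Q = "\<lambda>q. q \<in> arr \<X> (N0 y) (N0 y') \<and> (\<forall>z\<in>carrier (ob E (N0 y)).
    \<tau> y' (mor E (N0 y) (N0 y') q z) = Tm y y' k (\<tau> y z))"
  have g2: "Tm y y' k (\<tau> y (lact (ob E (N0 y)) a z))
      = lact (T y') a (Tm y y' k (\<tau> y z))"
    if "a \<in> carrier A" "z \<in> carrier (ob E (N0 y))" for a z
    by (simp only: lmod_homD(3)[OF \<tau>_hom[OF y] that] lmod_homD(3)[OF t that(1) lmod_homD(4)[OF \<tau>_hom[OF y] that(2)]])
  obtain q where q: "?Q q"
    by (rule E_iso_lift[OF N0[OF y] N0[OF y'] T_mod[OF y'] \<tau>[OF y']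
          module_hom_compose[OF lmod_homD(1)[OF \<tau>_hom[OF y]] lmod_homD(1)[OF t]] g2]) blast+
  have "?Q (N0_mor y y' k)" unfolding N0_mor_def by (rule someI[of ?Q, OF q])
  then show "N0_mor y y' k \<in> arr \<X> (N0 y) (N0 y')"
    and "\<And>z. z \<in> carrier (ob E (N0 y)) \<Longrightarrow> \<tau> y' (mor E (N0 y) (N0 y') (N0_mor y y' k) z)
      = Tm y y' k (\<tau> y z)" by auto
qed

text \<open>The source of the functor laws: a candidate q is recognised by any linear map g that it
  realizes and that has the right values on pure tensors.\<close>

lemma N0_mor_eqI:
  assumes y: "y \<in> Obj \<X>" and y': "y' \<in> Obj \<X>" and k: "k \<in> arr \<X> y y'" and q: "q \<in> arr \<X> (N0 y) (N0 y')"
    and g: "g \<in> module_hom K (T y) (T y')"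
    and \<tau>q: "\<And>z. z \<in> carrier (ob E (N0 y)) \<Longrightarrow> \<tau> y' (mor E (N0 y) (N0 y') q z) = g (\<tau> y z)"
    and pt: "\<And>\<phi> m. \<phi> \<in> carrier (dual K A) \<Longrightarrow> m \<in> carrier (ob E y) \<Longrightarrow> g (pt y \<phi> m) = pt y' \<phi> (mor E y y' k m)"
  shows "N0_mor y y' k = q"
proof (rule E_iso_eqI[OF N0[OF y] N0[OF y'] \<tau>[OF y'] N0_mor(1)[OF y y' k] q])
  interpret Y: coregular_tensor K A "ob E y" using ct[OF y] .
  interpret Y': coregular_tensor K A "ob E y'" using ct[OF y'] .
  fix z assume z: "z \<in> carrier (ob E (N0 y))"
  have "Tm y y' k (\<tau> y z) = g (\<tau> y z)"
    by (rule Y.TM_eqI[OF Y'.vectorspace_TM lmod_homD(1)[OF T_map(1)[OF y y' k]] g _ lmod_homD(4)[OF \<tau>_hom[OF y] z]])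
      (simp only: T_map(2)[OF y y' k] pt)
  then show "\<tau> y' (mor E (N0 y) (N0 y') (N0_mor y y' k) z) = \<tau> y' (mor E (N0 y) (N0 y') q z)"
    by (simp only: N0_mor(2)[OF y y' k z] \<tau>q[OF z])
qed

definition N0_functor :: "('o, 'm, 'o, 'm) functr"
  where "N0_functor = \<lparr>ob = N0, mor = N0_mor\<rparr>"

lemma linear_functor_N0: "linear_functor K \<X> \<X> N0_functor"
proof
  show "ob N0_functor y \<in> Obj \<X>" if "y \<in> Obj \<X>" for y using N0[OF that] by (simp add: N0_functor_def)
next
  fix y y' assume y: "y \<in> Obj \<X>" and y': "y' \<in> Obj \<X>"
  interpret Y: coregular_tensor K A "ob E y" using ct[OF y] .
  interpret Y': coregular_tensor K A "ob E y'" using ct[OF y'] .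
  note H = Hom_vectorspace[OF y y'] and H' = Hom_vectorspace[OF N0[OF y] N0[OF y']]
  note t = lmod_homD(1)[OF T_map(1)[OF y y']]
  have "N0_mor y y' \<in> module_hom K (Hom \<X> y y') (Hom \<X> (N0 y) (N0 y'))"
  proof (rule module_homI)
    fix k assume k: "k \<in> arr \<X> y y'"
    show "N0_mor y y' k \<in> arr \<X> (N0 y) (N0 y')" by (rule N0_mor(1)[OF y y' k])
    fix l assume l: "l \<in> arr \<X> y y'"
    show "N0_mor y y' (k \<oplus>\<^bsub>Hom \<X> y y'\<^esub> l) = N0_mor y y' k \<oplus>\<^bsub>Hom \<X> (N0 y) (N0 y')\<^esub> N0_mor y y' l"
    proof (rule N0_mor_eqI[OF y y' vectorspace_add[OF H k l] vectorspace_add[OF H' N0_mor(1)[OF y y' k] N0_mor(1)[OF y y' l]]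
          module_hom_pointwise_add[OF Y'.vectorspace_TM t[OF k] t[OF l]]])
      fix z assume z: "z \<in> carrier (ob E (N0 y))"
      show "\<tau> y' (mor E (N0 y) (N0 y') (N0_mor y y' k \<oplus>\<^bsub>Hom \<X> (N0 y) (N0 y')\<^esub> N0_mor y y' l) z)
        = Tm y y' k (\<tau> y z)
          \<oplus>\<^bsub>T y'\<^esub> Tm y y' l (\<tau> y z)"
        by (simp only: \<tau>_add[OF y' N0[OF y] N0_mor(1)[OF y y' k] N0_mor(1)[OF y y' l] z] N0_mor(2)[OF y y' k z] N0_mor(2)[OF y y' l z])
    next
      fix \<phi> m assume p: "\<phi> \<in> carrier (dual K A)" and m: "m \<in> carrier (ob E y)"
      show "Tm y y' k (pt y \<phi> m)
          \<oplus>\<^bsub>T y'\<^esub> Tm y y' l (pt y \<phi> m)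
        = pt y' \<phi> (mor E y y' (k \<oplus>\<^bsub>Hom \<X> y y'\<^esub> l) m)"
        by (simp only: T_map(2)[OF y y' k p m] T_map(2)[OF y y' l p m] E_add[OF y y' k l m]
            module_hom_add[OF Y'.pt_hom_right[OF p] E_in[OF y y' k m] E_in[OF y y' l m]])
    qed
  next
    fix c k assume c: "c \<in> carrier K" and k: "k \<in> arr \<X> y y'"
    show "N0_mor y y' (c \<odot>\<^bsub>Hom \<X> y y'\<^esub> k) = c \<odot>\<^bsub>Hom \<X> (N0 y) (N0 y')\<^esub> N0_mor y y' k"
    proof (rule N0_mor_eqI[OF y y' vectorspace_smult[OF H c k] vectorspace_smult[OF H' c N0_mor(1)[OF y y' k]]
          module_hom_pointwise_smult[OF Y'.vectorspace_TM t[OF k] c]])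
      fix z assume z: "z \<in> carrier (ob E (N0 y))"
      show "\<tau> y' (mor E (N0 y) (N0 y') (c \<odot>\<^bsub>Hom \<X> (N0 y) (N0 y')\<^esub> N0_mor y y' k) z)
        = c \<odot>\<^bsub>T y'\<^esub> Tm y y' k (\<tau> y z)"
        by (simp only: \<tau>_smult[OF y' N0[OF y] N0_mor(1)[OF y y' k] c z] N0_mor(2)[OF y y' k z])
    next
      fix \<phi> m assume p: "\<phi> \<in> carrier (dual K A)" and m: "m \<in> carrier (ob E y)"
      show "c \<odot>\<^bsub>T y'\<^esub> Tm y y' k (pt y \<phi> m)
        = pt y' \<phi> (mor E y y' (c \<odot>\<^bsub>Hom \<X> y y'\<^esub> k) m)"
        by (simp only: T_map(2)[OF y y' k p m] E_smult[OF y y' k c m]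
            module_hom_smult[OF Y'.pt_hom_right[OF p] c E_in[OF y y' k m]])
    qed
  qed
  then show "mor N0_functor y y' \<in> module_hom K (Hom \<X> y y') (Hom \<X> (ob N0_functor y) (ob N0_functor y'))"
    by (simp add: N0_functor_def)
next
  fix y assume y: "y \<in> Obj \<X>"
  have "N0_mor y y (idt \<X> y) = idt \<X> (N0 y)"
    by (rule N0_mor_eqI[OF y y idt_arr[OF y] idt_arr[OF N0[OF y]] module_hom_id])
      (simp_all add: E_idt y N0)
  then show "mor N0_functor y y (idt \<X> y) = idt \<X> (ob N0_functor y)" by (simp add: N0_functor_def)
next
  fix y y' y'' k l assume y: "y \<in> Obj \<X>" and y': "y' \<in> Obj \<X>" and y'': "y'' \<in> Obj \<X>"
    and k: "k \<in> arr \<X> y y'" and l: "l \<in> arr \<X> y' y''"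
  note n = N0[OF y] and n' = N0[OF y'] and n'' = N0[OF y'']
  note mk = N0_mor[OF y y' k] and ml = N0_mor[OF y' y'' l]
  have "N0_mor y y'' (cmp \<X> y y' y'' l k) = cmp \<X> (N0 y) (N0 y') (N0 y'') (N0_mor y' y'' l) (N0_mor y y' k)"
  proof (rule N0_mor_eqI[OF y y'' cmp_closed[OF y y' y'' k l] cmp_closed[OF n n' n'' mk(1) ml(1)]
        module_hom_compose[OF lmod_homD(1)[OF T_map(1)[OF y y' k]] lmod_homD(1)[OF T_map(1)[OF y' y'' l]]]])
    fix z assume z: "z \<in> carrier (ob E (N0 y))"
    show "\<tau> y'' (mor E (N0 y) (N0 y'') (cmp \<X> (N0 y) (N0 y') (N0 y'') (N0_mor y' y'' l) (N0_mor y y' k)) z)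
      = Tm y' y'' l
          (Tm y y' k (\<tau> y z))"
      by (simp only: E_cmp[OF n n' n'' mk(1) ml(1) z] ml(2)[OF E_in[OF n n' mk(1) z]] mk(2)[OF z])
  next
    fix \<phi> m assume p: "\<phi> \<in> carrier (dual K A)" and m: "m \<in> carrier (ob E y)"
    show "Tm y' y'' l
          (Tm y y' k (pt y \<phi> m))
      = pt y'' \<phi> (mor E y y'' (cmp \<X> y y' y'' l k) m)"
      by (simp only: T_map(2)[OF y y' k p m] T_map(2)[OF y' y'' l p E_in[OF y y' k m]] E_cmp[OF y y' y'' k l m])
  qed
  then show "mor N0_functor y y'' (cmp \<X> y y' y'' l k)
      = cmp \<X> (ob N0_functor y) (ob N0_functor y') (ob N0_functor y'') (mor N0_functor y' y'' l) (mor N0_functor y y' k)"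
    by (simp add: N0_functor_def)
qed

text \<open>By linearity in \<zeta> only matrix coefficients matter. There both sides are the
  \<open>pure_arr\<close> of \<xi> and the image of m under k, because A^* \<otimes> E k acts on the
  right factor alone.\<close>

lemma family_functor_N0: "family_functor K \<X> N0_functor theta"
  unfolding family_functor_def
proof (intro conjI linear_functor_N0 ballI)
  fix y assume y: "y \<in> Obj \<X>"
  note n = N0[OF y]
  show "universal_family K \<X> y (ob N0_functor y) (theta y)"
    using universal_family_theta[OF y] by (simp add: N0_functor_def)
  fix y' k x \<zeta> assume y': "y' \<in> Obj \<X>" and k: "k \<in> arr \<X> y y'" and x: "x \<in> Obj \<X>"
    and z: "\<zeta> \<in> carrier (dual K (Hom \<X> y x))"
  note n' = N0[OF y'] and mk = N0_mor[OF y y' k]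
  note dm = dual_map_hom[OF Hom_vectorspace[OF y' x] Hom_vectorspace[OF y x] precomp_linear[OF y y' x k]]
  have "cmp \<X> x (N0 y) (N0 y') (N0_mor y y' k) (theta y x \<zeta>)
      = theta y' x (dual_map K (Hom \<X> y' x) (Hom \<X> y x) (\<lambda>h. cmp \<X> y y' x h k) \<zeta>)"
  proof (rule dual_Hom_eqI[OF y x Hom_vectorspace[OF x n'] fin_dim_Hom[OF x n']
        module_hom_compose[OF theta_hom[OF y x] postcomp_linear[OF x n n' mk(1)]] module_hom_compose[OF dm(1) theta_hom[OF y' x]] _ z])
    interpret X: coregular_tensor K A "ob E x" using ct[OF x] .
    fix \<xi> m assume \<xi>: "\<xi> \<in> carrier (dual K (ob E x))" and m: "m \<in> carrier (ob E y)"
    note km = E_in[OF y y' k m]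
    note p = pure_arr[OF y x \<xi> m]
    have "pure_arr y' x \<xi> (mor E y y' k m) = cmp \<X> x (N0 y) (N0 y') (N0_mor y y' k) (pure_arr y x \<xi> m)"
      by (rule pure_arr_eqI[OF y' x \<xi> km cmp_closed[OF x n n' p(1) mk(1)]])
        (simp only: E_cmp[OF x n n' p(1) mk(1)] mk(2)[OF E_in[OF x n p(1)]] p(2) T_map(2)[OF y y' k X.coeff_in[OF \<xi>] m])
    then show "cmp \<X> x (N0 y) (N0 y') (N0_mor y y' k) (theta y x (matrix_form y x \<xi> m))
      = theta y' x (dual_map K (Hom \<X> y' x) (Hom \<X> y x) (\<lambda>h. cmp \<X> y y' x h k) (matrix_form y x \<xi> m))"
      by (simp only: theta_matrix_form[OF y x \<xi> m] dm(2)[OF matrix_form_in[OF y x \<xi> m]] matrix_form_push[OF y y' x k m]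
          theta_matrix_form[OF y' x \<xi> km])
  qed
  then show "cmp \<X> x (ob N0_functor y) (ob N0_functor y') (mor N0_functor y y' k) (theta y x \<zeta>)
      = theta y' x (\<lambda>h\<in>arr \<X> y' x. \<zeta> (cmp \<X> y y' x h k))"
    by (simp add: N0_functor_def dm(2)[OF z])
qed

text \<open>With \<theta> the given isomorphism to \<open>N0_functor\<close>, the components are
  \<open>\<tau>\<close> after E \<theta>: naturality of \<theta> handles N, and
  \<open>N0_mor\<close> was chosen so that \<open>\<tau>\<close> intertwines it with the tensor
  functor.\<close>

lemma naturally_isomorphic_tensor:
  assumes N: "linear_functor K \<X> \<X> N" and iso: "naturally_isomorphic \<X> \<X> N N0_functor"
  shows "mod_naturally_isomorphic K A \<X> (comp_functor E N)
    (comp_functor (tensor_functor K A (coregular K A)) E)"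
proof -
  interpret N: linear_functor K \<X> \<X> N by fact
  obtain \<theta> where \<theta>: "\<And>y. y \<in> Obj \<X> \<Longrightarrow> \<theta> y \<in> iso_arr \<X> (ob N y) (N0 y)"
    "\<And>y y' k. y \<in> Obj \<X> \<Longrightarrow> y' \<in> Obj \<X> \<Longrightarrow> k \<in> arr \<X> y y' \<Longrightarrow>
      cmp \<X> (ob N y) (ob N y') (N0 y') (\<theta> y') (mor N y y' k) = cmp \<X> (ob N y) (N0 y) (N0 y') (N0_mor y y' k) (\<theta> y)"
    using iso unfolding naturally_isomorphic_def N0_functor_def by simp blast
  have \<theta>a: "\<theta> y \<in> arr \<X> (ob N y) (N0 y)" if "y \<in> Obj \<X>" for y using \<theta>(1)[OF that] by (simp add: iso_arr_def)
  have E\<theta>: "mor E (ob N y) (N0 y) (\<theta> y) \<in> lmod_iso K A (ob E (ob N y)) (ob E (N0 y))" if y: "y \<in> Obj \<X>" for y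
  proof -
    note m = N.ob_closed[OF y] and n = N0[OF y]
    obtain g where g: "g \<in> arr \<X> (N0 y) (ob N y)"
      "cmp \<X> (ob N y) (N0 y) (ob N y) g (\<theta> y) = idt \<X> (ob N y)" "cmp \<X> (N0 y) (ob N y) (N0 y) (\<theta> y) g = idt \<X> (N0 y)"
      using \<theta>(1)[OF y] by (auto simp: iso_arr_def)
    have "mor E (ob N y) (N0 y) (\<theta> y) \<in> iso_arr (mod_category K A) (ob E (ob N y)) (ob E (N0 y))"
      unfolding iso_arr_def
      using E_hom[OF m n \<theta>a[OF y]] E_hom[OF n m g(1)] E.mor_cmp[OF m n m \<theta>a[OF y] g(1)] E.mor_cmp[OF n m n g(1) \<theta>a[OF y]]
        E.mor_idt[OF m] E.mor_idt[OF n] g(2,3) by auto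
    then show ?thesis by (rule iso_arr_lmod_iso)
  qed
  let ?\<eta> = "\<lambda>y. compose (carrier (ob E (ob N y))) (\<tau> y) (mor E (ob N y) (N0 y) (\<theta> y))"
  show ?thesis
    unfolding mod_naturally_isomorphic_def
  proof (intro exI[of _ ?\<eta>] conjI ballI)
    fix y assume y: "y \<in> Obj \<X>"
    note m = N.ob_closed[OF y] and n = N0[OF y]
    show "?\<eta> y \<in> lmod_iso K A (ob (comp_functor E N) y) (ob (comp_functor (tensor_functor K A (coregular K A)) E) y)"
      using lmod_iso_compose[OF ob_E[OF m] E\<theta>[OF y] \<tau>[OF y]] by (simp add: comp_functor_def tensor_functor_def)
    fix y' k assume y': "y' \<in> Obj \<X>" and k: "k \<in> arr \<X> y y'"
    note m' = N.ob_closed[OF y'] and n' = N0[OF y']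
    note Nk = module_hom_in[OF N.mor_linear[OF y y'] k]
    have "compose (carrier (ob E (ob N y))) (?\<eta> y') (mor E (ob N y) (ob N y') (mor N y y' k))
        = compose (carrier (ob E (ob N y))) (Tm y y' k) (?\<eta> y)"
      unfolding compose_def
    proof (rule restrict_ext)
      fix z assume z: "z \<in> carrier (ob E (ob N y))"
      have "\<tau> y' (mor E (ob N y') (N0 y') (\<theta> y') (mor E (ob N y) (ob N y') (mor N y y' k) z))
          = \<tau> y' (mor E (N0 y) (N0 y') (N0_mor y y' k) (mor E (ob N y) (N0 y) (\<theta> y) z))"
        by (simp only: E_cmp[OF m m' n' Nk \<theta>a[OF y'] z, symmetric] \<theta>(2)[OF y y' k]
            E_cmp[OF m n n' \<theta>a[OF y] N0_mor(1)[OF y y' k] z])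
      also have "\<dots> = Tm y y' k (\<tau> y (mor E (ob N y) (N0 y) (\<theta> y) z))"
        by (rule N0_mor(2)[OF y y' k E_in[OF m n \<theta>a[OF y] z]])
      finally show "(\<lambda>x\<in>carrier (ob E (ob N y')). \<tau> y' (mor E (ob N y') (N0 y') (\<theta> y') x)) (mor E (ob N y) (ob N y') (mor N y y' k) z)
          = Tm y y' k ((\<lambda>x\<in>carrier (ob E (ob N y)). \<tau> y (mor E (ob N y) (N0 y) (\<theta> y) x)) z)"
        using z E_in[OF m m' Nk z] by simp
    qed
    then show "compose (carrier (ob (comp_functor E N) y)) (?\<eta> y') (mor (comp_functor E N) y y' k)
        = compose (carrier (ob (comp_functor E N) y)) (mor (comp_functor (tensor_functor K A (coregular K A)) E) y y' k) (?\<eta> y)"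
      by (simp add: comp_functor_def tensor_functor_def)
  qed
qed

end

section \<open>Existence of copowers\<close>

text \<open>The n-fold direct sum. Extensional functions give every tuple a unique representative;
  the carrier type differs from that of L, and \<open>E_dense\<close> leads back into the
  category.\<close>

definition power_lmod :: "nat \<Rightarrow> ('k, 'a, 'm) lmod \<Rightarrow> ('k, 'a, nat \<Rightarrow> 'm) lmod"
  where "power_lmod n L =
    \<lparr>carrier = {..<n} \<rightarrow>\<^sub>E carrier L, mult = undefined, one = undefined, zero = (\<lambda>i\<in>{..<n}. \<zero>\<^bsub>L\<^esub>),
     add = (\<lambda>f g. \<lambda>i\<in>{..<n}. f i \<oplus>\<^bsub>L\<^esub> g i), smult = (\<lambda>c f. \<lambda>i\<in>{..<n}. c \<odot>\<^bsub>L\<^esub> f i),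
     lact = (\<lambda>a f. \<lambda>i\<in>{..<n}. lact L a (f i))\<rparr>"

lemma power_lmod_simps:
  "carrier (power_lmod n L) = {..<n} \<rightarrow>\<^sub>E carrier L" "\<zero>\<^bsub>power_lmod n L\<^esub> = (\<lambda>i\<in>{..<n}. \<zero>\<^bsub>L\<^esub>)"
  "f \<oplus>\<^bsub>power_lmod n L\<^esub> g = (\<lambda>i\<in>{..<n}. f i \<oplus>\<^bsub>L\<^esub> g i)" "c \<odot>\<^bsub>power_lmod n L\<^esub> f = (\<lambda>i\<in>{..<n}. c \<odot>\<^bsub>L\<^esub> f i)"
  "lact (power_lmod n L) a f = (\<lambda>i\<in>{..<n}. lact L a (f i))"
  by (simp_all add: power_lmod_def)

lemma fd_lmodule_power:
  assumes "fd_lmodule K A L"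
  shows "fd_lmodule K A (power_lmod n L)"
proof -
  interpret L: fd_lmodule K A L by fact
  interpret V: vectorspace K L by (rule L.vectorspace)
  let ?P = "power_lmod n L"
  have mem: "f i \<in> carrier L" if "f \<in> {..<n} \<rightarrow>\<^sub>E carrier L" "i < n" for f i
    using PiE_mem[OF that(1)] that(2) by simp
  have "vectorspace K (map_space {..<n} L ({..<n} \<rightarrow>\<^sub>E carrier L))"
    by (rule vectorspace_map_space[OF L.vectorspace]) (simp_all add: restrict_PiE_iff mem PiE_def[symmetric], simp add: PiE_def)
  then have vs: "vectorspace K ?P" by (rule vectorspace_transfer) (simp_all add: power_lmod_simps)
  obtain k v \<phi> where d: "dual_basis K L k v \<phi>" using dual_basis_exists[OF L.vectorspace L.fin_dim] by blast
  note \<phi> = linear_formD[OF dual_form[OF dual_basisD(2)[OF d]]]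
  have fd: "vectorspace.fin_dim K ?P"
  proof (rule fin_dim_separating[OF vs, of "(\<lambda>(j, i) f. \<phi> j (f i)) ` ({..<k} \<times> {..<n})"])
    show "(\<lambda>(j, i) f. \<phi> j (f i)) ` ({..<k} \<times> {..<n}) \<subseteq> linear_form K ?P"
      by (auto intro!: module_homI simp: power_lmod_simps \<phi> mem)
    fix f assume f: "f \<in> carrier ?P" and z: "\<forall>\<psi>\<in>(\<lambda>(j, i) f. \<phi> j (f i)) ` ({..<k} \<times> {..<n}). \<psi> f = \<zero>\<^bsub>K\<^esub>"
    have "f i = \<zero>\<^bsub>L\<^esub>" if i: "i < n" for i
    proof -
      have fi: "f i \<in> carrier L" using f i by (auto simp: power_lmod_simps)
      have "\<phi> j (f i) = \<zero>\<^bsub>K\<^esub>" if "j < k" for j using z that i by auto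
      then have "finsum L (\<lambda>j. \<phi> j (f i) \<odot>\<^bsub>L\<^esub> v j) {..<k} = finsum L (\<lambda>j. \<zero>\<^bsub>L\<^esub>) {..<k}"
        using dual_basisD(1)[OF d] by (intro V.M.finsum_cong') auto
      then show ?thesis using dual_basisD(4)[OF d fi] by simp
    qed
    then show "f = \<zero>\<^bsub>?P\<^esub>"
      using f by (intro extensionalityI[of f "{..<n}"]) (auto simp: power_lmod_simps PiE_iff)
  qed simp
  show ?thesis
  proof (rule fd_lmodule.intro[OF vs fd], goal_cases)
    case (6 m)
    then show ?case by (intro extensionalityI[of _ "{..<n}"]) (auto simp: power_lmod_simps PiE_iff L.lact_one)
  qed (simp_all add: power_lmod_simps restrict_PiE_iff mem L.lact_closed L.lact_add_left L.lact_add_right L.lact_smult_left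
      L.lact_smult_right L.lact_mult cong: restrict_cong)
qed

context module_realization
begin

text \<open>Finite powers in the category, with their universal property in terms of the
  projections, obtained by realizing the direct sum of n copies of E x.\<close>

lemma power_exists:
  fixes n :: nat
  assumes x: "x \<in> Obj \<X>"
  obtains p pr where "p \<in> Obj \<X>" "\<And>i. i < n \<Longrightarrow> pr i \<in> arr \<X> p x"
    "\<And>z g. z \<in> Obj \<X> \<Longrightarrow> (\<And>i. i < n \<Longrightarrow> g i \<in> arr \<X> z x) \<Longrightarrow> \<exists>q\<in>arr \<X> z p. \<forall>i<n. cmp \<X> z p x (pr i) q = g i"
    "\<And>z q q'. z \<in> Obj \<X> \<Longrightarrow> q \<in> arr \<X> z p \<Longrightarrow> q' \<in> arr \<X> z p \<Longrightarrow>
      (\<And>i. i < n \<Longrightarrow> cmp \<X> z p x (pr i) q = cmp \<X> z p x (pr i) q') \<Longrightarrow> q = q'"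
proof -
  interpret L: fd_lmodule K A "ob E x" using ob_E[OF x] .
  let ?P = "power_lmod n (ob E x)"
  note P = fd_lmodule_power[OF ob_E[OF x], of n]
  obtain p \<sigma> where p: "p \<in> Obj \<X>" and \<sigma>: "\<sigma> \<in> lmod_iso K A (ob E p) ?P" using E_dense[OF P] by blast
  have \<sigma>h: "\<sigma> \<in> lmod_hom K A (ob E p) ?P" using \<sigma> by (simp add: lmod_iso_def)
  have "\<exists>f. f \<in> arr \<X> p x \<and> (\<forall>u\<in>carrier (ob E p). mor E p x f u = \<sigma> u i)" if i: "i < n" for i
  proof -
    have e: "(\<lambda>f. f i) \<in> module_hom K ?P (ob E x)" using i by (intro module_homI) (auto simp: power_lmod_simps)
    have "\<sigma> (lact (ob E p) a u) i = lact (ob E x) a (\<sigma> u i)" if "a \<in> carrier A" "u \<in> carrier (ob E p)" for a u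
      using i by (simp add: lmod_homD(3)[OF \<sigma>h that] power_lmod_simps)
    then show ?thesis using E_full[OF p x module_hom_compose[OF lmod_homD(1)[OF \<sigma>h] e]] by metis
  qed
  then obtain pr where pr: "\<And>i. i < n \<Longrightarrow> pr i \<in> arr \<X> p x"
    "\<And>i u. i < n \<Longrightarrow> u \<in> carrier (ob E p) \<Longrightarrow> mor E p x (pr i) u = \<sigma> u i" by metis
  have ex: "\<exists>q\<in>arr \<X> z p. \<forall>i<n. cmp \<X> z p x (pr i) q = g i"
    if z: "z \<in> Obj \<X>" and g: "\<And>i. i < n \<Longrightarrow> g i \<in> arr \<X> z x" for z g
  proof -
    note Eg = E_hom[OF z x g]
    let ?g = "\<lambda>w. \<lambda>i\<in>{..<n}. mor E z x (g i) w"
    have g1: "?g \<in> module_hom K (ob E z) ?P"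
      by (rule module_homI) (auto simp: power_lmod_simps lmod_homD(4)[OF Eg] module_hom_add[OF lmod_homD(1)[OF Eg]]
          module_hom_smult[OF lmod_homD(1)[OF Eg]] intro!: restrict_ext)
    have g2: "?g (lact (ob E z) a w) = lact ?P a (?g w)" if "a \<in> carrier A" "w \<in> carrier (ob E z)" for a w
      using that by (auto simp: power_lmod_simps lmod_homD(3)[OF Eg] intro!: restrict_ext)
    obtain q where q: "q \<in> arr \<X> z p" "\<And>w. w \<in> carrier (ob E z) \<Longrightarrow> \<sigma> (mor E z p q w) = ?g w"
      using E_iso_lift[OF z p P \<sigma> g1 g2] by blast
    have "cmp \<X> z p x (pr i) q = g i" if i: "i < n" for i
      by (rule E_eqI[OF z x cmp_closed[OF z p x q(1) pr(1)[OF i]] g[OF i]])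
        (simp add: E_cmp[OF z p x q(1) pr(1)[OF i]] pr(2)[OF i E_in[OF z p q(1)]] q(2) i)
    then show ?thesis using q(1) by blast
  qed
  have eqI: "q = q'"
    if z: "z \<in> Obj \<X>" and q: "q \<in> arr \<X> z p" and q': "q' \<in> arr \<X> z p"
      and eq: "\<And>i. i < n \<Longrightarrow> cmp \<X> z p x (pr i) q = cmp \<X> z p x (pr i) q'" for z q q'
  proof (rule E_iso_eqI[OF z p \<sigma> q q'])
    fix w assume w: "w \<in> carrier (ob E z)"
    have "\<sigma> (mor E z p r w) \<in> {..<n} \<rightarrow>\<^sub>E carrier (ob E x)" if "r \<in> arr \<X> z p" for r
      using lmod_homD(4)[OF \<sigma>h E_in[OF z p that w]] by (simp add: power_lmod_simps)
    moreover have "\<sigma> (mor E z p q w) i = \<sigma> (mor E z p q' w) i" if i: "i < n" for i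
      using arg_cong[OF eq[OF i], of "\<lambda>f. mor E z x f w"]
      by (simp only: E_cmp[OF z p x q pr(1)[OF i] w] E_cmp[OF z p x q' pr(1)[OF i] w] pr(2)[OF i E_in[OF z p q w]]
          pr(2)[OF i E_in[OF z p q' w]])
    ultimately show "\<sigma> (mor E z p q w) = \<sigma> (mor E z p q' w)"
      using q q' by (intro PiE_ext[of _ "{..<n}" "\<lambda>_. carrier (ob E x)"]) auto
  qed
  show ?thesis by (rule that[of p pr, OF p pr(1) ex eqI])
qed

end

lemma module_hom_pointwise_finsum:
  assumes W: "vectorspace K W" and "finite I" and "\<And>i. i \<in> I \<Longrightarrow> f i \<in> module_hom K V W"
  shows "(\<lambda>x. finsum W (\<lambda>i. f i x) I) \<in> module_hom K V W"
proof -
  interpret W: vectorspace K W by fact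
  have in_W: "f i x \<in> carrier W" if "i \<in> I" "x \<in> carrier V" for i x using module_hom_in[OF assms(3)] that .
  show ?thesis
  proof (rule module_homI)
    fix x assume x: "x \<in> carrier V"
    show "finsum W (\<lambda>i. f i x) I \<in> carrier W" using in_W x by (intro W.M.finsum_closed) auto
    show "finsum W (\<lambda>i. f i (c \<odot>\<^bsub>V\<^esub> x)) I = c \<odot>\<^bsub>W\<^esub> finsum W (\<lambda>i. f i x) I" if c: "c \<in> carrier K" for c
    proof -
      have "finsum W (\<lambda>i. f i (c \<odot>\<^bsub>V\<^esub> x)) I = finsum W (\<lambda>i. c \<odot>\<^bsub>W\<^esub> f i x) I"
        using in_W x c by (intro W.M.finsum_cong') (auto simp: module_hom_smult[OF assms(3)])
      then show ?thesis using in_W x c assms(2) by (subst W.finsum_smult_ldistr) auto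
    qed
    fix y assume y: "y \<in> carrier V"
    have "finsum W (\<lambda>i. f i (x \<oplus>\<^bsub>V\<^esub> y)) I = finsum W (\<lambda>i. f i x \<oplus>\<^bsub>W\<^esub> f i y) I"
      using in_W x y by (intro W.M.finsum_cong') (auto simp: module_hom_add[OF assms(3)])
    also have "\<dots> = finsum W (\<lambda>i. f i x) I \<oplus>\<^bsub>W\<^esub> finsum W (\<lambda>i. f i y) I"
      using in_W x y by (intro W.M.finsum_addf) auto
    finally show "finsum W (\<lambda>i. f i (x \<oplus>\<^bsub>V\<^esub> y)) I = finsum W (\<lambda>i. f i x) I \<oplus>\<^bsub>W\<^esub> finsum W (\<lambda>i. f i y) I" .
  qed
qed

text \<open>With n the dimension of V, the n-fold power of x is V \<otimes> x: the i-th component of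
  \<beta>(u \<otimes> h) is the scalar \<open>\<phi> i u\<close> times h.\<close>

lemma (in linear_category) copower_of_power:
  fixes V :: "('k, 'v) module" and v :: "nat \<Rightarrow> 'v"
  assumes V: "vectorspace K V" and d: "dual_basis K V n v \<phi>" and x: "x \<in> Obj \<X>" and p: "p \<in> Obj \<X>"
    and pr: "\<And>i. i < n \<Longrightarrow> pr i \<in> arr \<X> p x"
    and ex: "\<And>z g. z \<in> Obj \<X> \<Longrightarrow> (\<And>i. i < n \<Longrightarrow> g i \<in> arr \<X> z x) \<Longrightarrow> \<exists>q\<in>arr \<X> z p. \<forall>i<n. cmp \<X> z p x (pr i) q = g i"
    and eqI: "\<And>z q q'. z \<in> Obj \<X> \<Longrightarrow> q \<in> arr \<X> z p \<Longrightarrow> q' \<in> arr \<X> z p \<Longrightarrow>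
      (\<And>i. i < n \<Longrightarrow> cmp \<X> z p x (pr i) q = cmp \<X> z p x (pr i) q') \<Longrightarrow> q = q'"
  obtains \<beta> where "represents_copower K \<X> V x p \<beta>"
proof -
  let ?VH = "\<lambda>z. space_tensor K V (Hom \<X> z x)"
  let ?pure = "\<lambda>z. space_pure K V (Hom \<X> z x)"
  note H = Hom_vectorspace[OF _ x] and dD = dual_basisD[OF d]
  note \<phi> = dual_form[OF dD(2)]
  have VH: "vectorspace K (?VH z)" if "z \<in> Obj \<X>" for z
    unfolding space_tensor_def by (rule tensor_factors.vectorspace_tensor[OF tensor_factors_space[OF V H[OF that]]])
  have eq_on_pure: "f t = g t"
    if "z \<in> Obj \<X>" "vectorspace K U" "f \<in> module_hom K (?VH z) U" "g \<in> module_hom K (?VH z) U"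
      "\<And>u h. u \<in> carrier V \<Longrightarrow> h \<in> arr \<X> z x \<Longrightarrow> f (?pure z u h) = g (?pure z u h)" "t \<in> carrier (?VH z)"
    for z and U :: "('k, 'u) module" and f g t
    using tensor_factors.tensor_hom_eqI[OF tensor_factors_space[OF V H[OF that(1)]] that(2), of f g t]
      that(3-6) by (simp add: space_tensor_def)
  have pure_l: "(\<lambda>u. ?pure z u h) \<in> module_hom K V (?VH z)" if "z \<in> Obj \<X>" "h \<in> arr \<X> z x" for z h
    using tensor_factors.pure_hom_left[OF tensor_factors_space[OF V H[OF that(1)]], of h] that(2)
    by (simp add: space_tensor_def)
  have pure_r: "?pure z u \<in> module_hom K (Hom \<X> z x) (?VH z)" if "z \<in> Obj \<X>" "u \<in> carrier V" for z u
    using tensor_factors.pure_hom_right[OF tensor_factors_space[OF V H[OF that(1)]], of u] that(2)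
    by (simp add: space_tensor_def)
  have "\<exists>c. c \<in> module_hom K (?VH z) (Hom \<X> z x) \<and>
      (\<forall>u\<in>carrier V. \<forall>h\<in>arr \<X> z x. c (?pure z u h) = \<phi> i u \<odot>\<^bsub>Hom \<X> z x\<^esub> h)"
    if z: "z \<in> Obj \<X>" and i: "i < n" for z i
  proof -
    interpret H: vectorspace K "Hom \<X> z x" using H[OF z] .
    note f = linear_formD[OF \<phi>[OF i]]
    have l: "(\<lambda>u. \<phi> i u \<odot>\<^bsub>Hom \<X> z x\<^esub> h) \<in> module_hom K V (Hom \<X> z x)" if "h \<in> arr \<X> z x" for h
      using that by (intro module_homI) (auto simp: f H.smult_l_distr H.smult_assoc1)
    have r: "(\<lambda>h. \<phi> i u \<odot>\<^bsub>Hom \<X> z x\<^esub> h) \<in> module_hom K (Hom \<X> z x) (Hom \<X> z x)" if "u \<in> carrier V" for u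
      by (rule module_hom_pointwise_smult[OF H[OF z] module_hom_id f(1)[OF that]])
    show ?thesis
      by (rule space_tensor_lift[OF V H[OF z] H[OF z], of "\<lambda>u h. \<phi> i u \<odot>\<^bsub>Hom \<X> z x\<^esub> h", OF l r]) blast+
  qed
  \<comment> \<open>\<open>c z i\<close> contracts the first tensor factor with the coordinate form
    \<open>\<phi> i\<close>.\<close>
  then obtain c where c: "\<And>z i. z \<in> Obj \<X> \<Longrightarrow> i < n \<Longrightarrow> c z i \<in> module_hom K (?VH z) (Hom \<X> z x)"
    "\<And>z i u h. z \<in> Obj \<X> \<Longrightarrow> i < n \<Longrightarrow> u \<in> carrier V \<Longrightarrow> h \<in> arr \<X> z x \<Longrightarrow>
      c z i (?pure z u h) = \<phi> i u \<odot>\<^bsub>Hom \<X> z x\<^esub> h" by metis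
  have cin: "c z i t \<in> arr \<X> z x" if "z \<in> Obj \<X>" "i < n" "t \<in> carrier (?VH z)" for z i t
    using module_hom_in[OF c(1)] that by blast
  have "\<exists>q. q \<in> arr \<X> z p \<and> (\<forall>i<n. cmp \<X> z p x (pr i) q = c z i t)" if "z \<in> Obj \<X>" "t \<in> carrier (?VH z)" for z t
    using ex[OF that(1), of "\<lambda>i. c z i t"] cin[OF that(1) _ that(2)] by blast
  then obtain \<beta> where \<beta>: "\<And>z t. z \<in> Obj \<X> \<Longrightarrow> t \<in> carrier (?VH z) \<Longrightarrow> \<beta> z t \<in> arr \<X> z p"
    "\<And>z t i. z \<in> Obj \<X> \<Longrightarrow> t \<in> carrier (?VH z) \<Longrightarrow> i < n \<Longrightarrow> cmp \<X> z p x (pr i) (\<beta> z t) = c z i t" by metis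
  have \<beta>_eqI: "\<beta> z t = q" if "z \<in> Obj \<X>" "t \<in> carrier (?VH z)" "q \<in> arr \<X> z p"
    "\<And>i. i < n \<Longrightarrow> cmp \<X> z p x (pr i) q = c z i t" for z t q
    using that by (intro eqI[OF that(1) \<beta>(1)[OF that(1,2)] that(3)]) (simp add: \<beta>(2))
  \<comment> \<open>The dual basis expansion in the first tensor factor: the contractions determine
    t, which gives injectivity of \<beta>.\<close>
  have expand: "finsum (?VH z) (\<lambda>i. ?pure z (v i) (c z i t)) {..<n} = t" if z: "z \<in> Obj \<X>" and t: "t \<in> carrier (?VH z)" for z t
  proof (rule eq_on_pure[OF z VH[OF z] _ module_hom_id _ t])
    interpret T: vectorspace K "?VH z" using VH[OF z] .
    show "(\<lambda>t. finsum (?VH z) (\<lambda>i. ?pure z (v i) (c z i t)) {..<n}) \<in> module_hom K (?VH z) (?VH z)"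
      by (rule module_hom_pointwise_finsum[OF VH[OF z]])
        (auto intro: module_hom_compose[OF c(1)[OF z] pure_r[OF z dD(1)]])
    fix u h assume u: "u \<in> carrier V" and h: "h \<in> arr \<X> z x"
    have "finsum (?VH z) (\<lambda>i. ?pure z (v i) (c z i (?pure z u h))) {..<n}
        = finsum (?VH z) (\<lambda>i. \<phi> i u \<odot>\<^bsub>?VH z\<^esub> ?pure z (v i) h) {..<n}"
      using u h dD(5)[OF _ u] module_hom_in[OF pure_r[OF z dD(1)] h]
      by (intro T.M.finsum_cong') (auto simp: c(2)[OF z] module_hom_smult[OF pure_r[OF z dD(1)]])
    also have "\<dots> = ?pure z u h" by (rule dual_basis_expand[OF V VH[OF z] d pure_l[OF z h] u, symmetric])
    finally show "finsum (?VH z) (\<lambda>i. ?pure z (v i) (c z i (?pure z u h))) {..<n} = ?pure z u h" .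
  qed
  have "represents_copower K \<X> V x p \<beta>"
    unfolding represents_copower_def
  proof (intro conjI p ballI)
    fix z assume z: "z \<in> Obj \<X>"
    interpret T: vectorspace K "?VH z" using VH[OF z] .
    interpret H: vectorspace K "Hom \<X> z x" using H[OF z] .
    note Hp = Hom_vectorspace[OF z p]
    show "\<beta> z \<in> module_hom K (?VH z) (Hom \<X> z p)"
    proof (rule module_homI)
      fix t assume t: "t \<in> carrier (?VH z)"
      show "\<beta> z t \<in> arr \<X> z p" by (rule \<beta>(1)[OF z t])
      show "\<beta> z (k \<odot>\<^bsub>?VH z\<^esub> t) = k \<odot>\<^bsub>Hom \<X> z p\<^esub> \<beta> z t" if k: "k \<in> carrier K" for k
        by (rule \<beta>_eqI[OF z T.smult_closed[OF k t] vectorspace_smult[OF Hp k \<beta>(1)[OF z t]]])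
          (simp only: module_hom_smult[OF postcomp_linear[OF z p x pr] k \<beta>(1)[OF z t]] \<beta>(2)[OF z t] module_hom_smult[OF c(1)[OF z] k t])
      fix s assume s: "s \<in> carrier (?VH z)"
      show "\<beta> z (t \<oplus>\<^bsub>?VH z\<^esub> s) = \<beta> z t \<oplus>\<^bsub>Hom \<X> z p\<^esub> \<beta> z s"
        by (rule \<beta>_eqI[OF z T.M.a_closed[OF t s] vectorspace_add[OF Hp \<beta>(1)[OF z t] \<beta>(1)[OF z s]]])
          (simp only: module_hom_add[OF postcomp_linear[OF z p x pr] \<beta>(1)[OF z t] \<beta>(1)[OF z s]] \<beta>(2)[OF z t] \<beta>(2)[OF z s]
            module_hom_add[OF c(1)[OF z] t s])
    qed
    show "bij_betw (\<beta> z) (carrier (?VH z)) (arr \<X> z p)"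
    proof (rule bij_betw_imageI)
      show "inj_on (\<beta> z) (carrier (?VH z))"
      proof (rule inj_onI)
        fix s t assume s: "s \<in> carrier (?VH z)" and t: "t \<in> carrier (?VH z)" and eq: "\<beta> z s = \<beta> z t"
        have cst: "c z i s = c z i t" if "i < n" for i using \<beta>(2)[OF z s that] \<beta>(2)[OF z t that] eq by simp
        have "finsum (?VH z) (\<lambda>i. ?pure z (v i) (c z i s)) {..<n} = finsum (?VH z) (\<lambda>i. ?pure z (v i) (c z i t)) {..<n}"
          using module_hom_in[OF pure_r[OF z dD(1)] cin[OF z _ t]] by (intro T.M.finsum_cong') (auto simp: cst)
        then show "s = t" by (simp only: expand[OF z s] expand[OF z t])
      qed
      show "\<beta> z ` carrier (?VH z) = arr \<X> z p"
      proof (intro equalityI subsetI)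
        fix q assume q: "q \<in> arr \<X> z p"
        note pq = cmp_closed[OF z p x q pr]
        \<comment> \<open>The inverse of \<open>\<beta> z\<close> at q: the components of q placed
          on the basis vectors of V.\<close>
        let ?t = "finsum (?VH z) (\<lambda>i. ?pure z (v i) (cmp \<X> z p x (pr i) q)) {..<n}"
        have pv: "?pure z (v i) (cmp \<X> z p x (pr i) q) \<in> carrier (?VH z)" if "i < n" for i
          by (rule module_hom_in[OF pure_r[OF z dD(1)[OF that]] pq[OF that]])
        have t: "?t \<in> carrier (?VH z)" using pv by (intro T.M.finsum_closed) auto
        have "cmp \<X> z p x (pr k) q = c z k ?t" if k: "k < n" for k
        proof -
          have "c z k ?t = finsum (Hom \<X> z x) (\<lambda>i. c z k (?pure z (v i) (cmp \<X> z p x (pr i) q))) {..<n}"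
            using pv by (intro module_hom_finsum[OF VH[OF z] H[OF z] c(1)[OF z k]]) auto
          also have "\<dots> = finsum (Hom \<X> z x) (\<lambda>i. if k = i then cmp \<X> z p x (pr i) q else \<zero>\<^bsub>Hom \<X> z x\<^esub>) {..<n}"
            using pq k by (intro H.M.finsum_cong') (auto simp: c(2)[OF z k dD(1) pq] dD(3))
          also have "\<dots> = cmp \<X> z p x (pr k) q"
            using pq k by (intro H.M.add.finprod_singleton) auto
          finally show ?thesis by simp
        qed
        then have "\<beta> z ?t = q" by (intro \<beta>_eqI[OF z t q]) auto
        then show "q \<in> \<beta> z ` carrier (?VH z)" using imageI[OF t, of "\<beta> z"] by simp
      qed (use \<beta>(1)[OF z] in auto)
    qed
  next
    fix z z' f t assume z: "z \<in> Obj \<X>" and z': "z' \<in> Obj \<X>" and f: "f \<in> arr \<X> z' z" and t: "t \<in> carrier (?VH z)"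
    let ?S = "space_tensor_map K V (Hom \<X> z x) V (Hom \<X> z' x) (\<lambda>v. v) (\<lambda>h. cmp \<X> z' z x h f)"
    note S = space_tensor_map_characterization[OF V H[OF z] V H[OF z'] module_hom_id precomp_linear[OF z' z x f]]
    have cS: "c z' i (?S t) = cmp \<X> z' z x (c z i t) f" if i: "i < n" for i
    proof (rule eq_on_pure[OF z H[OF z'] module_hom_compose[OF S(1) c(1)[OF z' i]]
          module_hom_compose[OF c(1)[OF z i] precomp_linear[OF z' z x f]] _ t])
      fix u h assume u: "u \<in> carrier V" and h: "h \<in> arr \<X> z x"
      show "c z' i (?S (?pure z u h)) = cmp \<X> z' z x (c z i (?pure z u h)) f"
        by (simp only: S(2)[OF u h] c(2)[OF z' i u cmp_closed[OF z' z x f h]] c(2)[OF z i u h]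
            module_hom_smult[OF precomp_linear[OF z' z x f] dD(5)[OF i u] h])
    qed
    show "\<beta> z' (?S t) = cmp \<X> z' z p (\<beta> z t) f"
      by (rule \<beta>_eqI[OF z' module_hom_in[OF S(1) t] cmp_closed[OF z' z p f \<beta>(1)[OF z t]]])
        (simp only: cmp_assoc[OF z' z p x f \<beta>(1)[OF z t] pr] \<beta>(2)[OF z t] cS)
  qed
  then show ?thesis using that by blast
qed

text \<open>Object and representing isomorphism are paired so that one choice function in V and x
  delivers both.\<close>

lemma (in module_realization) copower_choice_exists:
  obtains P :: "('k, 'v) module \<Rightarrow> 'o \<Rightarrow> 'o" and \<beta> where "copower_choice K \<X> P \<beta>"
proof -
  have "\<exists>pb. represents_copower K \<X> V x (fst pb) (snd pb)"
    if x: "x \<in> Obj \<X>" and V: "vectorspace K V" "vectorspace.fin_dim K V" for V :: "('k, 'v) module" and x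
  proof -
    obtain n v \<phi> where d: "dual_basis K V n v \<phi>" using dual_basis_exists[OF V] by blast
    obtain p pr where p: "p \<in> Obj \<X>" "\<And>i. i < n \<Longrightarrow> pr i \<in> arr \<X> p x"
      "\<And>z g. z \<in> Obj \<X> \<Longrightarrow> (\<And>i. i < n \<Longrightarrow> g i \<in> arr \<X> z x) \<Longrightarrow> \<exists>q\<in>arr \<X> z p. \<forall>i<n. cmp \<X> z p x (pr i) q = g i"
      "\<And>z q q'. z \<in> Obj \<X> \<Longrightarrow> q \<in> arr \<X> z p \<Longrightarrow> q' \<in> arr \<X> z p \<Longrightarrow>
      (\<And>i. i < n \<Longrightarrow> cmp \<X> z p x (pr i) q = cmp \<X> z p x (pr i) q') \<Longrightarrow> q = q'"
      by (rule power_exists[OF x, of n]) blast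
    obtain \<beta> where "represents_copower K \<X> V x p \<beta>"
      by (rule copower_of_power[OF V(1) d x p])
    then show ?thesis by (intro exI[of _ "(p, \<beta>)"]) simp
  qed
  then have "\<forall>V x. \<exists>pb. x \<in> Obj \<X> \<longrightarrow> vectorspace K V \<and> vectorspace.fin_dim K V \<longrightarrow>
      represents_copower K \<X> (V :: ('k, 'v) module) x (fst pb) (snd pb)" by blast
  then obtain pb where pb: "\<And>V x. x \<in> Obj \<X> \<Longrightarrow> vectorspace K V \<and> vectorspace.fin_dim K V \<Longrightarrow>
      represents_copower K \<X> (V :: ('k, 'v) module) x (fst (pb V x)) (snd (pb V x))" by metis
  have "copower_choice K \<X> (\<lambda>V x. fst (pb V x)) (\<lambda>V x. snd (pb V x))"
    unfolding copower_choice_def using pb by simp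
  then show ?thesis by (rule that)
qed

section \<open>The right Nakayama functor\<close>

text \<open>A coend is determined only up to isomorphism, so the claim covers every functor with the
  universal property, and the first conjunct guarantees that there is one. The comparison is made
  after applying E, because the tensor functor takes values in modules and not in objects of the
  category.\<close>

theorem lemma3p15:
  fixes K :: "'k ring" and A :: "('k, 'a) module" and \<X> :: "('o, 'm, 'k) lcat"
    and E :: "('o, 'm, ('k, 'a, nat \<Rightarrow> 'k) lmod, (nat \<Rightarrow> 'k) \<Rightarrow> (nat \<Rightarrow> 'k)) functr"
  assumes "algebraically_closed K"
    and "fd_algebra K A"
    and "linear_category K \<X>"
    and "linear_equivalence K \<X> (mod_category K A) E"
  shows "(\<exists>N. right_nakayama K \<X> N)
    \<and> (\<forall>N. right_nakayama K \<X> N \<longrightarrow>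
          mod_naturally_isomorphic K A \<X>
            (comp_functor E N)
            (comp_functor (tensor_functor K A (coregular K A)) E))"
proof (intro conjI allI impI)
  interpret module_realization K A \<X> E by (rule module_realizationI[OF assms(2-4)])
  obtain P :: "('k, 'm \<Rightarrow> 'k) module \<Rightarrow> 'o \<Rightarrow> 'o" and \<beta> where "copower_choice K \<X> P \<beta>"
    by (rule copower_choice_exists)
  then interpret nakayama_integrand K \<X> P \<beta>
    by (intro nakayama_integrand.intro nakayama_integrand_axioms.intro linear_category_axioms fin_dim_Hom)
  show "\<exists>N. right_nakayama K \<X> N"
    using right_nakayama_of_family_functor[OF family_functor_N0] by blast
next
  interpret module_realization K A \<X> E by (rule module_realizationI[OF assms(2-4)])
  fix N assume "right_nakayama K \<X> N"
  \<comment> \<open>An arbitrary candidate, with a copower choice of its own, becomes a family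
    functor and can be compared with the explicit one.\<close>
  then obtain \<Theta> where N: "family_functor K \<X> N \<Theta>"
    using family_functor_of_right_nakayama[OF assms(3) fin_dim_Hom] by blast
  show "mod_naturally_isomorphic K A \<X> (comp_functor E N) (comp_functor (tensor_functor K A (coregular K A)) E)"
    using N family_functors_isomorphic[OF N family_functor_N0]
    by (intro naturally_isomorphic_tensor) (auto simp: family_functor_def)
qed

end
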